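(* Let $(X,\mu_{uv})$ be a countable, connected, symmetrically weighted graph satisfying $V(D_X,r_0)$ and $P(P_X,r_0)$ for some $r_0\in(0,\infty]$. Let $P$ be the associated Markov operator, and assume that its spectrum on $\ell^2(X,m)$ satisfies $\sigma(P)\subset(a,1]$ with $a\in(-1,1)$. Let $s\in(0,1]$ with $1-a\le 2s$. Then there is a constant $C_4>0$ such that for every $r$ with $0<r<r_0$, every $\psi:\mathbb N\to\mathbb R_+$, every $F\in\mathcal F(s,r,\psi)$, and all $w_1,w_2\in X$ and $q\in\mathbb N$ with $d_X(w_1,w_2)=2r+q$, $$\sup_{(u,v)\in B_{r/2}(w_1)\times B_{r/2}(w_2)}|k(u,v)|\le\frac{C_4}{\sqrt{m(B_r(w_1))\,m(B_r(w_2))}}\,\psi(q),$$ where $k$ is the kernel of $K_F=F(I-P)$ with respect to $m$.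
   Context: Graph: $X$ is a countable set with a symmetric weight $\mu_{uv}=\mu_{vu}\ge0$; $u\sim v$ iff $\mu_{uv}>0$; the graph is connected; $m(u)=\sum_v\mu_{uv}\in(0,\infty)$, $m(E)=\sum_{u\in E}m(u)$; $d_X$ is the shortest-path distance and $B_r(u)=\{v:d_X(u,v)<r\}$. $|\nabla_X h(u)|^2=\frac1{m(u)}\sum_v\mu_{uv}(h(u)-h(v))^2$. $V(D_X,r_0)$: $m(B_{2r}(u))\le D_X\,m(B_r(u))$ for all $u\in X$, $0<r<r_0$. $P(P_X,r_0)$: $\sum_{v\in B_r(u)}|f(v)-f_{u,r}|^2m(v)\le P_Xr^2\sum_{v\in B_{2r}(u)}|\nabla_Xf(v)|^2m(v)$ for all $f:X\to\mathbb R$, $u\in X$, $0<r<r_0$, where $f_{u,r}$ is the $m$-average of $f$ over $B_r(u)$. Markov kernel: $P(u,v)=\mu_{uv}/m(u)$, $P^0(u,v)=\delta_u(v)$, $P^n(u,v)=\sum_wP(u,w)P^{n-1}(w,v)$, $p^n(u,v)=P^n(u,v)/m(v)$; $P$ acts on $\ell^2(X,m)$ as the self-adjoint operator $Pf(u)=\sum_vP(u,v)f(v)$. Functions of $I-P$: $F$ is real analytic at $1$ with $F(1-t)=\sum_{n\ge0}a_nt^n$ and $\sum_n|a_n|<\infty$. Then $K_F=F(I-P)=\sum_na_nP^n$, with kernel $k(u,v)=\sum_na_np^n(u,v)$, so that $K_Ff(u)=\sum_vk(u,v)f(v)m(v)$. Class $\mathcal F(s,r,\psi)$: let $\beta$ be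 the measure on $\mathbb Z$ with $\beta(\pm1)=1/2$, let $\beta_s=(1-s)\delta_0+s\beta$, and let $\beta_s^{(n)}$ be its $n$-th convolution power ($\beta_s^{(0)}=\delta_0$). For $F$ real analytic at $1$ with $F(1-t)=\sum_{n\ge0}a_nt^n$ and $\sum_n|a_n|<\infty$, and for $j\in\mathbb N=\{0,1,2,\dots\}$, put $f_{s,j}=\sum_na_n(\delta_0-\beta_s)^{*j}*\beta_s^{(n)}$, a function on $\mathbb Z$. For $\psi:\mathbb N\to\mathbb R_+$, $F\in\mathcal F(s,r,\psi)$ iff for all $j,q\in\mathbb N$, $\sum_{m\in\mathbb Z,\,|m|\ge q}|f_{s,j}(m)|\le\left(\frac{2j}{r}\right)^{2j}\psi(q)$ (with $0^0=1$). *)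

theory Defs
  imports "HOL-Analysis.Analysis"
begin

section \<open>Weighted graphs\<close>

text \<open>
  The vertex set is the whole type, whose countability is part of \<open>weighted_graph\<close>.
  Local finiteness is not assumed, and loops are allowed.  Sums of nonnegative terms that are not
  known in advance to be finite (volumes, Dirichlet energies) take values in \<open>ennreal\<close>.
\<close>

definition adj :: "('a \<Rightarrow> 'a \<Rightarrow> real) \<Rightarrow> ('a \<times> 'a) set" where
  "adj \<mu> = {(u, v). \<mu> u v > 0}"

definition vm :: "('a \<Rightarrow> 'a \<Rightarrow> real) \<Rightarrow> 'a \<Rightarrow> real" where
  "vm \<mu> u = (\<Sum>\<^sub>\<infinity>v. \<mu> u v)"

definition weighted_graph :: "('a \<Rightarrow> 'a \<Rightarrow> real) \<Rightarrow> bool" where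
  "weighted_graph \<mu> \<longleftrightarrow>
     countable (UNIV :: 'a set) \<and>
     (\<forall>u v. \<mu> u v = \<mu> v u) \<and>
     (\<forall>u v. 0 \<le> \<mu> u v) \<and>
     (\<forall>u. \<mu> u summable_on UNIV \<and> 0 < vm \<mu> u) \<and>
     (\<forall>u v. (u, v) \<in> (adj \<mu>)\<^sup>*)"

definition vol :: "('a \<Rightarrow> 'a \<Rightarrow> real) \<Rightarrow> 'a set \<Rightarrow> ennreal" where
  "vol \<mu> E = (\<Sum>\<^sub>\<infinity>u\<in>E. ennreal (vm \<mu> u))"

definition gdist :: "('a \<Rightarrow> 'a \<Rightarrow> real) \<Rightarrow> 'a \<Rightarrow> 'a \<Rightarrow> nat" where
  "gdist \<mu> u v = (LEAST n. (u, v) \<in> adj \<mu> ^^ n)"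

definition gball :: "('a \<Rightarrow> 'a \<Rightarrow> real) \<Rightarrow> real \<Rightarrow> 'a \<Rightarrow> 'a set" where
  "gball \<mu> r u = {v. real (gdist \<mu> u v) < r}"

definition grad_sq :: "('a \<Rightarrow> 'a \<Rightarrow> real) \<Rightarrow> ('a \<Rightarrow> real) \<Rightarrow> 'a \<Rightarrow> ennreal" where
  "grad_sq \<mu> h u = ennreal (1 / vm \<mu> u) * (\<Sum>\<^sub>\<infinity>v. ennreal (\<mu> u v * (h u - h v)\<^sup>2))"

definition ball_avg :: "('a \<Rightarrow> 'a \<Rightarrow> real) \<Rightarrow> ('a \<Rightarrow> real) \<Rightarrow> 'a \<Rightarrow> real \<Rightarrow> real" where
  "ball_avg \<mu> f u r =
     (\<Sum>\<^sub>\<infinity>v\<in>gball \<mu> r u. f v * vm \<mu> v) / enn2real (vol \<mu> (gball \<mu> r u))"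

definition vol_doubling :: "('a \<Rightarrow> 'a \<Rightarrow> real) \<Rightarrow> real \<Rightarrow> ereal \<Rightarrow> bool" where
  "vol_doubling \<mu> D r0 \<longleftrightarrow>
     (\<forall>u r. 0 < r \<and> ereal r < r0 \<longrightarrow>
        vol \<mu> (gball \<mu> (2 * r) u) \<le> ennreal D * vol \<mu> (gball \<mu> r u))"

text \<open>
  \<open>ball_avg\<close> is a genuine average only on balls where \<open>f\<close> is summable against \<open>m\<close>.  Under
  \<open>vol_doubling\<close> this is no restriction: if \<open>r0 > 1/2\<close>, doubling at a radius in \<open>(1/2, 1]\<close> bounds
  the vertex degrees, so that all balls are finite, and if \<open>r0 \<le> 1/2\<close> all balls concerned are
  singletons.
\<close>

definition poincare :: "('a \<Rightarrow> 'a \<Rightarrow> real) \<Rightarrow> real \<Rightarrow> ereal \<Rightarrow> bool" where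
  "poincare \<mu> PX r0 \<longleftrightarrow>
     (\<forall>f u r. 0 < r \<and> ereal r < r0 \<longrightarrow>
        (\<Sum>\<^sub>\<infinity>v\<in>gball \<mu> r u. ennreal (\<bar>f v - ball_avg \<mu> f u r\<bar>\<^sup>2 * vm \<mu> v))
        \<le> ennreal (PX * r\<^sup>2) *
           (\<Sum>\<^sub>\<infinity>v\<in>gball \<mu> (2 * r) u. grad_sq \<mu> f v * ennreal (vm \<mu> v)))"

section \<open>The Markov kernel and the Markov operator\<close>

definition markov :: "('a \<Rightarrow> 'a \<Rightarrow> real) \<Rightarrow> 'a \<Rightarrow> 'a \<Rightarrow> real" where
  "markov \<mu> u v = \<mu> u v / vm \<mu> u"

fun markov_pow :: "('a \<Rightarrow> 'a \<Rightarrow> real) \<Rightarrow> nat \<Rightarrow> 'a \<Rightarrow> 'a \<Rightarrow> real" where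
  "markov_pow \<mu> 0 u v = (if u = v then 1 else 0)"
| "markov_pow \<mu> (Suc n) u v = (\<Sum>\<^sub>\<infinity>w. markov \<mu> u w * markov_pow \<mu> n w v)"

definition markov_density :: "('a \<Rightarrow> 'a \<Rightarrow> real) \<Rightarrow> nat \<Rightarrow> 'a \<Rightarrow> 'a \<Rightarrow> real" where
  "markov_density \<mu> n u v = markov_pow \<mu> n u v / vm \<mu> v"

text \<open>The spectrum is taken in the complex Hilbert space \<open>\<ell>\<^sup>2(X, m)\<close>.\<close>

definition l2 :: "('a \<Rightarrow> 'a \<Rightarrow> real) \<Rightarrow> ('a \<Rightarrow> complex) set" where
  "l2 \<mu> = {f. (\<lambda>v. (cmod (f v))\<^sup>2 * vm \<mu> v) summable_on UNIV}"

definition l2_norm :: "('a \<Rightarrow> 'a \<Rightarrow> real) \<Rightarrow> ('a \<Rightarrow> complex) \<Rightarrow> real" where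
  "l2_norm \<mu> f = sqrt (\<Sum>\<^sub>\<infinity>v. (cmod (f v))\<^sup>2 * vm \<mu> v)"

definition markov_op :: "('a \<Rightarrow> 'a \<Rightarrow> real) \<Rightarrow> ('a \<Rightarrow> complex) \<Rightarrow> 'a \<Rightarrow> complex" where
  "markov_op \<mu> f u = (\<Sum>\<^sub>\<infinity>v. complex_of_real (markov \<mu> u v) * f v)"

definition l2_bounded_linear ::
    "('a \<Rightarrow> 'a \<Rightarrow> real) \<Rightarrow> (('a \<Rightarrow> complex) \<Rightarrow> 'a \<Rightarrow> complex) \<Rightarrow> bool" where
  "l2_bounded_linear \<mu> T \<longleftrightarrow>
     (\<forall>f\<in>l2 \<mu>. T f \<in> l2 \<mu>) \<and>
     (\<forall>f\<in>l2 \<mu>. \<forall>g\<in>l2 \<mu>. T (\<lambda>v. f v + g v) = (\<lambda>v. T f v + T g v)) \<and>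
     (\<forall>c. \<forall>f\<in>l2 \<mu>. T (\<lambda>v. c * f v) = (\<lambda>v. c * T f v)) \<and>
     (\<exists>K. \<forall>f\<in>l2 \<mu>. l2_norm \<mu> (T f) \<le> K * l2_norm \<mu> f)"

definition l2_spectrum ::
    "('a \<Rightarrow> 'a \<Rightarrow> real) \<Rightarrow> (('a \<Rightarrow> complex) \<Rightarrow> 'a \<Rightarrow> complex) \<Rightarrow> complex set" where
  "l2_spectrum \<mu> T =
     {z. \<not> (\<exists>R. l2_bounded_linear \<mu> R \<and>
              (\<forall>f\<in>l2 \<mu>. R (\<lambda>v. z * f v - T f v) = f \<and> (\<lambda>v. z * R f v - T (R f) v) = f))}"

section \<open>Functions of \<open>I - P\<close>\<close>

definition coeff_at_1 :: "(real \<Rightarrow> real) \<Rightarrow> nat \<Rightarrow> real" where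
  "coeff_at_1 F n = (deriv ^^ n) (\<lambda>t. F (1 - t)) 0 / fact n"

text \<open>
  \<open>F\<close> is real analytic at 1, \<open>F(1 - t) = \<Sum>\<^sub>n a\<^sub>n t\<^sup>n\<close> near \<open>t = 0\<close>, and \<open>\<Sum>\<^sub>n \<bar>a\<^sub>n\<bar> < \<infinity>\<close>.
  The values of \<open>F\<close> away from 1 are irrelevant: \<open>F(I - P)\<close> is by definition \<open>\<Sum>\<^sub>n a\<^sub>n P\<^sup>n\<close>.
\<close>

definition abs_analytic_at_1 :: "(real \<Rightarrow> real) \<Rightarrow> bool" where
  "abs_analytic_at_1 F \<longleftrightarrow>
     (\<lambda>t. F (1 - t)) has_fps_expansion Abs_fps (coeff_at_1 F) \<and>
     summable (\<lambda>n. \<bar>coeff_at_1 F n\<bar>)"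

lemma has_fps_expansion_real_taylor:
  fixes f :: "real \<Rightarrow> real"
  assumes "f has_fps_expansion A"
  shows "fps_nth A n = (deriv ^^ n) f 0 / fact n"
  using assms
proof (induction n arbitrary: f A)
  case 0
  then have "eval_fps A 0 = f 0"
    unfolding has_fps_expansion_def using eventually_nhds_x_imp_x by blast
  then show ?case
    by (simp add: eval_fps_at_0)
next
  case (Suc n)
  have "fps_nth (fps_deriv A) n = (deriv ^^ n) (deriv f) 0 / fact n"
    by (intro Suc.IH has_fps_expansion_deriv Suc.prems)
  moreover have "(deriv ^^ Suc n) f = (deriv ^^ n) (deriv f)"
    by (simp add: funpow_swap1)
  ultimately show ?case
    by (simp add: field_simps del: of_nat_Suc funpow.simps)
qed

lemma abs_analytic_at_1_iff:
  "abs_analytic_at_1 F \<longleftrightarrow>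
     (\<exists>a. (\<lambda>t. F (1 - t)) has_fps_expansion Abs_fps a \<and> summable (\<lambda>n. \<bar>a n\<bar>))"
proof
  assume "\<exists>a. (\<lambda>t. F (1 - t)) has_fps_expansion Abs_fps a \<and> summable (\<lambda>n. \<bar>a n\<bar>)"
  then obtain a where a: "(\<lambda>t. F (1 - t)) has_fps_expansion Abs_fps a" "summable (\<lambda>n. \<bar>a n\<bar>)"
    by blast
  have "a = coeff_at_1 F"
    using has_fps_expansion_real_taylor[OF a(1)] by (auto simp: coeff_at_1_def)
  with a show "abs_analytic_at_1 F"
    by (simp add: abs_analytic_at_1_def)
qed (auto simp: abs_analytic_at_1_def)

text \<open>The kernel of \<open>K\<^sub>F = F(I - P)\<close> with respect to \<open>m\<close>.\<close>

definition kernel_of :: "('a \<Rightarrow> 'a \<Rightarrow> real) \<Rightarrow> (real \<Rightarrow> real) \<Rightarrow> 'a \<Rightarrow> 'a \<Rightarrow> real" where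
  "kernel_of \<mu> F u v = (\<Sum>n. coeff_at_1 F n * markov_density \<mu> n u v)"

section \<open>The class \<open>\<F>(s, r, \<psi>)\<close>\<close>

definition delta0 :: "int \<Rightarrow> real" where
  "delta0 k = (if k = 0 then 1 else 0)"

definition conv :: "(int \<Rightarrow> real) \<Rightarrow> (int \<Rightarrow> real) \<Rightarrow> int \<Rightarrow> real" where
  "conv g h k = (\<Sum>\<^sub>\<infinity>i. g i * h (k - i))"

fun conv_pow :: "(int \<Rightarrow> real) \<Rightarrow> nat \<Rightarrow> int \<Rightarrow> real" where
  "conv_pow g 0 = delta0"
| "conv_pow g (Suc n) = conv g (conv_pow g n)"

definition step :: "int \<Rightarrow> real" where
  "step k = (if k = 1 \<or> k = -1 then 1 / 2 else 0)"

definition lazy_step :: "real \<Rightarrow> int \<Rightarrow> real" where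
  "lazy_step s k = (1 - s) * delta0 k + s * step k"

definition f_sj :: "(real \<Rightarrow> real) \<Rightarrow> real \<Rightarrow> nat \<Rightarrow> int \<Rightarrow> real" where
  "f_sj F s j k =
     (\<Sum>n. coeff_at_1 F n *
        conv (conv_pow (\<lambda>i. delta0 i - lazy_step s i) j) (conv_pow (lazy_step s) n) k)"

definition class_F :: "real \<Rightarrow> real \<Rightarrow> (nat \<Rightarrow> real) \<Rightarrow> (real \<Rightarrow> real) set" where
  "class_F s r \<psi> =
     {F. abs_analytic_at_1 F \<and>
         (\<forall>j q. (\<Sum>\<^sub>\<infinity>k\<in>{k. int q \<le> \<bar>k\<bar>}. ennreal \<bar>f_sj F s j k\<bar>)
                 \<le> ennreal ((2 * real j / r) ^ (2 * j) * \<psi> q))}"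

end

theory Submission
  imports Defs
begin

text \<open>
  Let \<open>n \<sim> r / M\<close> and let \<open>S\<^sub>n(P) = (1 - T\<^sub>n(P)) / (1 - P)\<close> be the Fejer kernel built from the Chebyshev
  polynomials. Then \<open>\<Phi> = S\<^sub>n / n\<^sup>2\<close> and \<open>H = (1 - \<Phi>) / (n\<^sup>2 (1 - P))\<close> are bounded operators of range less than
  \<open>n\<close>, so are \<open>n\<^sup>2 (1 - P) \<Phi>\<close> and \<open>n\<^sup>2 (1 - P) H\<close>, and \<open>1 = (\<Phi> + n\<^sup>2 (1 - P) H)\<^sup>M\<close>. Inserting this partition of
  unity on both sides of \<open>F(I - P)\<close> writes the kernel at \<open>(u, v)\<close> as a sum of matrix coefficients of
  \<open>(r\<^sup>2 (I - P))\<^sup>l F(I - P)\<close> between vectors \<open>W \<delta>\<^sub>u\<close> and \<open>W' \<delta>\<^sub>v\<close> with \<open>W, W'\<close> products of \<open>M\<close> factors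
  \<open>\<Phi>, H\<close>. Since \<open>(P - (1 - s)) / s\<close> is a contraction and its Chebyshev polynomials have finite propagation
  speed, only \<open>f\<^sub>s\<^sub>,\<^sub>l(m)\<close> with \<open>\<bar>m\<bar> \<ge> q\<close> contributes, and membership in \<open>class_F s r \<psi>\<close> is used for finitely
  many \<open>l\<close>.

  There remains \<open>\<parallel>W \<delta>\<^sub>u\<parallel>\<^sup>2 \<le> C / m(B\<^sub>r(u))\<close>. As \<open>W\<close> has short range, \<open>P\<close> may be replaced by its restriction to
  the ball of radius \<open>r / 2\<close> with Dirichlet boundary condition, for which doubling and the Poincare
  inequality give a Nash inequality and hence on-diagonal decay of the powers of \<open>(2 + P) / 3\<close>, with no tails
  to control. The \<open>M\<close> factors of \<open>W\<close> turn this decay into a bound at scale \<open>r\<close> as soon as \<open>M\<close> exceeds a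
  multiple of the doubling dimension.
\<close>

section \<open>Chebyshev and Fejer polynomials\<close>

text \<open>No spectral theorem is used. Only polynomials in P act, on finitely supported vectors,
  and the operator bounds come from identities that write a polynomial as a sum of squares with
  positive weights such as 1 - y and 1 + y. The spectrum enters once, as the form bound P >= a,
  which with 1 - a <= 2s gives (P - (1 - s)) / s >= -1.

  The obstacle is that a point mass has squared norm 1 / m(u), possibly far above 1 / m(B_r(u)),
  while F(I - P) itself need not smooth. All smoothing comes from the inserted partition, at the
  price of up to 2M factors n^2 (1 - P). The factor (2j / r)^(2j) in the class pays for them,
  because n <= 3r.

  The doubling constant is enlarged to the form 2 * 4^(M - 1). Each factor of W gains a ratio 4 per
  dyadic scale, and the extra 2 keeps every ratio that occurs outside (1/2, 2), so that no logarithm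
  appears in the geometric sums.\<close>

fun cheb :: "'b::comm_ring_1 \<Rightarrow> nat \<Rightarrow> 'b" where
  "cheb y 0 = 1"
| "cheb y (Suc 0) = y"
| "cheb y (Suc (Suc n)) = 2 * y * cheb y (Suc n) - cheb y n"

text \<open>For y = cos t and \<open>U\<close> = sin(nt) / sin t these are the addition formula and
  cos^2 + sin^2 = 1. The second one certifies that 1 - T_n^2 is 1 - y^2 times a square; the first is
  carried along so that the induction closes.\<close>

lemma cheb_pell:
  "\<exists>U. cheb y (Suc n) = y * cheb y n - (1 - y * y) * U \<and>
       cheb y n * cheb y n + (1 - y * y) * (U * U) = 1"
proof (induction n)
  case 0
  show ?case by (rule exI[of _ 0]) simp
next
  case (Suc n)
  then obtain U where U: "cheb y (Suc n) = y * cheb y n - (1 - y * y) * U"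
      "cheb y n * cheb y n + (1 - y * y) * (U * U) = 1" by blast
  have 1: "cheb y (Suc (Suc n)) = y * cheb y (Suc n) - (1 - y * y) * (y * U + cheb y n)"
    unfolding cheb.simps(3) U(1) by (simp add: algebra_simps)
  have "cheb y (Suc n) * cheb y (Suc n) + (1 - y * y) * ((y * U + cheb y n) * (y * U + cheb y n))
      = cheb y n * cheb y n + (1 - y * y) * (U * U)"
    unfolding U(1) by (simp add: algebra_simps)
  with 1 U(2) show ?case by metis
qed

definition cheb_dirichlet :: "'b::comm_ring_1 \<Rightarrow> nat \<Rightarrow> 'b" where
  "cheb_dirichlet y k = 1 + 2 * (\<Sum>i<k. cheb y (Suc i))"

text \<open>At y = cos t this is (1 - cos nt) / (1 - cos t), which is n times the usual Fejer
  kernel, with value n^2 at y = 1.\<close>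

definition cheb_fejer :: "'b::comm_ring_1 \<Rightarrow> nat \<Rightarrow> 'b" where
  "cheb_fejer y n = (\<Sum>k<n. cheb_dirichlet y k)"

text \<open>The quotient (n^2 - S_n) / (1 - y), written out as a double sum so that no polynomial
  division is needed.\<close>

definition cheb_rest :: "'b::comm_ring_1 \<Rightarrow> nat \<Rightarrow> 'b" where
  "cheb_rest y n = (\<Sum>k<n. \<Sum>i<k. 2 * cheb_fejer y (Suc i))"

lemma one_minus_mult_dirichlet: "(1 - y) * cheb_dirichlet y k = cheb y k - cheb y (Suc k)"
proof (induction k)
  case 0
  show ?case by (simp add: cheb_dirichlet_def)
next
  case (Suc k)
  have "cheb_dirichlet y (Suc k) = cheb_dirichlet y k + 2 * cheb y (Suc k)"
    by (simp add: cheb_dirichlet_def algebra_simps)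
  then have "(1 - y) * cheb_dirichlet y (Suc k)
      = (cheb y k - cheb y (Suc k)) + (1 - y) * (2 * cheb y (Suc k))"
    using Suc by (simp add: algebra_simps)
  then show ?case by (simp add: algebra_simps)
qed

lemma one_minus_mult_fejer: "(1 - y) * cheb_fejer y n = 1 - cheb y n"
proof -
  have "(1 - y) * cheb_fejer y n = (\<Sum>k<n. cheb y k - cheb y (Suc k))"
    by (simp add: cheb_fejer_def sum_distrib_left one_minus_mult_dirichlet del: cheb.simps)
  also have "\<dots> = cheb y 0 - cheb y n"
    by (rule sum_lessThan_telescope')
  finally show ?thesis by simp
qed

text \<open>As n^2 is the sum of the odd numbers 2k + 1 with k < n, it suffices to divide each 2k +
  1 - D_k by 1 - y. This difference is a sum of terms 2 (1 - T_i), and the quotients (1 - T_i) / (1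
  - y) are the Fejer sums.\<close>

lemma one_minus_mult_rest: "(1 - y) * cheb_rest y n = of_nat (n * n) - cheb_fejer y n"
proof -
  have *: "(1 - y) * (\<Sum>i<k. 2 * cheb_fejer y (Suc i)) = of_nat (2 * k + 1) - cheb_dirichlet y k" for k
  proof -
    have "(1 - y) * (\<Sum>i<k. 2 * cheb_fejer y (Suc i)) = (\<Sum>i<k. 2 * ((1 - y) * cheb_fejer y (Suc i)))"
      by (simp add: sum_distrib_left mult_ac)
    also have "\<dots> = (\<Sum>i<k. 2 * (1 - cheb y (Suc i)))"
      by (simp only: one_minus_mult_fejer)
    also have "\<dots> = of_nat (2 * k + 1) - cheb_dirichlet y k"
      by (simp add: cheb_dirichlet_def sum_subtractf sum_distrib_left algebra_simps)
    finally show ?thesis .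
  qed
  have **: "(\<Sum>k<n. of_nat (2 * k + 1)) = (of_nat (n * n) :: 'a)"
    by (induction n) (simp_all add: algebra_simps)
  have "(1 - y) * cheb_rest y n = (\<Sum>k<n. (1 - y) * (\<Sum>i<k. 2 * cheb_fejer y (Suc i)))"
    unfolding cheb_rest_def by (rule sum_distrib_left)
  also have "\<dots> = (\<Sum>k<n. of_nat (2 * k + 1)) - (\<Sum>k<n. cheb_dirichlet y k)"
    by (simp only: * sum_subtractf)
  finally show ?thesis
    by (simp only: ** cheb_fejer_def)
qed

lemma degree_cheb:
  fixes y :: "'c::idom poly"
  assumes "degree y \<le> 1"
  shows "degree (cheb y n) \<le> n"
proof (induction n rule: induct_nat_012)
  case (ge2 n)
  have "degree (2 * y * cheb y (Suc n)) \<le> degree (2 * y) + degree (cheb y (Suc n))"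
    by (rule degree_mult_le)
  moreover have "degree (2 * y) \<le> 1"
    using degree_mult_le[of 2 y] assms by simp
  ultimately have "degree (2 * y * cheb y (Suc n)) \<le> Suc (Suc n)"
    using ge2 by simp
  then show ?case
    unfolding cheb.simps using ge2 by (intro degree_diff_le) auto
qed (use assms in auto)

lemma degree_fejer:
  fixes y :: "'c::idom poly"
  assumes "degree y \<le> 1"
  shows "degree (cheb_fejer y n) \<le> n - 1"
proof -
  have "degree (cheb_dirichlet y k) \<le> n - 1" if "k < n" for k
  proof -
    have "degree (2 * (\<Sum>i<k. cheb y (Suc i))) \<le> degree (2 :: 'c poly) + degree (\<Sum>i<k. cheb y (Suc i))"
      by (rule degree_mult_le)
    also have "degree (\<Sum>i<k. cheb y (Suc i)) \<le> n - 1"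
    proof (rule degree_sum_le)
      fix i assume "i \<in> {..<k}"
      then show "degree (cheb y (Suc i)) \<le> n - 1"
        using degree_cheb[OF assms, of "Suc i"] that by simp
    qed simp
    finally show ?thesis
      unfolding cheb_dirichlet_def by (intro degree_add_le) auto
  qed
  then show ?thesis
    unfolding cheb_fejer_def by (intro degree_sum_le) auto
qed

lemma degree_rest:
  fixes y :: "'c::idom poly"
  assumes "degree y \<le> 1"
  shows "degree (cheb_rest y n) \<le> n - 1"
proof -
  have "degree (2 * cheb_fejer y (Suc i)) \<le> n - 1" if "i < k" "k < n" for i k
    using degree_mult_le[of 2 "cheb_fejer y (Suc i)"] degree_fejer[OF assms, of "Suc i"] that by simp
  then show ?thesis
    unfolding cheb_rest_def by (intro degree_sum_le) auto
qed

section \<open>Positive functionals on polynomials\<close>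

text \<open>The model is p |-> <p(P) f, f> with \<open>f\<close> finitely supported. The three
  positivity axioms play the role of a spectrum of \<open>y\<close> in [-1, 1]. \<open>y\<close> is
  a parameter because it is instantiated both with P and with the rescaled operator (P - (1 - s)) /
  s.\<close>

locale pos_functional =
  fixes L :: "real poly \<Rightarrow> real" and y :: "real poly"
  assumes add: "L (p + q) = L p + L q"
    and smult: "L (smult c p) = c * L p"
    and square: "0 \<le> L (p * p)"
    and upper: "0 \<le> L ((1 - y) * (p * p))"
    and lower: "0 \<le> L ((1 + y) * (p * p))"
begin

text \<open>An operator norm bound for multiplication by \<open>T\<close> in the seminorm defined by
  \<open>L\<close>. The form may be degenerate, and no Hilbert space is built from it.\<close>

definition bdd :: "real poly \<Rightarrow> real \<Rightarrow> bool" where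
  "bdd T c \<longleftrightarrow> 0 \<le> c \<and> (\<forall>p. L ((T * p) * (T * p)) \<le> c\<^sup>2 * L (p * p))"

lemma zero: "L 0 = 0"
  using smult[of 0 0] by simp

lemma minus: "L (- p) = - L p"
  using smult[of "-1" p] by simp

lemma diff: "L (p - q) = L p - L q"
  using add[of p "- q"] minus[of q] by simp

lemma sum: "L (\<Sum>i\<in>I. f i) = (\<Sum>i\<in>I. L (f i))"
  by (induction I rule: infinite_finite_induct) (auto simp: zero add)

lemma cauchy_schwarz: "\<bar>L (p * q)\<bar> \<le> sqrt (L (p * p)) * sqrt (L (q * q))"
proof -
  have *: "0 \<le> L (p * p) + 2 * t * L (p * q) + t\<^sup>2 * L (q * q)" for t
  proof -
    have "(p + Polynomial.smult t q) * (p + Polynomial.smult t q) =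
        p * p + (Polynomial.smult t (p * q) + Polynomial.smult t (p * q)) + Polynomial.smult (t\<^sup>2) (q * q)"
      by (simp add: algebra_simps power2_eq_square)
    then have "L ((p + Polynomial.smult t q) * (p + Polynomial.smult t q)) =
        L (p * p) + (t * L (p * q) + t * L (p * q)) + t\<^sup>2 * L (q * q)"
      by (simp only: add smult)
    then show ?thesis
      using square[of "p + Polynomial.smult t q"] by simp
  qed
  have "(L (p * q))\<^sup>2 \<le> L (p * p) * L (q * q)"
  proof (cases "L (q * q) = 0")
    case True
    have "L (p * q) = 0"
    proof (rule ccontr)
      assume nz: "L (p * q) \<noteq> 0"
      \<comment> \<open>With \<open>L (q * q) = 0\<close> the quadratic is affine in t, and this t
        gives it the value -1.\<close>
      show False
        using *[of "- (L (p * p) + 1) / (2 * L (p * q))"] True nz by (simp add: field_simps)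
    qed
    then show ?thesis using True by simp
  next
    case False
    then have pos: "0 < L (q * q)" using square[of q] by linarith
    have "0 \<le> L (p * p) - (L (p * q))\<^sup>2 / L (q * q)"
      using *[of "- L (p * q) / L (q * q)"] pos by (simp add: field_simps power2_eq_square)
    then show ?thesis using pos by (simp add: field_simps)
  qed
  then have "sqrt ((L (p * q))\<^sup>2) \<le> sqrt (L (p * p) * L (q * q))"
    by (rule real_sqrt_le_mono)
  then show ?thesis by (simp add: real_sqrt_mult)
qed

lemma bdd_sqrt: "bdd T c \<Longrightarrow> sqrt (L ((T * p) * (T * p))) \<le> c * sqrt (L (p * p))"
  unfolding bdd_def by (metis real_sqrt_le_mono real_sqrt_mult real_sqrt_unique)

lemma bdd_add:
  assumes "bdd T c" "bdd S d"
  shows "bdd (T + S) (c + d)"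
proof -
  have "L (((T + S) * p) * ((T + S) * p)) \<le> (c + d)\<^sup>2 * L (p * p)" for p
  proof -
    have "L ((T * p) * (S * p)) \<le> sqrt (L ((T * p) * (T * p))) * sqrt (L ((S * p) * (S * p)))"
      using cauchy_schwarz[of "T * p" "S * p"] by linarith
    also have "\<dots> \<le> (c * sqrt (L (p * p))) * (d * sqrt (L (p * p)))"
      using assms by (intro mult_mono bdd_sqrt) (auto simp: bdd_def square)
    also have "\<dots> = c * d * L (p * p)"
      using square[of p] by simp
    finally have cross: "L ((T * p) * (S * p)) \<le> c * d * L (p * p)" .
    have "((T + S) * p) * ((T + S) * p) =
        (T * p) * (T * p) + ((T * p) * (S * p) + (T * p) * (S * p)) + (S * p) * (S * p)"
      by (simp add: algebra_simps)
    then have "L (((T + S) * p) * ((T + S) * p)) =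
        L ((T * p) * (T * p)) + 2 * L ((T * p) * (S * p)) + L ((S * p) * (S * p))"
      by (simp only: add)
    moreover have "L ((T * p) * (T * p)) \<le> c\<^sup>2 * L (p * p)" "L ((S * p) * (S * p)) \<le> d\<^sup>2 * L (p * p)"
      using assms by (auto simp: bdd_def)
    ultimately show ?thesis
      using cross by (simp add: power2_eq_square algebra_simps)
  qed
  then show ?thesis using assms by (simp add: bdd_def)
qed

lemma bdd_mult:
  assumes "bdd T c" "bdd S d"
  shows "bdd (T * S) (c * d)"
proof -
  have "L ((T * S * p) * (T * S * p)) \<le> (c * d)\<^sup>2 * L (p * p)" for p
  proof -
    have "L ((T * (S * p)) * (T * (S * p))) \<le> c\<^sup>2 * L ((S * p) * (S * p))"
      using assms by (auto simp: bdd_def)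
    also have "\<dots> \<le> c\<^sup>2 * (d\<^sup>2 * L (p * p))"
      using assms by (intro mult_left_mono) (auto simp: bdd_def)
    finally show ?thesis by (simp add: mult_ac power_mult_distrib)
  qed
  then show ?thesis using assms by (simp add: bdd_def)
qed

lemma bdd_smult:
  assumes "bdd T c"
  shows "bdd (Polynomial.smult t T) (\<bar>t\<bar> * c)"
proof -
  have "L ((Polynomial.smult t T * p) * (Polynomial.smult t T * p)) = t\<^sup>2 * L ((T * p) * (T * p))" for p
    by (simp add: smult power2_eq_square)
  then show ?thesis
    using assms by (simp add: bdd_def power_mult_distrib mult_left_mono mult.assoc)
qed

lemma bdd_mono: "bdd T c \<Longrightarrow> c \<le> d \<Longrightarrow> bdd T d"
  unfolding bdd_def
  by (smt (verit) mult_right_mono power_mono square)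

lemma bdd_zero: "bdd 0 0"
  by (simp add: bdd_def zero)

lemma bdd_one: "bdd 1 1"
  by (simp add: bdd_def)

lemma bdd_sum: "(\<And>i. i \<in> I \<Longrightarrow> bdd (T i) (c i)) \<Longrightarrow> bdd (\<Sum>i\<in>I. T i) (\<Sum>i\<in>I. c i)"
  by (induction I rule: infinite_finite_induct) (auto simp: bdd_zero bdd_add)

lemma bdd_const_mult: "bdd T c \<Longrightarrow> bdd (of_nat k * T) (real k * c)"
  using bdd_smult[of T c "real k"] by (simp add: of_nat_poly)

lemma bdd_uminus: "bdd T c \<Longrightarrow> bdd (- T) c"
  using bdd_smult[of T c "-1"] by simp

text \<open>Positivity of two weights does not formally pass to their product. Here it does, because
  2 (1 - y^2) = (1 - y)(1 + y)^2 + (1 + y)(1 - y)^2.\<close>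

lemma square_nonneg: "0 \<le> L ((1 - y * y) * (p * p))"
proof -
  have "(1 - y * y) * (p * p) + (1 - y * y) * (p * p) =
      (1 - y) * (((1 + y) * p) * ((1 + y) * p)) + (1 + y) * (((1 - y) * p) * ((1 - y) * p))"
    by (simp add: algebra_simps)
  then have "2 * L ((1 - y * y) * (p * p)) =
      L ((1 - y) * (((1 + y) * p) * ((1 + y) * p))) + L ((1 + y) * (((1 - y) * p) * ((1 - y) * p)))"
    by (metis add mult_2)
  then show ?thesis
    using upper[of "(1 + y) * p"] lower[of "(1 - y) * p"] by linarith
qed

text \<open>Replaces the functional calculus for |T_n| <= 1 on [-1, 1]: by \<open>cheb_pell\<close>
  the loss of squared norm is the weight 1 - y^2 against a square.\<close>

lemma bdd_cheb: "bdd (cheb y n) 1"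
proof -
  obtain U where U: "cheb y n * cheb y n + (1 - y * y) * (U * U) = 1"
    using cheb_pell[of y n] by blast
  have "L ((cheb y n * p) * (cheb y n * p)) \<le> L (p * p)" for p
  proof -
    have "p * p = (cheb y n * cheb y n + (1 - y * y) * (U * U)) * (p * p)"
      using U by simp
    also have "\<dots> = (cheb y n * p) * (cheb y n * p) + (1 - y * y) * ((U * p) * (U * p))"
      by (simp add: algebra_simps)
    finally have "L (p * p) =
        L ((cheb y n * p) * (cheb y n * p)) + L ((1 - y * y) * ((U * p) * (U * p)))"
      by (metis add)
    then show ?thesis using square_nonneg[of "U * p"] by linarith
  qed
  then show ?thesis by (simp add: bdd_def)
qed

lemma bdd_dirichlet: "bdd (cheb_dirichlet y k) (2 * real k + 1)"
proof -
  have "bdd (1 + of_nat 2 * (\<Sum>i<k. cheb y (Suc i))) (1 + real 2 * (\<Sum>i<k. 1))"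
    by (intro bdd_add bdd_one bdd_const_mult bdd_sum bdd_cheb)
  then show ?thesis by (simp add: cheb_dirichlet_def add.commute)
qed

lemma bdd_fejer: "bdd (cheb_fejer y n) ((real n)\<^sup>2)"
proof -
  have "bdd (\<Sum>k<n. cheb_dirichlet y k) (\<Sum>k<n. 2 * real k + 1)"
    by (intro bdd_sum bdd_dirichlet)
  moreover have "(\<Sum>k<n. 2 * real k + 1) = (real n)\<^sup>2"
    by (induction n) (simp_all add: power2_eq_square algebra_simps)
  ultimately show ?thesis by (simp add: cheb_fejer_def)
qed

lemma bdd_rest: "bdd (cheb_rest y n) (2 * real n ^ 4)"
proof -
  have "bdd (\<Sum>k<n. \<Sum>i<k. of_nat 2 * cheb_fejer y (Suc i)) (\<Sum>k<n. \<Sum>i<k. real 2 * (real n)\<^sup>2)"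
    by (intro bdd_sum bdd_const_mult bdd_mono[OF bdd_fejer] power_mono) auto
  then have "bdd (cheb_rest y n) (\<Sum>k<n. \<Sum>i<k. real 2 * (real n)\<^sup>2)"
    by (simp add: cheb_rest_def)
  moreover have "(\<Sum>k<n. \<Sum>i<k. real 2 * (real n)\<^sup>2) \<le> (\<Sum>k<n. real n * (real 2 * (real n)\<^sup>2))"
    by (intro sum_mono) (simp add: mult_right_mono)
  moreover have "(\<Sum>k<n. real n * (real 2 * (real n)\<^sup>2)) = 2 * real n ^ 4"
    by (simp add: power2_eq_square power4_eq_xxxx)
  ultimately show ?thesis using bdd_mono by metis
qed

end

text \<open>The gap between 1/2 and 2 excludes ratios near 1, for which the sum would grow linearly
  in \<open>t\<close>.\<close>

lemma geometric_sum_le: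
  fixes q :: real
  assumes "0 \<le> q" "2 \<le> q \<or> q \<le> 1 / 2"
  shows "(\<Sum>i<t. q ^ Suc i) \<le> 2 * (max 1 q) ^ t"
  using assms(2)
proof
  assume q: "2 \<le> q"
  have "(\<Sum>i<t. q ^ Suc i) \<le> 2 * q ^ t"
  proof (induction t)
    case (Suc t)
    have "2 * q ^ t \<le> q * q ^ t" using q by (intro mult_right_mono) auto
    with Suc show ?case by simp
  qed simp
  then show ?thesis using q by (simp add: max_def)
next
  assume q: "q \<le> 1 / 2"
  have "(\<Sum>i<t. q ^ Suc i) \<le> 2 - 2 * q ^ t"
  proof (induction t)
    case (Suc t)
    have "q * q ^ t \<le> (1 / 2) * q ^ t" using q assms(1) by (intro mult_right_mono) auto
    moreover have "0 \<le> q ^ t" using assms(1) by simp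
    ultimately have "3 * (q * q ^ t) \<le> 2 * q ^ t" by linarith
    with Suc show ?case by simp
  qed simp
  moreover have "0 \<le> q ^ t" using assms(1) by simp
  ultimately show ?thesis using q by (simp add: max_def)
qed

text \<open>The constant of \<open>smoothing_bound\<close> after \<open>j\<close> factors. The first
  summand comes from the top scale, where each factor costs c^2. In the second, 4 is the 2 of a
  single descent step times the 2 of \<open>geometric_sum_le\<close>.\<close>

fun iter_const :: "real \<Rightarrow> real \<Rightarrow> nat \<Rightarrow> real" where
  "iter_const C c 0 = C"
| "iter_const C c (Suc j) = c ^ (2 * Suc j) * C + 4 * c\<^sup>2 * iter_const C c j"

lemma iter_const_nonneg: "0 \<le> C \<Longrightarrow> 0 \<le> c \<Longrightarrow> 0 \<le> iter_const C c j"
  by (induction j) auto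

section \<open>Lazy powers and the abstract smoothing estimate\<close>

context pos_functional
begin

text \<open>The weights are such that \<open>1/3 \<le> lazy \<le> 1\<close> on \<open>-1 \<le> y \<le> 1\<close>: powers of \<open>lazy\<close> are positive, and one
  factor of \<open>lazy\<close> can be removed at the cost of a constant.\<close>

definition lazy :: "real poly" where
  "lazy = Polynomial.smult (1 / 3) (2 + y)"

lemma one_minus_lazy: "1 - lazy = Polynomial.smult (1 / 3) (1 - y)"
proof -
  have "1 - lazy = Polynomial.smult (1 / 3) (Polynomial.smult 3 1 - (2 + y))"
    unfolding lazy_def by (simp add: smult_diff_right)
  also have "Polynomial.smult 3 1 - (2 + y) = 1 - y"
    by (simp add: numeral_poly one_pCons)
  finally show ?thesis .
qed

lemma lower_lazy: "0 \<le> L (lazy * (p * p))"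
proof -
  have "lazy * (p * p) = Polynomial.smult (1 / 3) (p * p + (1 + y) * (p * p))"
    unfolding lazy_def by (simp add: algebra_simps)
  then show ?thesis using square[of p] lower[of p] by (simp add: smult add)
qed

lemma one_minus_lazy_mult: "L ((1 - lazy) * p) = (1 / 3) * L ((1 - y) * p)"
  unfolding one_minus_lazy by (simp add: smult)

lemma upper_lazy: "0 \<le> L ((1 - lazy) * (p * p))"
  using upper[of p] by (simp add: one_minus_lazy_mult)

lemma lazy_power_nonneg: "0 \<le> L (lazy ^ l * (p * p))"
proof (cases "even l")
  case True
  then obtain k where "l = 2 * k" by blast
  then have "lazy ^ l = lazy ^ k * lazy ^ k"
    by (simp add: mult_2 power_add)
  then have "lazy ^ l * (p * p) = (lazy ^ k * p) * (lazy ^ k * p)"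
    by (simp only: mult_ac)
  then show ?thesis using square by metis
next
  case False
  then obtain k where "l = 2 * k + 1" by (auto elim: oddE)
  then have "lazy ^ l = lazy * (lazy ^ k * lazy ^ k)"
    by (simp add: mult_2 power_add)
  then have "lazy ^ l * (p * p) = lazy * ((lazy ^ k * p) * (lazy ^ k * p))"
    by (simp only: mult_ac)
  then show ?thesis using lower_lazy by metis
qed

text \<open>Bernoulli's inequality 1 - t^N <= N (1 - t) on [0, 1]. In the induction the excess (1 -
  t)(1 - t^N) is (1 - t)^2 times a sum of powers of t, hence positive.\<close>

lemma one_minus_lazy_power: "L ((1 - lazy ^ N) * (p * p)) \<le> real N * L ((1 - lazy) * (p * p))"
proof (induction N)
  case 0
  show ?case by (simp add: zero)
next
  case (Suc N)
  have "(1 - lazy) * (p * p) - lazy ^ N * ((1 - lazy) * (p * p)) =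
      (\<Sum>i<N. lazy ^ i * (((1 - lazy) * p) * ((1 - lazy) * p)))"
  proof -
    have "(1 - lazy) * (p * p) - lazy ^ N * ((1 - lazy) * (p * p)) =
        (1 - lazy ^ N) * ((1 - lazy) * (p * p))"
      by (simp add: algebra_simps)
    also have "\<dots> = (\<Sum>i<N. lazy ^ i) * (((1 - lazy) * p) * ((1 - lazy) * p))"
      unfolding one_diff_power_eq by (simp only: mult_ac)
    finally show ?thesis by (simp only: sum_distrib_right)
  qed
  then have "L ((1 - lazy) * (p * p)) - L (lazy ^ N * ((1 - lazy) * (p * p))) =
      (\<Sum>i<N. L (lazy ^ i * (((1 - lazy) * p) * ((1 - lazy) * p))))"
    by (metis diff sum)
  also have "\<dots> \<ge> 0"
    by (intro sum_nonneg lazy_power_nonneg)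
  finally have *: "L (lazy ^ N * ((1 - lazy) * (p * p))) \<le> L ((1 - lazy) * (p * p))" by simp
  have "(1 - lazy ^ Suc N) * (p * p) = (1 - lazy ^ N) * (p * p) + lazy ^ N * ((1 - lazy) * (p * p))"
    by (simp add: algebra_simps)
  then have "L ((1 - lazy ^ Suc N) * (p * p)) =
      L ((1 - lazy ^ N) * (p * p)) + L (lazy ^ N * ((1 - lazy) * (p * p)))"
    by (metis add)
  with * Suc show ?case by (simp add: algebra_simps)
qed

text \<open>Bounds the Dirichlet form by the loss of squared norm in one lazy step, which telescopes
  in time. The identity behind it is 1 - t^2 = (1 - t) + (1 - t) t^2 + t (1 - t)^2.\<close>

lemma lazy_decrement:
  "(1 / 3) * L ((1 - y) * (p * p)) \<le> L (p * p) - L ((lazy * p) * (lazy * p))"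
proof -
  have "p * p - (lazy * p) * (lazy * p) =
      (1 - lazy) * (p * p) + ((1 - lazy) * ((lazy * p) * (lazy * p)) + lazy * (((1 - lazy) * p) * ((1 - lazy) * p)))"
    by (simp add: algebra_simps)
  then have "L (p * p) - L ((lazy * p) * (lazy * p)) = L ((1 - lazy) * (p * p)) +
      (L ((1 - lazy) * ((lazy * p) * (lazy * p))) + L (lazy * (((1 - lazy) * p) * ((1 - lazy) * p))))"
    by (metis add diff)
  then show ?thesis
    using upper_lazy[of "lazy * p"] lower_lazy[of "(1 - lazy) * p"]
    by (simp add: one_minus_lazy_mult)
qed

text \<open>This is \<open>lazy\<close> >= 1/3: 3 \<open>lazy\<close> = 1 + (1 + y), and in its
  square the cross term 2 (1 + y) is a positive weight.\<close>

lemma lazy_lower_bound: "L (p * p) \<le> 9 * L ((lazy * p) * (lazy * p))"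
proof -
  have "lazy + (lazy + lazy) = 2 + y"
    unfolding lazy_def by (simp flip: smult_add_left)
  then have "(lazy + (lazy + lazy)) * (lazy + (lazy + lazy)) * (p * p) =
      p * p + ((1 + y) * (p * p) + (1 + y) * (p * p)) + ((1 + y) * p) * ((1 + y) * p)"
    by (simp add: algebra_simps)
  moreover have "Polynomial.smult 9 ((lazy * p) * (lazy * p)) =
      (lazy + (lazy + lazy)) * (lazy + (lazy + lazy)) * (p * p)"
  proof -
    have "lazy + (lazy + lazy) = Polynomial.smult 3 lazy"
      by (simp add: lazy_def flip: smult_add_left)
    then show ?thesis by (simp add: mult_ac)
  qed
  ultimately have "9 * L ((lazy * p) * (lazy * p)) =
      L (p * p) + (L ((1 + y) * (p * p)) + L ((1 + y) * (p * p))) + L (((1 + y) * p) * ((1 + y) * p))"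
    by (metis add smult)
  then show ?thesis using lower[of p] square[of "(1 + y) * p"] by linarith
qed

lemma bdd_prod:
  "(\<And>i. i \<in> I \<Longrightarrow> bdd (T i) (c i)) \<Longrightarrow> bdd (\<Prod>i\<in>I. T i) (\<Prod>i\<in>I. c i)"
  by (induction I rule: infinite_finite_induct) (auto simp: bdd_one bdd_mult)

text \<open>The hypothesis on \<open>lazy\<close> is on-diagonal decay at scale \<open>2 ^ i\<close> relative to the scale \<open>2 ^ K\<close>.
  Each factor \<open>E j\<close> costs a factor \<open>4 ^ (i - K)\<close> when \<open>1 - lazy\<close> is absorbed into it, so that
  \<open>M\<close> factors compensate the polynomial growth of the volume.\<close>

lemma smoothing_bound:
  fixes E :: "nat \<Rightarrow> real poly"
  assumes M: "1 \<le> M" and nonneg: "0 \<le> C" "0 \<le> V" "0 \<le> c"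
    and decay: "\<And>i. i \<le> K \<Longrightarrow>
      L (lazy ^ (4 ^ i) * lazy ^ (4 ^ i)) \<le> C * (2 * 4 ^ (M - 1)) ^ (K - i) * V"
    and E: "\<And>j. j < M \<Longrightarrow> bdd (E j) c" "\<And>j. j < M \<Longrightarrow> bdd ((1 - y) * E j) (c / 4 ^ K)"
  shows "L ((\<Prod>j<M. E j) * (\<Prod>j<M. E j)) \<le> 9 * iter_const C c M * V"
proof -
  define W where "W j = (\<Prod>l<j. E l)" for j
  define b where "b j i = L ((W j * lazy ^ (4 ^ i)) * (W j * lazy ^ (4 ^ i)))" for j i
  \<comment> \<open>The growth per scale that remains after \<open>j\<close> factors: the doubling
    constant at first, divided by 4 by each factor, and 1/2 at the end.\<close>
  define q where "q j = 2 * 4 ^ (M - 1) / (4 :: real) ^ j" for j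
  have W_bdd: "bdd (W j) (c ^ j)" if "j \<le> M" for j
    using bdd_prod[of "{..<j}" E "\<lambda>_. c"] E that by (simp add: W_def)
  have q_Suc: "q (Suc j) = q j / 4" for j
    by (simp add: q_def)
  have q_pos: "0 < q j" for j by (simp add: q_def)
  have q_ge: "2 \<le> q j" if "j < M" for j
  proof -
    have "(4::real) ^ j \<le> 4 ^ (M - 1)" using that by (intro power_increasing) auto
    then show ?thesis by (simp add: q_def field_simps)
  qed
  have q_M: "q M = 1 / 2"
    using M by (cases M) (simp_all add: q_def)
  have b_top: "b j K \<le> c ^ (2 * j) * (C * V)" if "j \<le> M" for j
  proof -
    have "b j K \<le> (c ^ j)\<^sup>2 * L (lazy ^ (4 ^ K) * lazy ^ (4 ^ K))"
      using W_bdd[OF that] by (simp add: b_def bdd_def)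
    also have "\<dots> \<le> (c ^ j)\<^sup>2 * (C * V)"
      using decay[of K] by (intro mult_left_mono) auto
    finally show ?thesis by (simp add: power_mult mult.commute[of 2])
  qed
  \<comment> \<open>The exponents 4^i and 4^(i+1) differ by 3 * 4^i, which squaring doubles to 6 *
    4^i. Linearising 1 - \<open>lazy\<close>^N leaves a single weight 1 - y, and \<open>E j\<close>
    absorbs it at the cost of 4^(-K).\<close>
  have b_step: "b (Suc j) i \<le> b (Suc j) (Suc i) + 2 * c\<^sup>2 * (4 ^ i / 4 ^ K) * b j i" if "j < M" for i j
  proof -
    let ?g = "W (Suc j) * lazy ^ (4 ^ i)" and ?h = "W j * lazy ^ (4 ^ i)"
    have g: "?g = E j * ?h" by (simp add: W_def mult_ac)
    have "b (Suc j) i - b (Suc j) (Suc i) = L ((1 - lazy ^ (6 * 4 ^ i)) * (?g * ?g))"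
    proof -
      have "(lazy ^ (4 ^ Suc i)) = lazy ^ (3 * 4 ^ i) * lazy ^ (4 ^ i)"
        by (simp flip: power_add)
      moreover have "lazy ^ (6 * 4 ^ i) = lazy ^ (3 * 4 ^ i) * lazy ^ (3 * 4 ^ i)"
        by (simp flip: power_add)
      ultimately have "(1 - lazy ^ (6 * 4 ^ i)) * (?g * ?g) = ?g * ?g -
          (W (Suc j) * lazy ^ (4 ^ Suc i)) * (W (Suc j) * lazy ^ (4 ^ Suc i))"
        by (simp only: algebra_simps)
      then show ?thesis unfolding b_def by (metis diff)
    qed
    also have "\<dots> \<le> real (6 * 4 ^ i) * L ((1 - lazy) * (?g * ?g))"
      by (rule one_minus_lazy_power)
    also have "\<dots> = 2 * 4 ^ i * L ((1 - y) * (?g * ?g))"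
      unfolding one_minus_lazy_mult by simp
    also have "L ((1 - y) * (?g * ?g)) = L (((1 - y) * E j * ?h) * (E j * ?h))"
      unfolding g by (simp only: mult_ac)
    also have "\<dots> \<le> sqrt (L (((1 - y) * E j * ?h) * ((1 - y) * E j * ?h))) * sqrt (L ((E j * ?h) * (E j * ?h)))"
      using cauchy_schwarz[of "(1 - y) * E j * ?h" "E j * ?h"] by linarith
    also have "\<dots> \<le> (c / 4 ^ K * sqrt (L (?h * ?h))) * (c * sqrt (L (?h * ?h)))"
      using E[OF that] nonneg by (intro mult_mono bdd_sqrt) (auto simp: square)
    also have "\<dots> = c\<^sup>2 / 4 ^ K * b j i"
      using square[of ?h] by (simp add: b_def power2_eq_square)
    finally have "b (Suc j) i - b (Suc j) (Suc i) \<le> 2 * 4 ^ i * (c\<^sup>2 / 4 ^ K * b j i)"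
      by (simp add: mult_left_mono)
    also have "\<dots> = 2 * c\<^sup>2 * (4 ^ i / 4 ^ K) * b j i"
      by simp
    finally show ?thesis by linarith
  qed
  \<comment> \<open>Descent by \<open>t\<close> scales from the top scale \<open>K\<close>. The
    maximum with 1 accounts for the contribution of the top scale, which does not decay.\<close>
  have main: "b j (K - t) \<le> iter_const C c j * max 1 (q j) ^ t * V" if "j \<le> M" "t \<le> K" for j t
    using that
  proof (induction j arbitrary: t)
    case 0
    have "max 1 (q 0) = q 0" using q_ge[of 0] M by simp
    moreover have "q 0 = 2 * 4 ^ (M - 1)" by (simp add: q_def)
    ultimately show ?case
      using decay[of "K - t"] 0 by (simp add: b_def W_def)
  next
    case (Suc j)
    let ?I = "iter_const C c j"
    have IH: "b j (K - t) \<le> ?I * max 1 (q j) ^ t * V" if "j \<le> M" "t \<le> K" for t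
      using Suc.IH that by blast
    have I: "0 \<le> ?I" using nonneg by (intro iter_const_nonneg) auto
    have j: "j < M" using Suc.prems by simp
    have "b (Suc j) (K - t) \<le> c ^ (2 * Suc j) * (C * V) + 2 * c\<^sup>2 * ?I * V * (\<Sum>i<t. q (Suc j) ^ Suc i)"
      if "t \<le> K" for t
      using that
    proof (induction t)
      case 0
      show ?case using b_top[of "Suc j"] Suc.prems by simp
    next
      case (Suc t)
      have K: "Suc (K - Suc t) = K - t" using Suc.prems by simp
      have "(4::real) ^ (K - Suc t) / 4 ^ K = 1 / 4 ^ Suc t"
        using Suc.prems by (simp add: power_diff)
      with b_step[OF j, of "K - Suc t"]
      have "b (Suc j) (K - Suc t) \<le> b (Suc j) (K - t) + 2 * c\<^sup>2 * (1 / 4 ^ Suc t) * b j (K - Suc t)"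
        by (simp only: K)
      also have "2 * c\<^sup>2 * (1 / 4 ^ Suc t) * b j (K - Suc t)
          \<le> 2 * c\<^sup>2 * (1 / 4 ^ Suc t) * (?I * q j ^ Suc t * V)"
      proof (rule mult_left_mono)
        have "max 1 (q j) = q j" using q_ge[OF j] by simp
        then show "b j (K - Suc t) \<le> ?I * q j ^ Suc t * V"
          using IH[of "Suc t"] Suc.prems j by (simp only:)
      qed simp
      also have "\<dots> = 2 * c\<^sup>2 * ?I * V * q (Suc j) ^ Suc t"
        unfolding q_Suc power_divide by simp
      finally have "b (Suc j) (K - Suc t) \<le> b (Suc j) (K - t) + 2 * c\<^sup>2 * ?I * V * q (Suc j) ^ Suc t"
        by linarith
      moreover have "b (Suc j) (K - t) \<le> c ^ (2 * Suc j) * (C * V) + 2 * c\<^sup>2 * ?I * V * (\<Sum>i<t. q (Suc j) ^ Suc i)"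
        using Suc by simp
      ultimately show ?case by (simp only: sum.lessThan_Suc distrib_left)
    qed
    from this[OF Suc.prems(2)]
    have "b (Suc j) (K - t) \<le> c ^ (2 * Suc j) * (C * V) + 2 * c\<^sup>2 * ?I * V * (\<Sum>i<t. q (Suc j) ^ Suc i)" .
    also have "(\<Sum>i<t. q (Suc j) ^ Suc i) \<le> 2 * max 1 (q (Suc j)) ^ t"
    proof (rule geometric_sum_le)
      show "2 \<le> q (Suc j) \<or> q (Suc j) \<le> 1 / 2"
        using q_ge[of "Suc j"] q_M Suc.prems by (cases "Suc j = M") auto
    qed (use q_pos[of "Suc j"] in simp)
    also have "c ^ (2 * Suc j) * (C * V) \<le> c ^ (2 * Suc j) * (C * V) * max 1 (q (Suc j)) ^ t"
    proof -
      have "0 \<le> c ^ (2 * Suc j) * (C * V)" "1 \<le> max 1 (q (Suc j)) ^ t"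
        using nonneg by (auto intro!: one_le_power simp del: power_Suc)
      then show ?thesis using mult_left_mono[of 1 "max 1 (q (Suc j)) ^ t"] by (metis mult_1_right)
    qed
    finally have "b (Suc j) (K - t) \<le> c ^ (2 * Suc j) * (C * V) * max 1 (q (Suc j)) ^ t +
        2 * c\<^sup>2 * ?I * V * (2 * max 1 (q (Suc j)) ^ t)"
      using I nonneg by (simp add: mult_left_mono)
    also have "\<dots> = iter_const C c (Suc j) * max 1 (q (Suc j)) ^ t * V"
    proof -
      have "X * (C * V) * s + 2 * d * i * V * (2 * s) = (X * C + 4 * d * i) * s * V" for X d i s :: real
        by (simp add: algebra_simps)
      then show ?thesis unfolding iter_const.simps .
    qed
    finally show ?case .
  qed
  \<comment> \<open>All \<open>K\<close> scales are descended; since \<open>q M\<close> = 1/2,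
    nothing grows with \<open>K\<close>. One power of \<open>lazy\<close> is left, and
    \<open>lazy_lower_bound\<close> strips it off.\<close>
  have "b M 0 \<le> iter_const C c M * V"
    using main[of M K] q_M by simp
  moreover have "L (W M * W M) \<le> 9 * b M 0"
    using lazy_lower_bound[of "W M"] by (simp add: b_def mult_ac)
  ultimately show ?thesis by (simp add: W_def)
qed

end

section \<open>Symmetric kernels\<close>

definition fin_supp :: "('a \<Rightarrow> real) \<Rightarrow> bool" where
  "fin_supp f \<longleftrightarrow> finite {x. f x \<noteq> 0}"

lemma fin_supp_zero: "fin_supp (\<lambda>_. 0)"
  by (simp add: fin_supp_def)

lemma fin_supp_add: "fin_supp f \<Longrightarrow> fin_supp g \<Longrightarrow> fin_supp (\<lambda>x. f x + g x)"
  unfolding fin_supp_def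
  by (rule finite_subset[of _ "{x. f x \<noteq> 0} \<union> {x. g x \<noteq> 0}"]) auto

lemma fin_supp_mult: "fin_supp f \<Longrightarrow> fin_supp (\<lambda>x. c * f x)"
  unfolding fin_supp_def
  by (rule finite_subset[of _ "{x. f x \<noteq> 0}"]) auto

lemma fin_supp_diff: "fin_supp f \<Longrightarrow> fin_supp g \<Longrightarrow> fin_supp (\<lambda>x. f x - g x)"
  unfolding fin_supp_def
  by (rule finite_subset[of _ "{x. f x \<noteq> 0} \<union> {x. g x \<noteq> 0}"]) auto

text \<open>\<open>nu_le\<close> is only an inequality, so that besides the Markov operator of the
  graph also its restriction to a ball with killing at the boundary is an instance.\<close>

locale sym_kernel =
  fixes nu :: "'a \<Rightarrow> 'a \<Rightarrow> real" and m :: "'a \<Rightarrow> real"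
  assumes nu_sym: "nu u v = nu v u"
    and nu_nonneg: "0 \<le> nu u v"
    and m_pos: "0 < m u"
    and finite_nbrs: "finite {v. nu u v \<noteq> 0}"
    and nu_le: "finite S \<Longrightarrow> (\<Sum>v\<in>S. nu u v) \<le> m u"
begin

definition ip :: "('a \<Rightarrow> real) \<Rightarrow> ('a \<Rightarrow> real) \<Rightarrow> real" where
  "ip f g = (\<Sum>x | f x \<noteq> 0. f x * g x * m x)"

definition A :: "('a \<Rightarrow> real) \<Rightarrow> 'a \<Rightarrow> real" where
  "A f u = (\<Sum>w | nu u w \<noteq> 0. nu u w * f w) / m u"

text \<open>The point mass normalised by 1 / m(v), so that pairing with it evaluates at
  \<open>v\<close> and kernels with respect to m become matrix coefficients between such
  vectors.\<close>

definition point :: "'a \<Rightarrow> 'a \<Rightarrow> real" where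
  "point v u = (if u = v then 1 / m v else 0)"

lemma fin_supp_point: "fin_supp (point v)"
  unfolding fin_supp_def point_def by (rule finite_subset[of _ "{v}"]) auto

lemma ip_eq: "finite S \<Longrightarrow> {x. f x \<noteq> 0} \<subseteq> S \<Longrightarrow> ip f g = (\<Sum>x\<in>S. f x * g x * m x)"
  unfolding ip_def by (rule sum.mono_neutral_left) auto

lemma ip_sym:
  assumes "fin_supp f" "fin_supp g"
  shows "ip f g = ip g f"
proof -
  let ?S = "{x. f x \<noteq> 0} \<union> {x. g x \<noteq> 0}"
  have "finite ?S" using assms by (simp add: fin_supp_def)
  then show ?thesis
    using ip_eq[of ?S f g] ip_eq[of ?S g f] by (simp add: mult_ac)
qed

lemma ip_point: "fin_supp f \<Longrightarrow> ip f (point v) = f v"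
  using m_pos[of v] ip_eq[of "{v}" "point v" f]
  by (subst ip_sym) (auto simp: fin_supp_point point_def)

lemma ip_add:
  assumes "fin_supp f" "fin_supp g"
  shows "ip (\<lambda>x. f x + g x) h = ip f h + ip g h"
proof -
  let ?S = "{x. f x \<noteq> 0} \<union> {x. g x \<noteq> 0}"
  have S: "finite ?S" using assms by (simp add: fin_supp_def)
  have "ip (\<lambda>x. f x + g x) h = (\<Sum>x\<in>?S. (f x + g x) * h x * m x)"
    using S by (intro ip_eq) auto
  then show ?thesis
    using ip_eq[OF S, of f h] ip_eq[OF S, of g h] by (auto simp: sum.distrib algebra_simps)
qed

lemma ip_mult: "ip (\<lambda>x. c * f x) h = c * ip f h"
  by (cases "c = 0") (simp_all add: ip_def sum_distrib_left mult_ac)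

lemma ip_diff:
  assumes "fin_supp f" "fin_supp g"
  shows "ip (\<lambda>x. f x - g x) h = ip f h - ip g h"
  using ip_add[OF assms(1) fin_supp_mult[OF assms(2)], of "-1" h] ip_mult[of "-1" g h] by simp

lemma ip_nonneg: "0 \<le> ip f f"
  unfolding ip_def using m_pos by (intro sum_nonneg) (auto simp: less_imp_le)

lemma A_eq:
  assumes "finite S" "{x. f x \<noteq> 0} \<subseteq> S"
  shows "A f u = (\<Sum>w\<in>S. nu u w * f w) / m u"
proof -
  have "(\<Sum>w | nu u w \<noteq> 0. nu u w * f w) = (\<Sum>w\<in>S \<inter> {w. nu u w \<noteq> 0}. nu u w * f w)"
    using assms finite_nbrs[of u] by (intro sum.mono_neutral_right) auto
  also have "\<dots> = (\<Sum>w\<in>S. nu u w * f w)"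
    using assms by (intro sum.mono_neutral_left) auto
  finally show ?thesis by (simp add: A_def)
qed

lemma A_zero: "A (\<lambda>_. 0) = (\<lambda>_. 0)"
  by (simp add: A_def fun_eq_iff)

lemma A_add: "A (\<lambda>x. f x + g x) = (\<lambda>u. A f u + A g u)"
  by (simp add: A_def fun_eq_iff sum.distrib algebra_simps add_divide_distrib)

lemma A_mult: "A (\<lambda>x. c * f x) = (\<lambda>u. c * A f u)"
  by (simp add: A_def fun_eq_iff sum_distrib_left mult_ac)

lemma fin_supp_A:
  assumes "fin_supp f"
  shows "fin_supp (A f)"
proof -
  have "{x. A f x \<noteq> 0} \<subseteq> (\<Union>w\<in>{w. f w \<noteq> 0}. {x. nu w x \<noteq> 0})"
  proof
    fix x assume "x \<in> {x. A f x \<noteq> 0}"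
    then have "(\<Sum>w | nu x w \<noteq> 0. nu x w * f w) \<noteq> 0" by (auto simp: A_def)
    then obtain w where "nu x w * f w \<noteq> 0" by (meson sum.not_neutral_contains_not_neutral)
    then show "x \<in> (\<Union>w\<in>{w. f w \<noteq> 0}. {x. nu w x \<noteq> 0})"
      using nu_sym[of x w] by auto
  qed
  then show ?thesis
    using assms finite_nbrs unfolding fin_supp_def by (meson finite_UN_I finite_subset)
qed

lemma ip_A:
  assumes "finite S" "{x. f x \<noteq> 0} \<subseteq> S" "{x. g x \<noteq> 0} \<subseteq> S"
  shows "ip (A f) g = (\<Sum>x\<in>S. \<Sum>w\<in>S. nu x w * f w * g x)"
proof -
  have "fin_supp f" "fin_supp g"
    using assms finite_subset by (auto simp: fin_supp_def)
  then have "ip (A f) g = ip g (A f)"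
    by (intro ip_sym fin_supp_A)
  also have "\<dots> = (\<Sum>x\<in>S. g x * A f x * m x)"
    using assms by (intro ip_eq)
  also have "\<dots> = (\<Sum>x\<in>S. \<Sum>w\<in>S. nu x w * f w * g x)"
  proof (rule sum.cong[OF refl])
    fix x
    have "A f x * m x = (\<Sum>w\<in>S. nu x w * f w)"
      using m_pos[of x] by (simp add: A_eq[OF assms(1,2)])
    moreover have "g x * A f x * m x = A f x * m x * g x" by simp
    ultimately show "g x * A f x * m x = (\<Sum>w\<in>S. nu x w * f w * g x)"
      by (simp only: sum_distrib_right)
  qed
  finally show ?thesis .
qed

lemma A_sym:
  assumes "fin_supp f" "fin_supp g"
  shows "ip (A f) g = ip f (A g)"
proof -
  let ?S = "{x. f x \<noteq> 0} \<union> {x. g x \<noteq> 0}"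
  have S: "finite ?S" using assms by (simp add: fin_supp_def)
  have "ip (A f) g = (\<Sum>x\<in>?S. \<Sum>w\<in>?S. nu x w * f w * g x)"
    using S by (intro ip_A) auto
  also have "\<dots> = (\<Sum>w\<in>?S. \<Sum>x\<in>?S. nu x w * f w * g x)"
    by (rule sum.swap)
  also have "\<dots> = (\<Sum>w\<in>?S. \<Sum>x\<in>?S. nu w x * g x * f w)"
    by (intro sum.cong refl) (metis nu_sym mult.assoc mult.commute)
  also have "\<dots> = ip (A g) f"
    using S by (intro ip_A[symmetric]) auto
  also have "\<dots> = ip f (A g)"
    using assms by (intro ip_sym fin_supp_A)
  finally show ?thesis .
qed

text \<open>The signs t = 1 and t = -1 give the two bounds -1 <= A <= 1. Equality may fail because
  mass can be killed (\<open>nu_le\<close>) and edges leaving \<open>S\<close> are dropped.\<close>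

lemma energy_le:
  assumes "finite S" "{x. f x \<noteq> 0} \<subseteq> S" "t\<^sup>2 = 1"
  shows "(\<Sum>x\<in>S. \<Sum>w\<in>S. nu x w * (f x + t * f w)\<^sup>2) \<le> 2 * (ip f f + t * ip (A f) f)"
proof -
  have "(\<Sum>x\<in>S. \<Sum>w\<in>S. nu x w * (f x + t * f w)\<^sup>2)
      = (\<Sum>x\<in>S. \<Sum>w\<in>S. nu x w * (f x)\<^sup>2 + nu x w * (f w)\<^sup>2 + 2 * t * (nu x w * f w * f x))"
    using assms(3) by (intro sum.cong refl) (simp add: power2_sum power_mult_distrib algebra_simps)
  also have "\<dots> = (\<Sum>x\<in>S. \<Sum>w\<in>S. nu x w * (f x)\<^sup>2) + (\<Sum>x\<in>S. \<Sum>w\<in>S. nu x w * (f w)\<^sup>2)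
      + 2 * t * ip (A f) f"
    unfolding ip_A[OF assms(1,2,2)] by (simp add: sum.distrib sum_distrib_left)
  also have "(\<Sum>x\<in>S. \<Sum>w\<in>S. nu x w * (f w)\<^sup>2) = (\<Sum>x\<in>S. \<Sum>w\<in>S. nu x w * (f x)\<^sup>2)"
    by (subst sum.swap) (simp add: nu_sym)
  finally have eq: "(\<Sum>x\<in>S. \<Sum>w\<in>S. nu x w * (f x + t * f w)\<^sup>2) =
      2 * (\<Sum>x\<in>S. \<Sum>w\<in>S. nu x w * (f x)\<^sup>2) + 2 * t * ip (A f) f"
    by simp
  have "(\<Sum>x\<in>S. \<Sum>w\<in>S. nu x w * (f x)\<^sup>2) \<le> ip f f"
  proof -
    have "(\<Sum>x\<in>S. \<Sum>w\<in>S. nu x w * (f x)\<^sup>2) = (\<Sum>x\<in>S. (\<Sum>w\<in>S. nu x w) * (f x)\<^sup>2)"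
      by (simp add: sum_distrib_right)
    also have "\<dots> \<le> (\<Sum>x\<in>S. m x * (f x)\<^sup>2)"
      using assms(1) by (intro sum_mono mult_right_mono nu_le) auto
    also have "\<dots> = ip f f"
      using ip_eq[OF assms(1,2)] by (simp add: power2_eq_square mult_ac)
    finally show ?thesis .
  qed
  then show ?thesis unfolding eq by (simp add: algebra_simps)
qed

lemma A_bounds:
  assumes "fin_supp f"
  shows "0 \<le> ip f f + ip (A f) f" "0 \<le> ip f f - ip (A f) f"
proof -
  let ?S = "{x. f x \<noteq> 0}"
  have S: "finite ?S" using assms by (simp add: fin_supp_def)
  have "0 \<le> (\<Sum>x\<in>?S. \<Sum>w\<in>?S. nu x w * (f x + t * f w)\<^sup>2)" for t
    using nu_nonneg by (intro sum_nonneg) auto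
  from order.trans[OF this energy_le[OF S order.refl, of 1]]
    order.trans[OF this energy_le[OF S order.refl, of "-1"]]
  show "0 \<le> ip f f + ip (A f) f" "0 \<le> ip f f - ip (A f) f" by auto
qed

definition pact :: "real poly \<Rightarrow> ('a \<Rightarrow> real) \<Rightarrow> 'a \<Rightarrow> real" where
  "pact p f = fold_coeffs (\<lambda>c g u. c * f u + A g u) p (\<lambda>_. 0)"

lemma pact_0 [simp]: "pact 0 f = (\<lambda>_. 0)"
  by (simp add: pact_def)

lemma pact_pCons: "pact (pCons c p) f = (\<lambda>u. c * f u + A (pact p f) u)"
  by (cases "c = 0 \<and> p = 0") (auto simp: pact_def A_zero)

lemma fin_supp_pact: "fin_supp f \<Longrightarrow> fin_supp (pact p f)"
  by (induction p) (auto simp: pact_pCons fin_supp_zero fin_supp_add fin_supp_mult fin_supp_A)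

lemma pact_smult: "pact (smult c p) f = (\<lambda>u. c * pact p f u)"
  by (induction p) (simp_all add: pact_pCons A_mult algebra_simps)

lemma pact_add: "pact (p + q) f = (\<lambda>u. pact p f u + pact q f u)"
  by (induction p q rule: poly_induct2) (simp_all add: pact_pCons A_add algebra_simps)

lemma pact_mult: "pact (p * q) f = pact p (pact q f)"
  by (induction p) (simp_all add: pact_pCons pact_smult pact_add)

lemma pact_1 [simp]: "pact 1 f = f"
  by (simp add: one_pCons pact_pCons A_zero)

lemma pact_X: "pact [:0, 1:] f = A f"
  by (simp add: pact_pCons A_zero)

lemma pact_sym: "fin_supp f \<Longrightarrow> fin_supp g \<Longrightarrow> ip (pact p f) g = ip f (pact p g)"
proof (induction p arbitrary: f g)
  case 0
  then show ?case using ip_sym[OF _ fin_supp_zero, of f] by (simp add: ip_def)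
next
  case (pCons c p)
  have sym: "ip f h = ip h f" if "fin_supp h" for h
    using that pCons.prems ip_sym by blast
  have "ip (pact (pCons c p) f) g = c * ip f g + ip (A (pact p f)) g"
    unfolding pact_pCons using pCons.prems
    by (subst ip_add) (auto simp: ip_mult intro!: fin_supp_mult fin_supp_A fin_supp_pact)
  also have "ip (A (pact p f)) g = ip f (pact p (A g))"
    using pCons.prems pCons.IH by (simp add: A_sym fin_supp_pact fin_supp_A)
  also have "pact p (A g) = A (pact p g)"
    by (metis pact_X pact_mult mult.commute)
  also have "c * ip f g + ip f (A (pact p g)) = c * ip g f + ip (A (pact p g)) f"
    using pCons.prems sym[of g] sym[of "A (pact p g)"] by (simp add: fin_supp_A fin_supp_pact)
  also have "\<dots> = ip (pact (pCons c p) g) f"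
    unfolding pact_pCons using pCons.prems
    by (subst ip_add) (auto simp: ip_mult intro!: fin_supp_mult fin_supp_A fin_supp_pact)
  also have "\<dots> = ip f (pact (pCons c p) g)"
    using pCons.prems by (intro sym[symmetric] fin_supp_pact)
  finally show ?case .
qed

lemma pact_square: "fin_supp f \<Longrightarrow> ip (pact (p * q) f) g = ip (pact q f) (pact p g)" if "fin_supp g"
  using that by (simp add: pact_mult pact_sym fin_supp_pact)

lemma ip_pact_X:
  assumes "fin_supp f"
  shows "ip (pact ([:0, 1:] * (p * p)) f) f = ip (A (pact p f)) (pact p f)"
proof -
  have "[:0, 1:] * (p * p) = p * ([:0, 1:] * p)" by (simp only: mult_ac)
  then show ?thesis
    using pact_square[OF assms assms, of p "[:0, 1:] * p"] by (simp only: pact_mult pact_X)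
qed

lemma pos_functional:
  assumes "fin_supp f"
  shows "pos_functional (\<lambda>p. ip (pact p f) f) [:0, 1:]"
proof
  fix p q :: "real poly" and c :: real
  show "ip (pact (p + q) f) f = ip (pact p f) f + ip (pact q f) f"
    using assms by (simp add: pact_add ip_add fin_supp_pact)
  show "ip (pact (smult c p) f) f = c * ip (pact p f) f"
    by (simp add: pact_smult ip_mult)
  show "0 \<le> ip (pact (p * p) f) f"
    using assms by (simp add: pact_square ip_nonneg)
  have eq: "ip (pact ((1 + smult t [:0, 1:]) * (p * p)) f) f =
      ip (pact p f) (pact p f) + t * ip (A (pact p f)) (pact p f)" for t
  proof -
    have "(1 + smult t [:0, 1:]) * (p * p) = p * p + smult t ([:0, 1:] * (p * p))"
      by (simp only: distrib_right mult_smult_left mult_1)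
    then have "ip (pact ((1 + smult t [:0, 1:]) * (p * p)) f) f =
        ip (pact (p * p) f) f + t * ip (pact ([:0, 1:] * (p * p)) f) f"
      using assms by (simp only: pact_add pact_smult ip_add fin_supp_pact fin_supp_mult ip_mult)
    then show ?thesis
      using pact_square[OF assms assms, of p p] ip_pact_X[OF assms, of p] by (simp only:)
  qed
  show "0 \<le> ip (pact ((1 - [:0, 1:]) * (p * p)) f) f"
  proof -
    have "1 - [:0, 1:] = 1 + smult (-1 :: real) [:0, 1:]" by simp
    then show ?thesis
      using eq[of "-1"] A_bounds(2)[OF fin_supp_pact[OF assms], of p] by (simp only:)
  qed
  show "0 \<le> ip (pact ((1 + [:0, 1:]) * (p * p)) f) f"
    using eq[of 1] A_bounds(1)[OF fin_supp_pact[OF assms]] by simp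
qed

lemma ip_cauchy_schwarz:
  assumes "fin_supp f" "fin_supp g"
  shows "\<bar>ip f g\<bar> \<le> sqrt (ip f f) * sqrt (ip g g)"
proof -
  let ?S = "{x. f x \<noteq> 0} \<union> {x. g x \<noteq> 0}"
  have S: "finite ?S" using assms by (simp add: fin_supp_def)
  have *: "ip f' g' = (\<Sum>x\<in>?S. (f' x * sqrt (m x)) * (g' x * sqrt (m x)))"
    if "{x. f' x \<noteq> 0} \<subseteq> ?S" for f' g'
    using ip_eq[OF S that] m_pos by (simp add: less_imp_le mult_ac real_sqrt_mult_self)
  have "\<bar>ip f g\<bar> \<le> (\<Sum>x\<in>?S. \<bar>f x * sqrt (m x)\<bar> * \<bar>g x * sqrt (m x)\<bar>)"
    unfolding *[of f g, simplified] by (rule order.trans[OF sum_abs]) (simp add: abs_mult)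
  also have "\<dots> \<le> L2_set (\<lambda>x. f x * sqrt (m x)) ?S * L2_set (\<lambda>x. g x * sqrt (m x)) ?S"
    by (rule L2_set_mult_ineq)
  also have "\<dots> = sqrt (ip f f) * sqrt (ip g g)"
    unfolding L2_set_def by (subst (1 2) *) (auto simp: power2_eq_square)
  finally show ?thesis .
qed

end

section \<open>A local Nash inequality\<close>

locale wgraph =
  fixes mu :: "'a \<Rightarrow> 'a \<Rightarrow> real"
  assumes wg: "weighted_graph mu"
begin

lemma mu_sym: "mu u v = mu v u" and mu_nonneg: "0 \<le> mu u v" and vm_pos: "0 < vm mu u"
  using wg by (auto simp: weighted_graph_def)

lemma relpow_gdist: "(u, v) \<in> adj mu ^^ gdist mu u v"
proof -
  have "(u, v) \<in> (adj mu)\<^sup>*" using wg by (simp add: weighted_graph_def)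
  then have "\<exists>n. (u, v) \<in> adj mu ^^ n" by (simp add: rtrancl_power)
  then show ?thesis unfolding gdist_def by (rule LeastI_ex)
qed

lemma gdist_le: "(u, v) \<in> adj mu ^^ n \<Longrightarrow> gdist mu u v \<le> n"
  unfolding gdist_def by (rule Least_le)

lemma gdist_self [simp]: "gdist mu u u = 0"
  using gdist_le[of u u 0] by simp

lemma gdist_eq_0: "gdist mu u v = 0 \<longleftrightarrow> u = v"
  using relpow_gdist[of u v] by auto

lemma gdist_triangle: "gdist mu u w \<le> gdist mu u v + gdist mu v w"
  using relpow_gdist[of u v] relpow_gdist[of v w] by (intro gdist_le) (auto simp: relpow_add)

lemma gdist_sym: "gdist mu u v = gdist mu v u"
proof -
  have "gdist mu v u \<le> gdist mu u v" for u v
  proof -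
    have "(x, y) \<in> adj mu ^^ n \<Longrightarrow> (y, x) \<in> adj mu ^^ n" for x y n
    proof (induction n arbitrary: y)
      case (Suc n)
      then obtain w where "(x, w) \<in> adj mu ^^ n" "(w, y) \<in> adj mu" by auto
      then have "(w, x) \<in> adj mu ^^ n" "(y, w) \<in> adj mu"
        using Suc.IH by (auto simp: adj_def mu_sym)
      then show ?case by (metis relpow_Suc_I2)
    qed simp
    then show ?thesis using relpow_gdist[of u v] by (intro gdist_le)
  qed
  then show ?thesis by (simp add: antisym)
qed

lemma gdist_nbr: "mu u v \<noteq> 0 \<Longrightarrow> gdist mu u v \<le> 1"
  using gdist_le[of u v 1] mu_nonneg[of u v] by (auto simp: adj_def)

lemma in_gball: "v \<in> gball mu r u \<longleftrightarrow> real (gdist mu u v) < r"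
  by (simp add: gball_def)

lemma gball_subset:
  assumes "real (gdist mu u v) + r \<le> t"
  shows "gball mu r u \<subseteq> gball mu t v"
proof
  fix x assume "x \<in> gball mu r u"
  then show "x \<in> gball mu t v"
    using gdist_triangle[of v x u] gdist_sym[of u v] assms by (simp add: in_gball)
qed

end

section \<open>Locally finite graphs: Dirichlet restriction, ball volumes, energies\<close>

locale loc_fin_graph = wgraph +
  assumes fin_nb: "finite {v. mu u v \<noteq> 0}"
begin

lemma vm_eq: "finite S \<Longrightarrow> {v. mu u v \<noteq> 0} \<subseteq> S \<Longrightarrow> vm mu u = (\<Sum>v\<in>S. mu u v)"
  unfolding vm_def using infsum_cong_neutral[of "UNIV - S" "S - UNIV" "mu u" "mu u"]
  by (subst infsum_cong_neutral[of S UNIV "mu u" "mu u"]) auto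

lemma sum_mu_le: "finite S \<Longrightarrow> (\<Sum>v\<in>S. mu u v) \<le> vm mu u"
  using vm_eq[of "S \<union> {v. mu u v \<noteq> 0}" u] fin_nb[of u] mu_nonneg
  by (simp add: sum_mono2)

sublocale G: sym_kernel mu "vm mu"
  by unfold_locales (auto simp: mu_sym mu_nonneg vm_pos fin_nb sum_mu_le)

text \<open>Only the weights are cut off, while the measure stays \<open>vm mu\<close>: an edge
  leaving \<open>B\<close> therefore kills mass (Dirichlet condition) instead of reflecting
  it.\<close>

definition dirichlet_weight :: "'a set \<Rightarrow> 'a \<Rightarrow> 'a \<Rightarrow> real" where
  "dirichlet_weight B u v = (if u \<in> B \<and> v \<in> B then mu u v else 0)"

lemma dirichlet_kernel: "sym_kernel (dirichlet_weight B) (vm mu)"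
proof
  fix u v :: 'a and S :: "'a set"
  show "dirichlet_weight B u v = dirichlet_weight B v u" "0 \<le> dirichlet_weight B u v" "0 < vm mu u"
    by (auto simp: dirichlet_weight_def mu_sym mu_nonneg vm_pos)
  show "finite {v. dirichlet_weight B u v \<noteq> 0}"
    by (rule finite_subset[OF _ fin_nb[of u]]) (auto simp: dirichlet_weight_def)
  assume "finite S"
  then show "sum (dirichlet_weight B u) S \<le> vm mu u"
    by (intro order.trans[OF sum_mono sum_mu_le[of S u]]) (auto simp: dirichlet_weight_def mu_nonneg)
qed

lemma finite_gball: "finite (gball mu r u)"
proof -
  have *: "finite {v. (u, v) \<in> adj mu ^^ n}" for n
  proof (induction n)
    case (Suc n)
    have "{v. (u, v) \<in> adj mu ^^ Suc n} \<subseteq> (\<Union>w\<in>{w. (u, w) \<in> adj mu ^^ n}. {v. mu w v \<noteq> 0})"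
      by (auto simp: adj_def)
    then show ?case using Suc fin_nb by (meson finite_UN_I finite_subset)
  qed simp
  have "gball mu r u \<subseteq> (\<Union>n\<in>{..nat \<lceil>r\<rceil>}. {v. (u, v) \<in> adj mu ^^ n})"
  proof
    fix v assume "v \<in> gball mu r u"
    then have "gdist mu u v \<le> nat \<lceil>r\<rceil>" by (simp add: gball_def) linarith
    then show "v \<in> (\<Union>n\<in>{..nat \<lceil>r\<rceil>}. {v. (u, v) \<in> adj mu ^^ n})"
      using relpow_gdist[of u v] by auto
  qed
  then show ?thesis using * by (meson finite_UN_I finite_atMost finite_subset)
qed

definition bv :: "'a \<Rightarrow> real \<Rightarrow> real" where
  "bv u r = (\<Sum>x\<in>gball mu r u. vm mu x)"

lemma vol_gball: "vol mu (gball mu r u) = ennreal (bv u r)"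
  unfolding vol_def bv_def using finite_gball vm_pos by (simp add: less_imp_le sum_ennreal)

lemma bv_nonneg: "0 \<le> bv u r"
  unfolding bv_def using vm_pos by (simp add: less_imp_le sum_nonneg)

lemma bv_pos: "0 < r \<Longrightarrow> 0 < bv u r"
  unfolding bv_def using vm_pos finite_gball
  by (intro sum_pos) (metis empty_iff gdist_self in_gball of_nat_0)+

lemma bv_mono: "gball mu r u \<subseteq> gball mu t v \<Longrightarrow> bv u r \<le> bv v t"
  unfolding bv_def using vm_pos finite_gball by (intro sum_mono2) (auto simp: less_imp_le)

lemma bv_small:
  assumes "0 < r" "r \<le> 1"
  shows "bv u r = vm mu u"
proof -
  have "gball mu r u = {u}"
  proof
    show "gball mu r u \<subseteq> {u}"
    proof
      fix v assume "v \<in> gball mu r u"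
      then have "gdist mu u v = 0" using assms by (simp add: in_gball)
      then show "v \<in> {u}" by (simp add: gdist_eq_0)
    qed
  qed (use assms in \<open>simp add: in_gball\<close>)
  then show ?thesis by (simp add: bv_def)
qed

definition energy_at :: "('a \<Rightarrow> real) \<Rightarrow> 'a \<Rightarrow> real" where
  "energy_at f v = (\<Sum>w | mu v w \<noteq> 0. mu v w * (f v - f w)\<^sup>2)"

lemma energy_at_nonneg: "0 \<le> energy_at f v"
  unfolding energy_at_def using mu_nonneg by (intro sum_nonneg) auto

lemma grad_sq_eq: "grad_sq mu f v * ennreal (vm mu v) = ennreal (energy_at f v)"
proof -
  have "(\<Sum>\<^sub>\<infinity>w. ennreal (mu v w * (f v - f w)\<^sup>2)) = (\<Sum>\<^sub>\<infinity>w\<in>{w. mu v w \<noteq> 0}. ennreal (mu v w * (f v - f w)\<^sup>2))"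
    by (rule infsum_cong_neutral) auto
  also have "\<dots> = ennreal (energy_at f v)"
    using fin_nb mu_nonneg by (simp add: energy_at_def sum_ennreal)
  finally have "grad_sq mu f v * ennreal (vm mu v) =
      ennreal (1 / vm mu v) * ennreal (energy_at f v) * ennreal (vm mu v)"
    by (simp add: grad_sq_def)
  also have "ennreal (1 / vm mu v) * ennreal (energy_at f v) = ennreal (1 / vm mu v * energy_at f v)"
    using vm_pos[of v] energy_at_nonneg by (intro ennreal_mult[symmetric]) auto
  also have "\<dots> * ennreal (vm mu v) = ennreal (1 / vm mu v * energy_at f v * vm mu v)"
    using vm_pos[of v] energy_at_nonneg[of f v] by (intro ennreal_mult[symmetric]) auto
  also have "1 / vm mu v * energy_at f v * vm mu v = energy_at f v"
    using vm_pos[of v] by simp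
  finally show ?thesis .
qed

lemma sum_energy_le:
  assumes "finite V" "fin_supp f"
  shows "(\<Sum>v\<in>V. energy_at f v) \<le> 2 * (G.ip f f - G.ip (G.A f) f)"
proof -
  let ?S = "V \<union> {x. f x \<noteq> 0} \<union> (\<Union>v\<in>V. {w. mu v w \<noteq> 0})"
  have S: "finite ?S" using assms fin_nb by (simp add: fin_supp_def)
  have "(\<Sum>v\<in>V. energy_at f v) = (\<Sum>v\<in>V. \<Sum>w\<in>?S. mu v w * (f v + -1 * f w)\<^sup>2)"
  proof (rule sum.cong[OF refl])
    fix v assume "v \<in> V"
    then show "energy_at f v = (\<Sum>w\<in>?S. mu v w * (f v + -1 * f w)\<^sup>2)"
      unfolding energy_at_def using S by (intro sum.mono_neutral_cong_left) auto
  qed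
  also have "\<dots> \<le> (\<Sum>v\<in>?S. \<Sum>w\<in>?S. mu v w * (f v + -1 * f w)\<^sup>2)"
    using mu_nonneg S by (intro sum_mono2 sum_nonneg) auto
  also have "\<dots> \<le> 2 * (G.ip f f + -1 * G.ip (G.A f) f)"
    using S by (intro G.energy_le) auto
  finally show ?thesis by simp
qed

end

locale doubling_graph = loc_fin_graph +
  fixes r0 :: ereal and D Pc :: real
  assumes D_ge: "1 \<le> D" and Pc_nonneg: "0 \<le> Pc"
    and doubling: "0 < r \<Longrightarrow> ereal r < r0 \<Longrightarrow> bv u (2 * r) \<le> D * bv u r"
    and poincare: "0 < r \<Longrightarrow> ereal r < r0 \<Longrightarrow>
      (\<Sum>v\<in>gball mu r u. (f v - (\<Sum>v\<in>gball mu r u. f v * vm mu v) / bv u r)\<^sup>2 * vm mu v)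
      \<le> Pc * r\<^sup>2 * (\<Sum>v\<in>gball mu (2 * r) u. energy_at f v)"
begin

lemma doubling_iter: "0 < r \<Longrightarrow> ereal r < r0 \<Longrightarrow> bv u r \<le> D ^ k * bv u (r / 2 ^ k)"
proof (induction k)
  case (Suc k)
  have "(1::real) \<le> 2 ^ Suc k" by (rule one_le_power) simp
  then have "r / 2 ^ Suc k \<le> r" using Suc.prems by (simp add: divide_le_eq mult_le_cancel_left1)
  then have "ereal (r / 2 ^ Suc k) < r0"
    using Suc.prems by (metis ereal_less_eq(3) order.strict_trans1)
  then have "bv u (2 * (r / 2 ^ Suc k)) \<le> D * bv u (r / 2 ^ Suc k)"
    using Suc.prems by (intro doubling) auto
  moreover have "2 * (r / 2 ^ Suc k) = r / 2 ^ k" by simp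
  ultimately have "D ^ k * bv u (r / 2 ^ k) \<le> D ^ k * (D * bv u (r / 2 ^ Suc k))"
    using D_ge by (intro mult_left_mono) auto
  with Suc show ?case by (simp add: mult_ac)
qed simp

text \<open>Covering, with weights: the balls of radius \<open>r\<close> that contain
  \<open>x\<close> have total weight at least 1/D, because B_r(z) lies in B_2r(x) for each such
  centre z.\<close>

lemma weight_lower:
  assumes "0 < r" "ereal r < r0"
  shows "1 \<le> D * (\<Sum>z\<in>gball mu r x. vm mu z / bv z r)"
proof -
  have pos: "0 < bv x r" using assms bv_pos by simp
  have "1 = (\<Sum>z\<in>gball mu r x. vm mu z / bv x r)"
    using pos by (simp add: bv_def sum_divide_distrib[symmetric])
  also have "\<dots> \<le> (\<Sum>z\<in>gball mu r x. D * (vm mu z / bv z r))"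
  proof (rule sum_mono)
    fix z assume "z \<in> gball mu r x"
    then have "bv z r \<le> bv x (2 * r)"
      using gdist_sym[of x z] by (intro bv_mono gball_subset) (simp add: in_gball)
    also have "\<dots> \<le> D * bv x r" by (intro doubling assms)
    finally have "bv z r \<le> D * bv x r" .
    moreover have "0 < bv z r" using assms bv_pos by simp
    ultimately have "1 / bv x r \<le> D / bv z r" using pos by (simp add: field_simps)
    then show "vm mu z / bv x r \<le> D * (vm mu z / bv z r)"
      using vm_pos[of z] mult_left_mono[of "1 / bv x r" "D / bv z r" "vm mu z"] by (simp add: mult_ac)
  qed
  finally show ?thesis by (simp add: sum_distrib_left)
qed

text \<open>Bounded overlap of the doubled balls, which occur on the right of the Poincare
  inequality. B_2r(x) lies in B_4r(z), and two doublings bring this back to B_r(z).\<close>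

lemma weight_upper:
  assumes "0 < r" "ereal (2 * r) < r0"
  shows "(\<Sum>z\<in>gball mu (2 * r) x. vm mu z / bv z r) \<le> D\<^sup>2"
proof -
  have r: "ereal r < r0" using assms(2) by (rule order.strict_trans1[rotated]) (use assms(1) in simp)
  have pos: "0 < bv x (2 * r)" using assms bv_pos by simp
  have "(\<Sum>z\<in>gball mu (2 * r) x. vm mu z / bv z r) \<le> (\<Sum>z\<in>gball mu (2 * r) x. D\<^sup>2 * (vm mu z / bv x (2 * r)))"
  proof (rule sum_mono)
    fix z assume "z \<in> gball mu (2 * r) x"
    then have "bv x (2 * r) \<le> bv z (2 * (2 * r))"
      by (intro bv_mono gball_subset) (simp add: in_gball)
    also have "\<dots> \<le> D * bv z (2 * r)" using assms by (intro doubling) auto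
    also have "\<dots> \<le> D * (D * bv z r)" using D_ge assms r by (intro mult_left_mono doubling) auto
    finally have "bv x (2 * r) \<le> D\<^sup>2 * bv z r" by (simp add: power2_eq_square)
    moreover have "0 < bv z r" using assms bv_pos by simp
    ultimately have "1 / bv z r \<le> D\<^sup>2 / bv x (2 * r)" using pos by (simp add: field_simps)
    then show "vm mu z / bv z r \<le> D\<^sup>2 * (vm mu z / bv x (2 * r))"
      using vm_pos[of z] mult_left_mono[of "1 / bv z r" "D\<^sup>2 / bv x (2 * r)" "vm mu z"] by (simp add: mult_ac)
  qed
  also have "\<dots> = D\<^sup>2"
    using pos by (simp add: bv_def sum_divide_distrib[symmetric] sum_distrib_left[symmetric])
  finally show ?thesis .
qed

lemma ball_square_le:
  assumes "0 < r" "ereal r < r0"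
  shows "(\<Sum>x\<in>gball mu r z. (f x)\<^sup>2 * vm mu x) \<le>
    2 * (Pc * r\<^sup>2 * (\<Sum>v\<in>gball mu (2 * r) z. energy_at f v)) + 2 * ((\<Sum>x\<in>gball mu r z. f x * vm mu x)\<^sup>2 / bv z r)"
proof -
  define t where "t = (\<Sum>x\<in>gball mu r z. f x * vm mu x) / bv z r"
  have pos: "0 < bv z r" using assms bv_pos by simp
  have "(\<Sum>x\<in>gball mu r z. (f x)\<^sup>2 * vm mu x) \<le>
      (\<Sum>x\<in>gball mu r z. 2 * ((f x - t)\<^sup>2 * vm mu x) + 2 * (t\<^sup>2 * vm mu x))"
  proof (rule sum_mono)
    fix x
    have "(f x)\<^sup>2 \<le> 2 * (f x - t)\<^sup>2 + 2 * t\<^sup>2"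
      using zero_le_power2[of "f x - 2 * t"] by (simp add: power2_eq_square algebra_simps)
    then show "(f x)\<^sup>2 * vm mu x \<le> 2 * ((f x - t)\<^sup>2 * vm mu x) + 2 * (t\<^sup>2 * vm mu x)"
      using vm_pos[of x] mult_right_mono[of "(f x)\<^sup>2" "2 * (f x - t)\<^sup>2 + 2 * t\<^sup>2" "vm mu x"] by (simp add: algebra_simps)
  qed
  also have "\<dots> = 2 * (\<Sum>x\<in>gball mu r z. (f x - t)\<^sup>2 * vm mu x) + 2 * (t\<^sup>2 * bv z r)"
    by (simp add: sum.distrib sum_distrib_left bv_def)
  also have "t\<^sup>2 * bv z r = (\<Sum>x\<in>gball mu r z. f x * vm mu x)\<^sup>2 / bv z r"
    using pos by (simp add: t_def power2_eq_square)
  finally show ?thesis using poincare[OF assms, of f z] by (simp add: t_def)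
qed

text \<open>A local Nash inequality. Instead of a covering of the support by balls of radius \<open>\<rho>\<close>, all such
  balls are used, the one around \<open>z\<close> with weight \<open>m(z) / m(B\<^sub>\<rho>(z))\<close>.\<close>

lemma nash:
  assumes r: "0 < r" "ereal r < r0" and k: "2 \<le> k"
    and supp: "{x. f x \<noteq> 0} \<subseteq> gball mu (r / 2) u" and nonneg: "\<And>x. 0 \<le> f x"
  shows "G.ip f f \<le> 4 * D ^ 3 * Pc * (r / 2 ^ k)\<^sup>2 * (G.ip f f - G.ip (G.A f) f)
    + 2 * D ^ 4 * D ^ k * (\<Sum>x\<in>gball mu (r / 2) u. f x * vm mu x)\<^sup>2 / bv u r"
proof -
  define \<rho> where "\<rho> = r / 2 ^ k"
  define X where "X = gball mu (r / 2) u"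
  \<comment> \<open>Centres of balls that may meet the support: r/2 + \<open>\<rho>\<close> <= 3r/4.
    The balls of radius 2 \<open>\<rho>\<close> around them stay inside \<open>V\<close>.\<close>
  define Z where "Z = gball mu (3 / 4 * r) u"
  define V where "V = gball mu (2 * r) u"
  define N where "N = (\<Sum>x\<in>X. f x * vm mu x)"
  define w where "w z = vm mu z / bv z \<rho>" for z
  have "(4::real) \<le> 2 ^ k"
    using power_increasing[OF k, of "2::real"] by simp
  then have \<rho>: "0 < \<rho>" "\<rho> \<le> r / 4"
    using r unfolding \<rho>_def by (auto simp: field_simps)
  have \<rho>0: "ereal (2 * \<rho>) < r0" "ereal \<rho> < r0"
    using r(2) by (rule order.strict_trans1[rotated], use \<rho> r in simp)+
  have fin: "finite X" "finite Z" "finite V"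
    by (simp_all add: X_def Z_def V_def finite_gball)
  have fs: "fin_supp f"
    using supp finite_gball by (auto simp: fin_supp_def intro: finite_subset)
  have w_nonneg: "0 \<le> w z" for z
    using vm_pos[of z] bv_nonneg[of z \<rho>] by (simp add: w_def less_imp_le)
  have N_nonneg: "0 \<le> N"
    unfolding N_def using nonneg vm_pos by (intro sum_nonneg) (simp add: less_imp_le)
  have swap: "(\<Sum>x\<in>X. \<Sum>z\<in>gball mu \<rho> x. w z * h x) = (\<Sum>z\<in>Z. w z * (\<Sum>x\<in>{x\<in>X. real (gdist mu x z) < \<rho>}. h x))" for h
  proof -
    have "(\<Sum>x\<in>X. \<Sum>z\<in>gball mu \<rho> x. w z * h x) = (\<Sum>x\<in>X. \<Sum>z\<in>{z\<in>Z. real (gdist mu x z) < \<rho>}. w z * h x)"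
    proof (rule sum.cong[OF refl])
      fix x assume "x \<in> X"
      then have "gball mu \<rho> x \<subseteq> Z"
        unfolding Z_def using \<rho> gdist_sym[of u x] by (intro gball_subset) (auto simp: X_def in_gball)
      then have "gball mu \<rho> x = {z\<in>Z. real (gdist mu x z) < \<rho>}"
        by (auto simp: in_gball)
      then show "(\<Sum>z\<in>gball mu \<rho> x. w z * h x) = (\<Sum>z\<in>{z\<in>Z. real (gdist mu x z) < \<rho>}. w z * h x)"
        by simp
    qed
    also have "\<dots> = (\<Sum>z\<in>Z. \<Sum>x\<in>{x\<in>X. real (gdist mu x z) < \<rho>}. w z * h x)"
      using fin by (intro sum.swap_restrict)
    finally show ?thesis by (simp add: sum_distrib_left)
  qed
  have ball_sum: "(\<Sum>x\<in>{x\<in>X. real (gdist mu x z) < \<rho>}. h x) = (\<Sum>x\<in>gball mu \<rho> z. h x)"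
    if "\<And>x. f x = 0 \<Longrightarrow> h x = 0" for h :: "'a \<Rightarrow> real" and z
  proof (rule sum.mono_neutral_left[OF finite_gball])
    show "{x\<in>X. real (gdist mu x z) < \<rho>} \<subseteq> gball mu \<rho> z"
      using gdist_sym by (auto simp: in_gball)
    show "\<forall>i\<in>gball mu \<rho> z - {x \<in> X. real (gdist mu x z) < \<rho>}. h i = 0"
      using supp that gdist_sym by (fastforce simp: in_gball X_def)
  qed
  have "G.ip f f = (\<Sum>x\<in>X. (f x)\<^sup>2 * vm mu x)"
    using G.ip_eq[of X f f] supp fin by (simp add: X_def power2_eq_square)
  also have "\<dots> \<le> (\<Sum>x\<in>X. (f x)\<^sup>2 * vm mu x * (D * (\<Sum>z\<in>gball mu \<rho> x. w z)))"
  proof (rule sum_mono)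
    fix x
    have "0 \<le> (f x)\<^sup>2 * vm mu x" using vm_pos[of x] by simp
    then show "(f x)\<^sup>2 * vm mu x \<le> (f x)\<^sup>2 * vm mu x * (D * (\<Sum>z\<in>gball mu \<rho> x. w z))"
      using weight_lower[OF \<rho>(1) \<rho>0(2), of x] unfolding w_def[symmetric]
      by (metis mult.right_neutral mult_left_mono)
  qed
  also have "\<dots> = D * (\<Sum>x\<in>X. \<Sum>z\<in>gball mu \<rho> x. w z * ((f x)\<^sup>2 * vm mu x))"
    by (simp add: sum_distrib_left mult_ac)
  also have "\<dots> = D * (\<Sum>z\<in>Z. w z * (\<Sum>x\<in>gball mu \<rho> z. (f x)\<^sup>2 * vm mu x))"
    unfolding swap by (subst ball_sum) auto
  also have "\<dots> \<le> D * (\<Sum>z\<in>Z. w z * (2 * (Pc * \<rho>\<^sup>2 * (\<Sum>v\<in>gball mu (2 * \<rho>) z. energy_at f v))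
      + 2 * ((\<Sum>x\<in>gball mu \<rho> z. f x * vm mu x)\<^sup>2 / bv z \<rho>)))"
    using D_ge w_nonneg by (intro mult_left_mono sum_mono ball_square_le \<rho> \<rho>0) auto
  also have "\<dots> = D * (2 * Pc * \<rho>\<^sup>2 * (\<Sum>z\<in>Z. w z * (\<Sum>v\<in>gball mu (2 * \<rho>) z. energy_at f v))
      + 2 * (\<Sum>z\<in>Z. w z * ((\<Sum>x\<in>gball mu \<rho> z. f x * vm mu x)\<^sup>2 / bv z \<rho>)))"
    by (simp add: sum_distrib_left sum.distrib algebra_simps)
  finally have main: "G.ip f f \<le> D * (2 * Pc * \<rho>\<^sup>2 * (\<Sum>z\<in>Z. w z * (\<Sum>v\<in>gball mu (2 * \<rho>) z. energy_at f v))
      + 2 * (\<Sum>z\<in>Z. w z * ((\<Sum>x\<in>gball mu \<rho> z. f x * vm mu x)\<^sup>2 / bv z \<rho>)))" .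
  have energy: "(\<Sum>z\<in>Z. w z * (\<Sum>v\<in>gball mu (2 * \<rho>) z. energy_at f v)) \<le> D\<^sup>2 * (2 * (G.ip f f - G.ip (G.A f) f))"
  proof -
    have "(\<Sum>z\<in>Z. w z * (\<Sum>v\<in>gball mu (2 * \<rho>) z. energy_at f v))
        = (\<Sum>z\<in>Z. \<Sum>v\<in>{v\<in>V. real (gdist mu z v) < 2 * \<rho>}. w z * energy_at f v)"
    proof (rule sum.cong[OF refl])
      fix z assume "z \<in> Z"
      then have "gball mu (2 * \<rho>) z \<subseteq> V"
        unfolding V_def using \<rho> r gdist_sym[of u z] by (intro gball_subset) (auto simp: Z_def in_gball)
      then have "gball mu (2 * \<rho>) z = {v\<in>V. real (gdist mu z v) < 2 * \<rho>}"
        by (auto simp: in_gball)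
      then show "w z * (\<Sum>v\<in>gball mu (2 * \<rho>) z. energy_at f v) = (\<Sum>v\<in>{v\<in>V. real (gdist mu z v) < 2 * \<rho>}. w z * energy_at f v)"
        by (simp add: sum_distrib_left)
    qed
    also have "\<dots> = (\<Sum>v\<in>V. \<Sum>z\<in>{z\<in>Z. real (gdist mu z v) < 2 * \<rho>}. w z * energy_at f v)"
      using fin by (intro sum.swap_restrict)
    also have "\<dots> \<le> (\<Sum>v\<in>V. D\<^sup>2 * energy_at f v)"
    proof (rule sum_mono)
      fix v
      have "(\<Sum>z\<in>{z\<in>Z. real (gdist mu z v) < 2 * \<rho>}. w z) \<le> (\<Sum>z\<in>gball mu (2 * \<rho>) v. w z)"
        using finite_gball w_nonneg gdist_sym by (intro sum_mono2) (auto simp: in_gball)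
      also have "\<dots> \<le> D\<^sup>2"
        unfolding w_def by (rule weight_upper[OF \<rho>(1) \<rho>0(1)])
      finally show "(\<Sum>z\<in>{z\<in>Z. real (gdist mu z v) < 2 * \<rho>}. w z * energy_at f v) \<le> D\<^sup>2 * energy_at f v"
        using energy_at_nonneg by (simp add: sum_distrib_right[symmetric] mult_right_mono)
    qed
    also have "\<dots> = D\<^sup>2 * (\<Sum>v\<in>V. energy_at f v)" by (simp add: sum_distrib_left)
    also have "\<dots> \<le> D\<^sup>2 * (2 * (G.ip f f - G.ip (G.A f) f))"
      by (intro mult_left_mono sum_energy_le fin fs) auto
    finally show ?thesis .
  qed
  \<comment> \<open>Of the two factors in the squared mass of a ball, one is bounded by the total
    mass \<open>N\<close> and the other is summed over the balls. Doubling gives m(B_rho(z)) >=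
    m(B_r(u)) / D^(k+1).\<close>
  have mass: "(\<Sum>z\<in>Z. w z * ((\<Sum>x\<in>gball mu \<rho> z. f x * vm mu x)\<^sup>2 / bv z \<rho>)) \<le> D ^ 3 * D ^ k * N\<^sup>2 / bv u r"
  proof -
    have "(\<Sum>z\<in>Z. w z * ((\<Sum>x\<in>gball mu \<rho> z. f x * vm mu x)\<^sup>2 / bv z \<rho>))
        \<le> (\<Sum>z\<in>Z. w z * ((D * D ^ k / bv u r * N) * (\<Sum>x\<in>gball mu \<rho> z. f x * vm mu x)))"
    proof (intro sum_mono mult_left_mono w_nonneg)
      fix z assume "z \<in> Z"
      define n where "n = (\<Sum>x\<in>gball mu \<rho> z. f x * vm mu x)"
      have n0: "0 \<le> n"
        unfolding n_def using nonneg vm_pos by (intro sum_nonneg) (simp add: less_imp_le)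
      have "n = (\<Sum>x\<in>{x\<in>X. real (gdist mu x z) < \<rho>}. f x * vm mu x)"
        unfolding n_def by (rule ball_sum[symmetric]) simp
      also have "\<dots> \<le> N"
        unfolding N_def using fin nonneg vm_pos by (intro sum_mono2) (auto simp: less_imp_le)
      finally have nN: "n \<le> N" .
      have "bv u r \<le> bv z (2 * r)"
        using \<open>z \<in> Z\<close> r by (intro bv_mono gball_subset) (simp add: Z_def in_gball)
      also have "\<dots> \<le> D * bv z r" by (intro doubling r)
      also have "\<dots> \<le> D * (D ^ k * bv z \<rho>)"
        unfolding \<rho>_def using D_ge by (intro mult_left_mono doubling_iter r) auto
      finally have "bv u r \<le> D * D ^ k * bv z \<rho>" by (simp add: mult_ac)
      moreover have pos: "0 < bv u r" "0 < bv z \<rho>" using r \<rho> bv_pos by auto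
      ultimately have "1 / bv z \<rho> \<le> D * D ^ k / bv u r" by (simp add: field_simps)
      then have "(n * n) * (1 / bv z \<rho>) \<le> (N * n) * (D * D ^ k / bv u r)"
        using nN n0 N_nonneg pos by (intro mult_mono) auto
      then show "n\<^sup>2 / bv z \<rho> \<le> (D * D ^ k / bv u r * N) * n"
        by (simp add: power2_eq_square mult_ac)
    qed
    also have "\<dots> = (D * D ^ k / bv u r * N) * (\<Sum>z\<in>Z. w z * (\<Sum>x\<in>gball mu \<rho> z. f x * vm mu x))"
      unfolding sum_distrib_left[of "D * D ^ k / bv u r * N" _ Z] by (simp only: mult.left_commute)
    finally have *: "(\<Sum>z\<in>Z. w z * ((\<Sum>x\<in>gball mu \<rho> z. f x * vm mu x)\<^sup>2 / bv z \<rho>))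
        \<le> (D * D ^ k / bv u r * N) * (\<Sum>z\<in>Z. w z * (\<Sum>x\<in>gball mu \<rho> z. f x * vm mu x))" .
    have "(\<Sum>z\<in>Z. w z * (\<Sum>x\<in>gball mu \<rho> z. f x * vm mu x))
        = (\<Sum>x\<in>X. \<Sum>z\<in>gball mu \<rho> x. w z * (f x * vm mu x))"
      unfolding swap by (subst ball_sum) auto
    also have "\<dots> \<le> (\<Sum>x\<in>X. D\<^sup>2 * (f x * vm mu x))"
    proof (rule sum_mono)
      fix x
      have "(\<Sum>z\<in>gball mu \<rho> x. w z) \<le> (\<Sum>z\<in>gball mu (2 * \<rho>) x. w z)"
        using finite_gball w_nonneg \<rho> by (intro sum_mono2) (auto simp: in_gball)
      also have "\<dots> \<le> D\<^sup>2"
        unfolding w_def by (rule weight_upper[OF \<rho>(1) \<rho>0(1)])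
      finally have "(\<Sum>z\<in>gball mu \<rho> x. w z) * (f x * vm mu x) \<le> D\<^sup>2 * (f x * vm mu x)"
        using nonneg[of x] vm_pos[of x] by (intro mult_right_mono) auto
      then show "(\<Sum>z\<in>gball mu \<rho> x. w z * (f x * vm mu x)) \<le> D\<^sup>2 * (f x * vm mu x)"
        by (simp add: sum_distrib_right)
    qed
    also have "\<dots> = D\<^sup>2 * N" by (simp add: N_def sum_distrib_left)
    finally have "(D * D ^ k / bv u r * N) * (\<Sum>z\<in>Z. w z * (\<Sum>x\<in>gball mu \<rho> z. f x * vm mu x))
        \<le> (D * D ^ k / bv u r * N) * (D\<^sup>2 * N)"
      using D_ge N_nonneg bv_nonneg by (intro mult_left_mono) auto
    note *[THEN order.trans, OF this]
    also have "(D * D ^ k / bv u r * N) * (D\<^sup>2 * N) = D ^ 3 * D ^ k * N\<^sup>2 / bv u r"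
      by (simp add: power2_eq_square power3_eq_cube)
    finally show ?thesis .
  qed
  have "G.ip f f \<le> D * (2 * Pc * \<rho>\<^sup>2 * (D\<^sup>2 * (2 * (G.ip f f - G.ip (G.A f) f))) + 2 * (D ^ 3 * D ^ k * N\<^sup>2 / bv u r))"
    using D_ge Pc_nonneg energy mass
    by (intro order.trans[OF main] mult_left_mono add_mono) auto
  also have "\<dots> = 4 * D ^ 3 * Pc * \<rho>\<^sup>2 * (G.ip f f - G.ip (G.A f) f) + 2 * D ^ 4 * D ^ k * N\<^sup>2 / bv u r"
    by (simp add: power2_eq_square power3_eq_cube power4_eq_xxxx algebra_simps)
  finally show ?thesis by (simp add: \<rho>_def N_def X_def)
qed

end

section \<open>On-diagonal bounds\<close>

lemma power2_two_power: "(2 ^ j)\<^sup>2 = (4::real) ^ j"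
proof -
  have "(2 ^ j)\<^sup>2 = ((2::real)\<^sup>2) ^ j" by (simp only: power_mult[symmetric] mult.commute)
  then show ?thesis by simp
qed

definition fejer_factor :: "nat \<Rightarrow> real poly" where
  "fejer_factor n = smult (1 / real n ^ 2) (cheb_fejer [:0, 1:] n)"

text \<open>This is H = (1 - Phi) / (n^2 (1 - P)): one factor n^2 normalises S_n, the other balances
  1 - P.\<close>

definition rest_factor :: "nat \<Rightarrow> real poly" where
  "rest_factor n = smult (1 / real n ^ 4) (cheb_rest [:0, 1:] n)"

lemma fejer_partition:
  assumes "1 \<le> n"
  shows "fejer_factor n + smult (real n ^ 2) ((1 - [:0, 1:]) * rest_factor n) = 1"
proof -
  have "smult (real n ^ 2) ((1 - [:0, 1:]) * rest_factor n) =
      smult (1 / real n ^ 2) ((1 - [:0, 1:]) * cheb_rest [:0, 1:] n)"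
    using assms by (simp add: rest_factor_def power2_eq_square power4_eq_xxxx)
  also have "\<dots> = smult (1 / real n ^ 2) (of_nat (n * n)) - fejer_factor n"
    unfolding one_minus_mult_rest by (simp add: fejer_factor_def smult_diff_right)
  also have "smult (1 / real n ^ 2) (of_nat (n * n)) = 1"
    using assms by (simp add: of_nat_poly power2_eq_square one_pCons)
  finally show ?thesis by simp
qed

lemma degree_factors: "degree (fejer_factor n) \<le> n - 1" "degree (rest_factor n) \<le> n - 1"
  unfolding fejer_factor_def rest_factor_def
  using degree_fejer[of "[:0, 1 :: real:]" n] degree_rest[of "[:0, 1 :: real:]" n] degree_smult_le order.trans
  by fastforce+

context pos_functional
begin

lemma bdd_scaled: "bdd T c \<Longrightarrow> 0 \<le> t \<Longrightarrow> t * c \<le> d \<Longrightarrow> bdd (smult t T) d"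
  using bdd_mono[OF bdd_smult[of T c t]] by simp

text \<open>Both factors obey the same two bounds, so the smoothing estimate need not know which of
  them occurs where. The second bound uses (1 - y) Phi = (1 - T_n) / n^2 and (1 - y) H = (n^2 - S_n)
  / n^4.\<close>

lemma bdd_factors:
  assumes y: "y = [:0, 1:]" and n: "1 \<le> n" and E: "E \<in> {fejer_factor n, rest_factor n}"
  shows "bdd E 2" "bdd ((1 - y) * E) (2 / real n ^ 2)"
proof -
  have "bdd (fejer_factor n) 2" "bdd (rest_factor n) 2"
    unfolding fejer_factor_def rest_factor_def y[symmetric]
    using n by (auto intro!: bdd_scaled[OF bdd_fejer] bdd_scaled[OF bdd_rest])
  then show "bdd E 2" using E by auto
  have "bdd (1 - cheb y n) 2"
    using bdd_add[OF bdd_one bdd_uminus[OF bdd_cheb[of n]]] by simp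
  moreover have "(1 - y) * fejer_factor n = smult (1 / real n ^ 2) (1 - cheb y n)"
    unfolding fejer_factor_def y[symmetric] by (simp add: one_minus_mult_fejer)
  ultimately have "bdd ((1 - y) * fejer_factor n) (2 / real n ^ 2)"
    by (auto intro!: bdd_scaled)
  moreover have "bdd ((1 - y) * rest_factor n) (2 / real n ^ 2)"
  proof -
    have "bdd (of_nat (n * n) * 1 + - cheb_fejer y n) (real (n * n) * 1 + (real n)\<^sup>2)"
      by (intro bdd_add bdd_const_mult bdd_one bdd_uminus bdd_fejer)
    then have "bdd (of_nat (n * n) - cheb_fejer y n) (2 * (real n)\<^sup>2)"
      by (simp add: power2_eq_square)
    moreover have "(1 - y) * rest_factor n = smult (1 / real n ^ 4) (of_nat (n * n) - cheb_fejer y n)"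
      unfolding rest_factor_def y[symmetric] mult_smult_right one_minus_mult_rest ..
    moreover have "1 / real n ^ 4 * (2 * (real n)\<^sup>2) \<le> 2 / (real n)\<^sup>2"
      using n by (simp add: power2_eq_square power4_eq_xxxx)
    ultimately show ?thesis
      using bdd_scaled by (metis divide_nonneg_nonneg of_nat_0_le_iff zero_le_one zero_le_power)
  qed
  ultimately show "bdd ((1 - y) * E) (2 / real n ^ 2)" using E by auto
qed

end

context sym_kernel
begin

lemma A_nonneg: "(\<And>x. 0 \<le> f x) \<Longrightarrow> 0 \<le> A f u"
  unfolding A_def using nu_nonneg m_pos[of u] by (intro divide_nonneg_pos sum_nonneg) auto

lemma A_mass:
  assumes "finite S" "{x. f x \<noteq> 0} \<subseteq> S" "\<And>x. 0 \<le> f x"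
  shows "(\<Sum>x\<in>S. A f x * m x) \<le> (\<Sum>x\<in>S. f x * m x)"
proof -
  have "A f x * m x = (\<Sum>w\<in>S. nu x w * f w)" for x
    using m_pos[of x] by (simp add: A_eq[OF assms(1,2)])
  then have "(\<Sum>x\<in>S. A f x * m x) = (\<Sum>x\<in>S. \<Sum>w\<in>S. nu x w * f w)"
    by simp
  also have "\<dots> = (\<Sum>w\<in>S. \<Sum>x\<in>S. nu x w * f w)"
    by (rule sum.swap)
  also have "\<dots> = (\<Sum>w\<in>S. (\<Sum>x\<in>S. nu w x) * f w)"
    unfolding sum_distrib_right by (intro sum.cong refl) (metis nu_sym)
  also have "\<dots> \<le> (\<Sum>w\<in>S. m w * f w)"
    using assms by (intro sum_mono mult_right_mono nu_le)
  finally show ?thesis by (simp add: mult.commute)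
qed

lemma pact_lazy: "pact (smult (1 / 3) (2 + [:0, 1:])) f = (\<lambda>u. (2 * f u + A f u) / 3)"
proof -
  have "2 + [:0, 1:] = [:2, 1 :: real:]" by (simp add: numeral_poly)
  then have "pact (smult (1 / 3) (2 + [:0, 1:])) f = (\<lambda>u. 2 / 3 * f u + A (\<lambda>x. 1 / 3 * f x) u)"
    by (simp add: pact_pCons A_zero)
  then show ?thesis unfolding A_mult by (simp add: add_divide_distrib)
qed

text \<open>The mass bound that the Nash inequality needs. The support condition on \<open>A\<close>
  is satisfied by the Dirichlet kernel of \<open>S\<close>, whose walk never leaves
  \<open>S\<close>.\<close>

lemma pact_lazy_power:
  assumes "finite S" "\<And>f x. A f x \<noteq> 0 \<Longrightarrow> x \<in> S" "v \<in> S"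
  shows "0 \<le> pact (smult (1 / 3) (2 + [:0, 1:]) ^ n) (point v) x \<and>
    {x. pact (smult (1 / 3) (2 + [:0, 1:]) ^ n) (point v) x \<noteq> 0} \<subseteq> S \<and>
    (\<Sum>x\<in>S. pact (smult (1 / 3) (2 + [:0, 1:]) ^ n) (point v) x * m x) \<le> 1"
    (is "?P n x")
proof (induction n arbitrary: x)
  case 0
  have "(\<Sum>x\<in>S. point v x * m x) = (\<Sum>x\<in>S. if x = v then 1 else 0)"
    using m_pos[of v] by (intro sum.cong) (auto simp: point_def)
  then have "(\<Sum>x\<in>S. point v x * m x) \<le> 1" using assms by simp
  moreover have "{x. point v x \<noteq> 0} \<subseteq> S" "0 \<le> point v x" using assms(3) m_pos[of v] by (auto simp: point_def)
  ultimately show ?case by simp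
next
  case (Suc n)
  let ?f = "pact (smult (1 / 3) (2 + [:0, 1:]) ^ n) (point v)"
  have f: "\<And>x. 0 \<le> ?f x" "{x. ?f x \<noteq> 0} \<subseteq> S" "(\<Sum>x\<in>S. ?f x * m x) \<le> 1"
    by (rule Suc[THEN conjunct1], rule Suc[THEN conjunct2, THEN conjunct1], rule Suc[THEN conjunct2, THEN conjunct2])
  have eq: "pact (smult (1 / 3) (2 + [:0, 1:]) ^ Suc n) (point v) = (\<lambda>u. (2 * ?f u + A ?f u) / 3)"
    unfolding power_Suc pact_mult by (rule pact_lazy)
  have "(\<Sum>x\<in>S. (2 * ?f x + A ?f x) / 3 * m x) = (\<Sum>x\<in>S. 2 / 3 * (?f x * m x) + 1 / 3 * (A ?f x * m x))"
    by (intro sum.cong refl) (simp add: field_simps)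
  also have "\<dots> = 2 / 3 * (\<Sum>x\<in>S. ?f x * m x) + 1 / 3 * (\<Sum>x\<in>S. A ?f x * m x)"
    by (simp only: sum.distrib sum_distrib_left)
  also have "\<dots> \<le> 1"
    using A_mass[OF assms(1) f(2,1)] f(3) by linarith
  finally have mass: "(\<Sum>x\<in>S. (2 * ?f x + A ?f x) / 3 * m x) \<le> 1" .
  have supp: "{x. (2 * ?f x + A ?f x) / 3 \<noteq> 0} \<subseteq> S"
  proof
    fix x assume "x \<in> {x. (2 * ?f x + A ?f x) / 3 \<noteq> 0}"
    then have "?f x \<noteq> 0 \<or> A ?f x \<noteq> 0" by auto
    then show "x \<in> S"
    proof
      assume "?f x \<noteq> 0"
      then show ?thesis using f(2) by (rule set_mp[rotated, OF CollectI])
    next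
      assume "A ?f x \<noteq> 0"
      then show ?thesis by (rule assms(2))
    qed
  qed
  have nonneg: "0 \<le> (2 * ?f x + A ?f x) / 3"
  proof -
    have "0 \<le> A ?f x" by (rule A_nonneg) (rule f(1))
    with f(1)[of x] show ?thesis by (intro divide_nonneg_pos add_nonneg_nonneg mult_nonneg_nonneg) simp_all
  qed
  define g where "g = pact (smult (1 / 3) (2 + [:0, 1:]) ^ Suc n) (point v)"
  have g: "g = (\<lambda>u. (2 * ?f u + A ?f u) / 3)" unfolding g_def by (rule eq)
  have "0 \<le> g x" unfolding g by (rule nonneg)
  moreover have "{x. g x \<noteq> 0} \<subseteq> S" unfolding g by (rule supp)
  moreover have "(\<Sum>x\<in>S. g x * m x) \<le> 1" unfolding g by (rule mass)
  ultimately show ?case unfolding g_def by (rule conjI[OF _ conjI])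
qed

end

section \<open>Finite range and comparison with the Dirichlet restriction\<close>

context loc_fin_graph
begin

lemma dirichlet_support:
  assumes "sym_kernel.A (dirichlet_weight B) (vm mu) f x \<noteq> 0"
  shows "x \<in> B"
proof -
  interpret Dk: sym_kernel "dirichlet_weight B" "vm mu" by (rule dirichlet_kernel)
  show ?thesis
    by (rule ccontr) (use assms in \<open>simp add: Dk.A_def dirichlet_weight_def\<close>)
qed

lemma pact_support:
  assumes "G.pact p (G.point u) x \<noteq> 0"
  shows "gdist mu u x \<le> degree p"
  using assms
proof (induction p arbitrary: x)
  case (pCons c p)
  show ?case
  proof (cases "x = u")
    case False
    then have "G.A (G.pact p (G.point u)) x \<noteq> 0"
      using pCons.prems by (auto simp: G.pact_pCons G.point_def[of u x])
    then obtain w where "mu x w * G.pact p (G.point u) w \<noteq> 0"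
      unfolding G.A_def by (metis (mono_tags, lifting) div_0 sum.neutral)
    then have w: "mu x w \<noteq> 0" "G.pact p (G.point u) w \<noteq> 0" by auto
    have "p \<noteq> 0" using w(2) by auto
    have "gdist mu u x \<le> gdist mu u w + gdist mu w x" by (rule gdist_triangle)
    also have "\<dots> \<le> degree p + 1"
      using pCons.IH[OF w(2)] gdist_nbr[OF w(1)] gdist_sym[of x w] by simp
    finally show ?thesis using \<open>p \<noteq> 0\<close> by simp
  qed simp
qed simp

text \<open>In Horner's scheme the operator is applied only to functions supported within distance n
  - 1 of \<open>u\<close>, so every edge that matters has both ends in \<open>B\<close>.\<close>

lemma dirichlet_pact_eq:
  assumes "{x. gdist mu u x \<le> n} \<subseteq> B" "degree p \<le> n"
  shows "sym_kernel.pact (dirichlet_weight B) (vm mu) p (G.point u) = G.pact p (G.point u)"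
proof -
  interpret Dk: sym_kernel "dirichlet_weight B" "vm mu" by (rule dirichlet_kernel)
  show ?thesis
    using assms(2)
  proof (induction p)
    case (pCons c p)
    let ?g = "G.pact p (G.point u)"
    have deg: "p = 0 \<or> Suc (degree p) \<le> n" using pCons.prems by (auto split: if_splits)
    have supp: "gdist mu u x \<le> degree p" if "?g x \<noteq> 0" for x
      using that by (rule pact_support)
    have "Dk.A ?g x = G.A ?g x" for x
    proof (cases "p = 0")
      case False
      then have n: "Suc (degree p) \<le> n" using deg by simp
      let ?S = "{w. ?g w \<noteq> 0}"
      have S: "finite ?S" using G.fin_supp_pact[OF G.fin_supp_point] by (simp add: fin_supp_def)
      have "(\<Sum>w\<in>?S. dirichlet_weight B x w * ?g w) = (\<Sum>w\<in>?S. mu x w * ?g w)"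
      proof (intro sum.cong refl)
        fix w assume w: "w \<in> ?S"
        then have wB: "w \<in> B" using supp[of w] n assms(1) by auto
        show "dirichlet_weight B x w * ?g w = mu x w * ?g w"
        proof (cases "mu x w = 0")
          case False
          have "gdist mu u x \<le> gdist mu u w + gdist mu w x" by (rule gdist_triangle)
          also have "\<dots> \<le> n"
            using supp[of w] w n gdist_nbr[OF False] gdist_sym[of x w] by simp
          finally have "x \<in> B" using assms(1) by auto
          then show ?thesis using wB by (simp add: dirichlet_weight_def)
        qed (simp add: dirichlet_weight_def)
      qed
      then show ?thesis
        using Dk.A_eq[OF S order.refl] G.A_eq[OF S order.refl] by simp
    qed (simp add: Dk.A_zero G.A_zero)
    moreover have "Dk.pact p (G.point u) = ?g"
      using deg pCons.IH by auto
    ultimately show ?case by (simp add: Dk.pact_pCons G.pact_pCons)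
  qed simp
qed

end

context doubling_graph
begin

text \<open>Nash iteration in time blocks. The squared norms \<open>a n\<close> decrease and their
  decrements control the Dirichlet form, so that summing the Nash inequality over 4^i <= n < 4^(i+1)
  telescopes. \<open>l\<close> makes the telescoped term small against the block length.\<close>

lemma on_diagonal_decay:
  assumes r: "0 < r" "ereal r < r0" and K: "r \<le> 2 ^ K" and l: "2 \<le> l" "24 * D ^ 4 * Pc \<le> 4 ^ l"
    and B: "B = gball mu (r / 2) u"
    and lazy: "lazy = smult (1 / 3) (2 + [:0, 1:])"
    and a: "\<And>n. a n = G.ip (sym_kernel.pact (dirichlet_weight B) (vm mu) (lazy ^ n * lazy ^ n) (G.point u)) (G.point u)"
    and i: "i \<le> K"
  shows "a (4 ^ i) \<le> 4 * D ^ (l + 5) * D ^ (K - i) / bv u r"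
proof -
  interpret Dk: sym_kernel "dirichlet_weight B" "vm mu" by (rule dirichlet_kernel)
  define L where "L p = G.ip (Dk.pact p (G.point u)) (G.point u)" for p
  interpret L: pos_functional L "[:0, 1:]"
    unfolding L_def by (rule Dk.pos_functional) (rule G.fin_supp_point)
  have L_lazy: "L.lazy = lazy" by (simp add: L.lazy_def lazy)
  have aL: "a n = L (lazy ^ n * lazy ^ n)" for n by (simp add: a L_def)
  define f where "f n = Dk.pact (lazy ^ n) (G.point u)" for n
  have uB: "u \<in> B" using r by (simp add: B in_gball)
  have finB: "finite B" by (simp add: B finite_gball)
  have mem: "x \<in> B" if "Dk.A g x \<noteq> 0" for g x
    using that by (rule dirichlet_support)
  have f: "0 \<le> f n x" "{x. f n x \<noteq> 0} \<subseteq> B" "(\<Sum>x\<in>B. f n x * vm mu x) \<le> 1" for n x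
  proof -
    have "0 \<le> f n x \<and> {x. f n x \<noteq> 0} \<subseteq> B \<and> (\<Sum>x\<in>B. f n x * vm mu x) \<le> 1"
      unfolding f_def lazy by (rule Dk.pact_lazy_power[OF finB _ uB]) (rule mem)
    then show "0 \<le> f n x" "{x. f n x \<noteq> 0} \<subseteq> B" "(\<Sum>x\<in>B. f n x * vm mu x) \<le> 1" by simp_all
  qed
  have fs: "fin_supp (f n)" for n
    unfolding f_def by (intro Dk.fin_supp_pact G.fin_supp_point)
  have a_f: "a n = G.ip (f n) (f n)" for n
    unfolding a f_def by (intro Dk.pact_square G.fin_supp_point)
  \<comment> \<open>No boundary term arises: on functions supported in \<open>B\<close> the forms of
    P and of its restriction coincide.\<close>
  have dir: "G.ip (G.A (f n)) (f n) = G.ip (Dk.A (f n)) (f n)" for n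
    unfolding G.ip_A[OF finB f(2) f(2)] Dk.ip_A[OF finB f(2) f(2)]
    by (intro sum.cong) (auto simp: dirichlet_weight_def)
  have decr: "G.ip (f n) (f n) - G.ip (G.A (f n)) (f n) \<le> 3 * (a n - a (Suc n))" for n
  proof -
    have "(1 - [:0, 1:]) * (lazy ^ n * lazy ^ n) = lazy ^ n * lazy ^ n - [:0, 1:] * (lazy ^ n * lazy ^ n)"
      by (simp only: left_diff_distrib mult_1)
    then have "L ((1 - [:0, 1:]) * (lazy ^ n * lazy ^ n)) = a n - G.ip (Dk.A (f n)) (f n)"
      using Dk.ip_pact_X[OF G.fin_supp_point[of u], of "lazy ^ n"]
      by (simp only: L.diff aL f_def) (simp only: L_def)
    then show ?thesis
      using L.lazy_decrement[of "lazy ^ n"] unfolding L_lazy a_f[symmetric] dir aL power_Suc by simp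
  qed
  have diff_nonneg: "0 \<le> G.ip (f n) (f n) - G.ip (G.A (f n)) (f n)" for n
    using G.A_bounds(2)[OF fs] .
  have anti: "a (n + k) \<le> a n" for n k
  proof (induction k)
    case (Suc k)
    then show ?case using decr[of "n + k"] diff_nonneg[of "n + k"] by simp
  qed simp
  have a_nonneg: "0 \<le> a n" for n unfolding a_f by (rule G.ip_nonneg)
  define V where "V = 1 / bv u r"
  have V: "0 < V" using bv_pos[OF r(1)] by (simp add: V_def)
  have "a (4 ^ i) \<le> 4 * D ^ (l + 5) * D ^ (K - i) * V"
    using i
  proof (induction i)
    case 0
    \<comment> \<open>A ball of radius at most 1 is a single vertex, so the trivial value 1 / m(u)
      is reached by \<open>Suc K\<close> doublings.\<close>
    have "r / 2 ^ Suc K \<le> 1" using K r by (simp add: field_simps)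
    then have "bv u (r / 2 ^ Suc K) = vm mu u" using r by (intro bv_small) auto
    then have "bv u r \<le> D ^ Suc K * vm mu u" using doubling_iter[OF r, of u "Suc K"] by simp
    then have "1 / vm mu u \<le> D ^ Suc K * V"
      using vm_pos[of u] bv_pos[OF r(1), of u] by (simp add: V_def field_simps)
    moreover have "a 0 = 1 / vm mu u"
      using G.ip_point[OF G.fin_supp_point[of u], of u] by (simp add: a G.point_def)
    moreover have "a (4 ^ 0) \<le> a 0" using anti[of 0 1] by simp
    moreover have "D ^ Suc K * V \<le> 4 * D ^ (l + 5) * D ^ K * V"
    proof -
      have "D ^ 1 \<le> D ^ (l + 5)" using D_ge by (intro power_increasing) auto
      then have "D ^ 1 \<le> 4 * D ^ (l + 5)" using D_ge by simp
      then have "D ^ 1 * (D ^ K * V) \<le> 4 * D ^ (l + 5) * (D ^ K * V)"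
        using D_ge V by (intro mult_right_mono) auto
      then show ?thesis by (simp add: mult_ac)
    qed
    ultimately show ?case by simp
  next
    case (Suc i)
    \<comment> \<open>The Nash radius r / 2^k is then at most 2^(i - l), the diffusive length of
      time 4^i reduced by 2^l.\<close>
    define k where "k = K - i + l"
    have k: "2 \<le> k" using l by (simp add: k_def)
    define E where "E = 12 * D ^ 3 * Pc * (4 ^ i / 4 ^ l)"
    define T where "T = 2 * D ^ 4 * D ^ k * V"
    have E_nonneg: "0 \<le> E" using D_ge Pc_nonneg by (simp add: E_def)
    have scale: "(r / 2 ^ k)\<^sup>2 \<le> 4 ^ i / 4 ^ l"
    proof -
      have "(r / 2 ^ k)\<^sup>2 \<le> (2 ^ K / 2 ^ k)\<^sup>2"
        using K r by (intro power_mono divide_right_mono) auto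
      also have "\<dots> = 4 ^ K / 4 ^ k"
        by (simp add: power_divide power2_two_power)
      also have "\<dots> = 4 ^ i / 4 ^ l"
        using Suc.prems by (simp add: k_def power_add power_diff)
      finally show ?thesis .
    qed
    have step: "a n \<le> E * (a n - a (Suc n)) + T" for n
    proof -
      have "a n \<le> 4 * D ^ 3 * Pc * (r / 2 ^ k)\<^sup>2 * (G.ip (f n) (f n) - G.ip (G.A (f n)) (f n))
          + 2 * D ^ 4 * D ^ k * (\<Sum>x\<in>B. f n x * vm mu x)\<^sup>2 / bv u r"
        unfolding a_f B using f(1,2) by (intro nash r k) (auto simp: B)
      also have "\<dots> \<le> 4 * D ^ 3 * Pc * (4 ^ i / 4 ^ l) * (3 * (a n - a (Suc n))) + 2 * D ^ 4 * D ^ k * 1 / bv u r"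
      proof (intro add_mono mult_mono divide_right_mono order.refl scale decr diff_nonneg)
        show "(\<Sum>x\<in>B. f n x * vm mu x)\<^sup>2 \<le> 1"
          using f(1,3) vm_pos by (intro power_le_one sum_nonneg) (auto simp: less_imp_le)
      qed (use D_ge Pc_nonneg bv_nonneg in auto)
      also have "4 * D ^ 3 * Pc * (4 ^ i / 4 ^ l) * (3 * (a n - a (Suc n))) = E * (a n - a (Suc n))"
        by (simp add: E_def algebra_simps)
      also have "2 * D ^ 4 * D ^ k * 1 / bv u r = T"
        by (simp add: T_def V_def)
      finally show ?thesis .
    qed
    have "3 * 4 ^ i * a (4 ^ Suc i) = (\<Sum>n\<in>{4 ^ i..<4 ^ Suc i :: nat}. a (4 ^ Suc i))"
    proof -
      have "card {4 ^ i..<4 ^ Suc i :: nat} = 3 * 4 ^ i" by simp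
      then show ?thesis by (simp only: sum_constant of_nat_mult of_nat_power of_nat_numeral)
    qed
    also have "\<dots> \<le> (\<Sum>n\<in>{4 ^ i..<4 ^ Suc i :: nat}. E * (a n - a (Suc n)) + T)"
    proof (rule sum_mono)
      fix n :: nat assume "n \<in> {4 ^ i..<4 ^ Suc i :: nat}"
      then show "a (4 ^ Suc i) \<le> E * (a n - a (Suc n)) + T"
        using anti[of n "4 ^ Suc i - n"] step[of n] by simp
    qed
    also have "\<dots> = E * (a (4 ^ i) - a (4 ^ Suc i)) + 3 * 4 ^ i * T"
    proof -
      have "(\<Sum>n\<in>{4 ^ i..<4 ^ Suc i :: nat}. a n - a (Suc n)) = a (4 ^ i) - a (4 ^ Suc i)"
        using sum_Suc_diff'[of "4 ^ i" "4 ^ Suc i" "\<lambda>n. - a n"] by simp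
      moreover have "card {4 ^ i..<4 ^ Suc i :: nat} = 3 * 4 ^ i" by simp
      ultimately show ?thesis
        by (simp only: sum.distrib sum_distrib_left[symmetric] sum_constant of_nat_mult of_nat_power of_nat_numeral)
    qed
    also have "\<dots> \<le> E * a (4 ^ i) + 3 * 4 ^ i * T"
      using E_nonneg a_nonneg by (simp add: mult_left_mono)
    also have "\<dots> \<le> E * (4 * D ^ (l + 5) * D ^ (K - i) * V) + 3 * 4 ^ i * T"
      using Suc E_nonneg by (intro add_right_mono mult_left_mono) auto
    also have "E * (4 * D ^ (l + 5) * D ^ (K - i) * V) \<le> 4 ^ i * (2 * D ^ (l + 5) * D ^ (K - Suc i) * V)"
    proof -
      have "K - i = Suc (K - Suc i)" using Suc.prems by simp
      then have "E * (4 * D ^ (l + 5) * D ^ (K - i) * V) =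
          (24 * D ^ 4 * Pc) * (4 ^ i / 4 ^ l * (2 * D ^ (l + 5) * D ^ (K - Suc i) * V))"
        by (simp add: E_def power3_eq_cube power4_eq_xxxx)
      also have "\<dots> \<le> 4 ^ l * (4 ^ i / 4 ^ l * (2 * D ^ (l + 5) * D ^ (K - Suc i) * V))"
        using l D_ge V by (intro mult_right_mono) auto
      finally show ?thesis by simp
    qed
    also have "3 * 4 ^ i * T = 3 * (4 ^ i * (2 * D ^ (l + 5) * D ^ (K - Suc i) * V))"
    proof -
      have "4 + k = (l + 5) + (K - Suc i)" using Suc.prems by (simp add: k_def)
      then have "D ^ 4 * D ^ k = D ^ (l + 5) * D ^ (K - Suc i)" by (simp only: power_add[symmetric])
      then show ?thesis by (simp add: T_def)
    qed
    finally have "3 * 4 ^ i * a (4 ^ Suc i) \<le> 4 ^ i * (4 * (2 * D ^ (l + 5) * D ^ (K - Suc i) * V))"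
      by (simp add: mult_ac)
    \<comment> \<open>In units of 2 D^(l+5) D^(K - Suc i) V, the block sum is at most 4^i times 1 +
      3, from the telescoped term and the mass term. Over 3 * 4^i indices this gives 4/3, below the
      2 units claimed.\<close>
    then have "3 * a (4 ^ Suc i) \<le> 4 * (2 * D ^ (l + 5) * D ^ (K - Suc i) * V)"
    proof -
      have "3 * x \<le> 4 * y" if "3 * 4 ^ i * x \<le> 4 ^ i * (4 * y)" for x y :: real
        using that mult_le_cancel_left_pos[of "4 ^ i" "3 * x" "4 * y"] by (simp add: mult_ac)
      then show "3 * 4 ^ i * a (4 ^ Suc i) \<le> 4 ^ i * (4 * (2 * D ^ (l + 5) * D ^ (K - Suc i) * V)) \<Longrightarrow> ?thesis" .
    qed
    moreover have "0 \<le> D ^ (l + 5) * D ^ (K - Suc i) * V" using D_ge V by simp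
    ultimately show ?case by simp
  qed
  then show ?thesis by (simp add: V_def)
qed

text \<open>The abstract estimate is applied on the Dirichlet ball of radius r/2. The product has
  degree at most M (n - 1) <= r/4, so on the point mass it agrees with the product for the full
  graph. The form of \<open>D\<close> matches the decay rate required by
  \<open>smoothing_bound\<close>.\<close>

lemma smoothing:
  assumes M: "1 \<le> M" and D: "D = 2 * 4 ^ (M - 1)"
  shows "\<exists>C\<ge>0. \<forall>u r n E. 1 / 2 \<le> r \<longrightarrow> ereal r < r0 \<longrightarrow> 1 \<le> n \<longrightarrow> r / (4 * real M) \<le> real n \<longrightarrow>
    real (M * (n - 1)) \<le> r / 4 \<longrightarrow> (\<forall>j<M. E j \<in> {fejer_factor n, rest_factor n}) \<longrightarrow>
    G.ip (G.pact (\<Prod>j<M. E j) (G.point u)) (G.pact (\<Prod>j<M. E j) (G.point u)) \<le> C / bv u r"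
proof -
  obtain l0 where l0: "24 * D ^ 4 * Pc < 4 ^ l0"
    using real_arch_pow[of 4] by auto
  define l where "l = l0 + 2"
  have "(4::real) ^ l0 \<le> 4 ^ l" by (intro power_increasing) (auto simp: l_def)
  then have l: "2 \<le> l" "24 * D ^ 4 * Pc \<le> 4 ^ l"
    using l0 by (simp add: l_def, linarith)
  define C where "C = 4 * D ^ (l + 5)"
  \<comment> \<open>128 = 2 * 4 * 16, from the bound 2 / n^2 for (1 - P) E, from 4^K <= 4 r^2, and
    from r^2 <= 16 M^2 n^2.\<close>
  define c where "c = 128 * (real M)\<^sup>2"
  have C: "0 \<le> C" using D_ge by (simp add: C_def)
  have "1 \<le> (real M)\<^sup>2" using M by (intro one_le_power) simp
  then have c: "2 \<le> c" unfolding c_def by linarith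
  show ?thesis
  proof (intro exI[of _ "9 * iter_const C c M"] conjI allI impI)
    show "0 \<le> 9 * iter_const C c M" using iter_const_nonneg[OF C, of c] c by simp
    fix u r n E
    assume r: "1 / 2 \<le> r" "ereal r < r0" and n: "1 \<le> n" "r / (4 * real M) \<le> real n"
      "real (M * (n - 1)) \<le> r / 4" and E: "\<forall>j<M. E j \<in> {fejer_factor n, rest_factor n}"
    have "\<exists>K. r \<le> 2 ^ K" using real_arch_pow[of 2 r] less_imp_le by auto
    then obtain K where K: "r \<le> 2 ^ K" "\<And>k. k < K \<Longrightarrow> \<not> r \<le> 2 ^ k"
      using exists_least_iff[of "\<lambda>K. r \<le> 2 ^ K"] by auto
    \<comment> \<open>Minimality of \<open>K\<close> gives this for K > 0; for K = 0 it is r >=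
      1/2.\<close>
    have K2: "(4::real) ^ K \<le> 4 * r\<^sup>2"
    proof (cases K)
      case 0
      have "(1 / 2)\<^sup>2 \<le> r\<^sup>2" using r by (intro power_mono) auto
      then show ?thesis using 0 by (simp add: power2_eq_square)
    next
      case (Suc k)
      then have "2 ^ k \<le> r" using K(2)[of k] by simp
      then have "(2 ^ k)\<^sup>2 \<le> r\<^sup>2" by (intro power_mono) auto
      then show ?thesis using Suc by (simp add: power2_two_power)
    qed
    define B where "B = gball mu (r / 2) u"
    interpret Dk: sym_kernel "dirichlet_weight B" "vm mu" by (rule dirichlet_kernel)
    define L where "L p = G.ip (Dk.pact p (G.point u)) (G.point u)" for p
    interpret L: pos_functional L "[:0, 1:]"
      unfolding L_def by (rule Dk.pos_functional) (rule G.fin_supp_point)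
    let ?W = "\<Prod>j<M. E j"
    have "L (?W * ?W) \<le> 9 * iter_const C c M * (1 / bv u r)"
    proof (rule L.smoothing_bound[OF M C])
      show "0 \<le> 1 / bv u r" using bv_nonneg by simp
      show "0 \<le> c" using c by simp
      fix i assume "i \<le> K"
      then show "L (L.lazy ^ 4 ^ i * L.lazy ^ 4 ^ i) \<le> C * (2 * 4 ^ (M - 1)) ^ (K - i) * (1 / bv u r)"
        using on_diagonal_decay[OF _ r(2) K(1) l B_def L.lazy_def refl] r
        by (simp add: D C_def L_def)
    next
      fix j assume "j < M"
      then have Ej: "E j \<in> {fejer_factor n, rest_factor n}" using E by blast
      show "L.bdd (E j) c"
        using L.bdd_mono[OF L.bdd_factors(1)[OF refl n(1) Ej] c] .
      have "2 / (real n)\<^sup>2 \<le> c / 4 ^ K"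
      proof -
        have "(r / (4 * real M))\<^sup>2 \<le> (real n)\<^sup>2" using n r M by (intro power_mono) auto
        then have "r\<^sup>2 \<le> 16 * (real M)\<^sup>2 * (real n)\<^sup>2"
          using M by (simp add: power_divide power_mult_distrib field_simps)
        then have "2 * 4 ^ K \<le> c * (real n)\<^sup>2" using K2 by (simp add: c_def)
        then show ?thesis using n by (simp add: field_simps)
      qed
      then show "L.bdd ((1 - [:0, 1:]) * E j) (c / 4 ^ K)"
        using L.bdd_mono[OF L.bdd_factors(2)[OF refl n(1) Ej]] by blast
    qed
    moreover have "L (?W * ?W) = G.ip (G.pact ?W (G.point u)) (G.pact ?W (G.point u))"
    proof -
      have "degree ?W \<le> (\<Sum>j<M. degree (E j))"
        by (rule order.trans[OF degree_prod_sum_le]) auto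
      also have "\<dots> \<le> (\<Sum>j<M. n - 1)"
        using E degree_factors[of n] by (intro sum_mono) fastforce
      finally have deg: "degree ?W \<le> M * (n - 1)" by simp
      have "{x. gdist mu u x \<le> M * (n - 1)} \<subseteq> B"
      proof
        fix x assume "x \<in> {x. gdist mu u x \<le> M * (n - 1)}"
        then have "real (gdist mu u x) \<le> r / 4"
          using n(3) by (meson mem_Collect_eq of_nat_le_iff order.trans)
        then show "x \<in> B" using r by (simp add: B_def in_gball)
      qed
      then have "Dk.pact ?W (G.point u) = G.pact ?W (G.point u)"
        by (rule dirichlet_pact_eq) (rule deg)
      then show ?thesis
        unfolding L_def by (simp add: Dk.pact_square G.fin_supp_point)
    qed
    ultimately show "G.ip (G.pact ?W (G.point u)) (G.pact ?W (G.point u)) \<le> 9 * iter_const C c M / bv u r"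
      by simp
  qed
qed

end

section \<open>The spectral lower bound\<close>

context pos_functional
begin

text \<open>For Y = y - c one has 0 <= Y <= 2, hence Y^2 <= 2Y. The weight Y is known to be positive
  only against squares, so Y (1 - Y/2)^2 is expanded and its cubic term is absorbed by Y^3 <= 2
  Y^2.\<close>

lemma shifted_square_le:
  assumes c: "-1 \<le> c" and lower_c: "\<And>p. 0 \<le> L ((y - [:c:]) * (p * p))"
  shows "L ((y - [:c:]) * (y - [:c:])) \<le> 2 * L (y - [:c:])"
proof -
  define Y where "Y = y - [:c:]"
  have "0 \<le> L (Y * ((1 - smult (1 / 2) Y) * (1 - smult (1 / 2) Y)))"
    using lower_c unfolding Y_def .
  moreover have "Y * ((1 - smult (1 / 2) Y) * (1 - smult (1 / 2) Y)) = Y - Y * Y + smult (1 / 4) (Y * (Y * Y))"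
  proof -
    have "Y * ((1 - H) * (1 - H)) = Y - (Y * H + Y * H) + Y * (H * H)" for H
      by (simp add: algebra_simps)
    moreover have "Y * smult (1 / 2) Y + Y * smult (1 / 2) Y = Y * Y"
      by (simp flip: smult_add_left)
    ultimately show ?thesis by (simp add: mult_ac)
  qed
  ultimately have 1: "0 \<le> L Y - L (Y * Y) + 1 / 4 * L (Y * (Y * Y))"
    by (simp only: diff add smult)
  have "(y - [:c:]) * Q = Q - smult c Q - (1 - y) * Q" for Q
    by (simp add: left_diff_distrib)
  then have "L (Y * (Y * Y)) = L (Y * Y - smult c (Y * Y) - (1 - y) * (Y * Y))"
    by (simp only: Y_def)
  then have "L (Y * (Y * Y)) = (1 - c) * L (Y * Y) - L ((1 - y) * (Y * Y))"
    by (simp only: diff smult left_diff_distrib mult_1)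
  also have "\<dots> \<le> 2 * L (Y * Y)"
    using upper[of Y] c square[of Y] mult_right_mono[of "1 - c" 2 "L (Y * Y)"] by simp
  finally show ?thesis using 1 unfolding Y_def by simp
qed

end

context loc_fin_graph
begin

lemma fin_supp_l2:
  assumes "fin_supp f"
  shows "(\<lambda>v. complex_of_real (f v)) \<in> l2 mu"
    and "l2_norm mu (\<lambda>v. complex_of_real (f v)) = sqrt (G.ip f f)"
proof -
  have S: "finite {x. f x \<noteq> 0}" using assms by (simp add: fin_supp_def)
  have "finite {x \<in> UNIV. (cmod (complex_of_real (f x)))\<^sup>2 * vm mu x \<noteq> 0}"
    by (rule finite_subset[OF _ S]) auto
  then show "(\<lambda>v. complex_of_real (f v)) \<in> l2 mu"
    by (simp add: l2_def finite_nonzero_values_imp_summable_on)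
  have "(\<Sum>\<^sub>\<infinity>v. (cmod (complex_of_real (f v)))\<^sup>2 * vm mu v) = (\<Sum>\<^sub>\<infinity>v\<in>{x. f x \<noteq> 0}. f v * f v * vm mu v)"
    by (rule infsum_cong_neutral) (auto simp: power2_eq_square)
  then show "l2_norm mu (\<lambda>v. complex_of_real (f v)) = sqrt (G.ip f f)"
    using S by (simp add: l2_norm_def G.ip_def)
qed

lemma markov_op_eq:
  assumes "fin_supp f"
  shows "markov_op mu (\<lambda>v. complex_of_real (f v)) = (\<lambda>u. complex_of_real (G.A f u))"
proof
  fix u
  have S: "finite {x. f x \<noteq> 0}" using assms by (simp add: fin_supp_def)
  have "markov_op mu (\<lambda>v. complex_of_real (f v)) u =
      (\<Sum>\<^sub>\<infinity>v\<in>{x. f x \<noteq> 0}. complex_of_real (mu u v / vm mu u * f v))"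
    unfolding markov_op_def markov_def by (rule infsum_cong_neutral) auto
  also have "\<dots> = complex_of_real (\<Sum>v | f v \<noteq> 0. mu u v / vm mu u * f v)"
    using S by simp
  also have "(\<Sum>v | f v \<noteq> 0. mu u v / vm mu u * f v) = G.A f u"
    unfolding G.A_eq[OF S order.refl] by (simp add: sum_divide_distrib)
  finally show "markov_op mu (\<lambda>v. complex_of_real (f v)) u = complex_of_real (G.A f u)" .
qed

text \<open>The infimum of the Rayleigh quotient is an approximate eigenvalue, hence in the spectrum.\<close>

lemma spectral_lower_bound:
  assumes spec: "l2_spectrum mu (markov_op mu) \<subseteq> complex_of_real ` {a<..1}" and "fin_supp f0"
  shows "a * G.ip f0 f0 \<le> G.ip (G.A f0) f0"
proof (rule ccontr)
  assume neg: "\<not> a * G.ip f0 f0 \<le> G.ip (G.A f0) f0"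
  define S where "S = {G.ip (G.A f) f / G.ip f f | f. fin_supp f \<and> 0 < G.ip f f}"
  define c where "c = Inf S"
  have ge: "-1 \<le> t" if "t \<in> S" for t
  proof -
    from that obtain f where f: "fin_supp f" "0 < G.ip f f" "t = G.ip (G.A f) f / G.ip f f"
      unfolding S_def by auto
    then show ?thesis using G.A_bounds(1)[OF f(1)] unfolding f(3) pos_le_divide_eq[OF f(2)] by simp
  qed
  then have bdd: "bdd_below S" unfolding bdd_below_def by blast
  have pos: "0 < G.ip f0 f0"
  proof (rule ccontr)
    assume "\<not> 0 < G.ip f0 f0"
    then have "G.ip f0 f0 = 0" using G.ip_nonneg[of f0] by simp
    then show False using neg G.A_bounds[OF assms(2)] by simp
  qed
  have f0S: "G.ip (G.A f0) f0 / G.ip f0 f0 \<in> S" using assms(2) pos by (auto simp: S_def)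
  have "c \<le> G.ip (G.A f0) f0 / G.ip f0 f0" unfolding c_def by (rule cInf_lower[OF f0S bdd])
  also have "\<dots> < a" using neg pos by (simp add: field_simps)
  finally have ca: "c < a" .
  have c1: "-1 \<le> c" unfolding c_def using f0S ge by (intro cInf_greatest) auto
  have lower: "c * G.ip f f \<le> G.ip (G.A f) f" if f: "fin_supp f" for f
  proof (cases "0 < G.ip f f")
    case True
    then have "c \<le> G.ip (G.A f) f / G.ip f f"
      unfolding c_def using f by (intro cInf_lower[OF _ bdd]) (auto simp: S_def)
    then show ?thesis using True by (simp add: field_simps)
  next
    case False
    then have "G.ip f f = 0" using G.ip_nonneg[of f] by simp
    then show ?thesis using G.A_bounds[OF f] by simp
  qed
  have "complex_of_real c \<notin> l2_spectrum mu (markov_op mu)"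
    using spec ca by auto
  then obtain R where R: "l2_bounded_linear mu R"
    "\<And>f. f \<in> l2 mu \<Longrightarrow> R (\<lambda>v. complex_of_real c * f v - markov_op mu f v) = f"
    unfolding l2_spectrum_def by auto
  then obtain B where B: "\<And>f. f \<in> l2 mu \<Longrightarrow> l2_norm mu (R f) \<le> B * l2_norm mu f"
    unfolding l2_bounded_linear_def by blast
  define h where "h f = (\<lambda>v. c * f v - G.A f v)" for f
  have fs_h: "fin_supp (h f)" if "fin_supp f" for f
    unfolding h_def using that by (intro fin_supp_diff fin_supp_mult G.fin_supp_A)
  \<comment> \<open>A bounded inverse of c - P bounds c - P from below; only finitely supported real
    vectors are needed.\<close>
  have inv: "sqrt (G.ip f f) \<le> \<bar>B\<bar> * sqrt (G.ip (h f) (h f))" if f: "fin_supp f" for f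
  proof -
    have "R (\<lambda>v. complex_of_real (h f v)) = (\<lambda>v. complex_of_real (f v))"
      using R(2)[OF fin_supp_l2(1)[OF f]] unfolding markov_op_eq[OF f] by (simp add: h_def)
    then have "sqrt (G.ip f f) \<le> B * sqrt (G.ip (h f) (h f))"
      using B[OF fin_supp_l2(1)[OF fs_h[OF f]]] by (simp add: fin_supp_l2(2) f fs_h)
    also have "\<dots> \<le> \<bar>B\<bar> * sqrt (G.ip (h f) (h f))"
      using G.ip_nonneg by (intro mult_right_mono) auto
    finally show ?thesis .
  qed
  \<comment> \<open>Since P - c is nonnegative and bounded by 2, a Rayleigh quotient close to
    \<open>c\<close> makes (c - P) f itself small.\<close>
  have approx: "G.ip (h f) (h f) \<le> 2 * (G.ip (G.A f) f - c * G.ip f f)" if f: "fin_supp f" for f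
  proof -
    interpret L: pos_functional "\<lambda>p. G.ip (G.pact p f) f" "[:0, 1:]"
      by (rule G.pos_functional[OF f])
    have Y: "[:0, 1:] - [:c:] = [:0, 1:] - smult c 1" by (simp add: one_pCons)
    have pactY: "G.pact ([:0, 1:] - [:c:]) g = (\<lambda>v. - h g v)" for g
    proof -
      have "[:0, 1:] - [:c:] = [:-c, 1:]" by simp
      then show ?thesis by (simp add: G.pact_pCons G.A_zero h_def)
    qed
    have ip_h: "G.ip (\<lambda>v. - h g v) g = G.ip (G.A g) g - c * G.ip g g" if "fin_supp g" for g
      using that G.ip_diff[OF fin_supp_mult G.fin_supp_A, of g g c g] G.ip_mult[of "-1" "h g" g]
      by (simp add: h_def G.ip_mult)
    have "G.ip (G.pact (([:0, 1:] - [:c:]) * ([:0, 1:] - [:c:])) f) f \<le> 2 * G.ip (G.pact ([:0, 1:] - [:c:]) f) f"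
    proof (rule L.shifted_square_le[OF c1])
      fix p
      have "([:0, 1:] - [:c:]) * (p * p) = p * (([:0, 1:] - [:c:]) * p)" by (simp only: mult_ac)
      then have "G.ip (G.pact (([:0, 1:] - [:c:]) * (p * p)) f) f = G.ip (\<lambda>v. - h (G.pact p f) v) (G.pact p f)"
        using G.pact_square[OF f f, of p "([:0, 1:] - [:c:]) * p"] by (simp only: G.pact_mult[of "[:0, 1:] - [:c:]"] pactY)
      then show "0 \<le> G.ip (G.pact (([:0, 1:] - [:c:]) * (p * p)) f) f"
        using lower[OF G.fin_supp_pact[OF f]] ip_h[OF G.fin_supp_pact[OF f], of p] by simp
    qed
    moreover have "G.ip (G.pact (([:0, 1:] - [:c:]) * ([:0, 1:] - [:c:])) f) f = G.ip (\<lambda>v. - h f v) (\<lambda>v. - h f v)"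
      using G.pact_square[OF f f, of "[:0, 1:] - [:c:]" "[:0, 1:] - [:c:]"] by (simp only: pactY)
    moreover have "G.ip (\<lambda>v. - h f v) (\<lambda>v. - h f v) = G.ip (h f) (h f)"
      by (simp add: G.ip_def)
    ultimately show ?thesis using ip_h[OF f] by (simp only: pactY)
  qed
  \<comment> \<open>Chosen so that a vector with Rayleigh quotient below c + e violates the lower
    bound \<open>inv\<close>.\<close>
  define e where "e = 1 / (4 * (B\<^sup>2 + 1))"
  have e: "0 < e" "2 * B\<^sup>2 * e < 1"
    using add_pos_nonneg[of 1 "B\<^sup>2"] by (auto simp: e_def field_simps add_pos_nonneg)
  have "\<exists>t\<in>S. t < c + e" unfolding c_def using f0S e by (intro cInf_lessD) auto
  then obtain f where f: "fin_supp f" "0 < G.ip f f" "G.ip (G.A f) f / G.ip f f < c + e"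
    unfolding S_def by auto
  have "G.ip f f = (sqrt (G.ip f f))\<^sup>2" using f by simp
  also have "\<dots> \<le> (\<bar>B\<bar> * sqrt (G.ip (h f) (h f)))\<^sup>2"
    using inv[OF f(1)] f(2) by (intro power_mono) auto
  also have "\<dots> = B\<^sup>2 * G.ip (h f) (h f)"
    using G.ip_nonneg[of "h f"] by (simp add: power_mult_distrib)
  also have "\<dots> \<le> B\<^sup>2 * (2 * (G.ip (G.A f) f - c * G.ip f f))"
    using approx[OF f(1)] by (intro mult_left_mono) auto
  also have "\<dots> \<le> B\<^sup>2 * (2 * (e * G.ip f f))"
    using f(2,3) by (intro mult_left_mono) (auto simp: field_simps)
  also have "\<dots> = (2 * B\<^sup>2 * e) * G.ip f f" by simp
  also have "\<dots> < 1 * G.ip f f" using e f(2) by (intro mult_strict_right_mono) auto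
  finally show False by simp
qed

text \<open>The polynomial Y with X = (1 - s) + s Y, so that multiplication by X acts on the
  Chebyshev polynomials of Y as one step of the walk with law beta_s.\<close>

definition shifted_X :: "real \<Rightarrow> real poly" where
  "shifted_X s = [:- (1 - s) / s, 1 / s:]"

text \<open>Here 1 - a <= 2s is used: 1 + Y = (X + 2s - 1) / s, and P >= a >= 1 - 2s.\<close>

lemma pos_functional_shifted:
  assumes spec: "l2_spectrum mu (markov_op mu) \<subseteq> complex_of_real ` {a<..1}"
    and s: "0 < s" "1 - a \<le> 2 * s" and f: "fin_supp f"
  shows "pos_functional (\<lambda>p. G.ip (G.pact p f) f) (shifted_X s)"
proof -
  interpret L: pos_functional "\<lambda>p. G.ip (G.pact p f) f" "[:0, 1:]"
    by (rule G.pos_functional[OF f])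
  show ?thesis
  proof
    fix p q :: "real poly" and c :: real
    show "G.ip (G.pact (p + q) f) f = G.ip (G.pact p f) f + G.ip (G.pact q f) f"
      by (rule L.add)
    show "G.ip (G.pact (smult c p) f) f = c * G.ip (G.pact p f) f"
      by (rule L.smult)
    show "0 \<le> G.ip (G.pact (p * p) f) f" by (rule L.square)
    have "1 - shifted_X s = smult (1 / s) (1 - [:0, 1:])"
      using s by (simp add: shifted_X_def one_pCons field_simps)
    then have "G.ip (G.pact ((1 - shifted_X s) * (p * p)) f) f = 1 / s * G.ip (G.pact ((1 - [:0, 1:]) * (p * p)) f) f"
      by (simp only: mult_smult_left L.smult)
    then show "0 \<le> G.ip (G.pact ((1 - shifted_X s) * (p * p)) f) f"
      using L.upper[of p] s by (simp only: zero_le_mult_iff) simp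
    have "1 + shifted_X s = smult (1 / s) ([:0, 1:] + smult (2 * s - 1) 1)"
      using s by (simp add: shifted_X_def one_pCons field_simps)
    then have "(1 + shifted_X s) * (p * p) = smult (1 / s) ([:0, 1:] * (p * p) + smult (2 * s - 1) (p * p))"
      by (simp only: mult_smult_left distrib_right mult_1)
    then have "G.ip (G.pact ((1 + shifted_X s) * (p * p)) f) f =
        1 / s * (G.ip (G.A (G.pact p f)) (G.pact p f) + (2 * s - 1) * G.ip (G.pact p f) (G.pact p f))"
      using G.ip_pact_X[OF f, of p] G.pact_square[OF f f, of p p] by (simp only: L.smult L.add)
    moreover have "0 \<le> G.ip (G.A (G.pact p f)) (G.pact p f) + (2 * s - 1) * G.ip (G.pact p f) (G.pact p f)"
    proof -
      have "(1 - 2 * s) * G.ip (G.pact p f) (G.pact p f) \<le> a * G.ip (G.pact p f) (G.pact p f)"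
        using s G.ip_nonneg by (intro mult_right_mono) auto
      also have "\<dots> \<le> G.ip (G.A (G.pact p f)) (G.pact p f)"
        by (intro spectral_lower_bound[OF spec] G.fin_supp_pact f)
      finally show ?thesis by (simp add: algebra_simps)
    qed
    ultimately show "0 \<le> G.ip (G.pact ((1 + shifted_X s) * (p * p)) f) f"
      using s by simp
  qed
qed

end

section \<open>Finite propagation speed\<close>

text \<open>Extended evenly in the index, so that the three-term recurrence holds at every integer
  and the walk needs no boundary rule at 0.\<close>

definition chebz :: "real poly \<Rightarrow> int \<Rightarrow> real poly" where
  "chebz y k = cheb y (nat \<bar>k\<bar>)"

lemma chebz_step: "chebz y (k + 1) + chebz y (k - 1) = 2 * y * chebz y k"
proof -
  have pos: "chebz y (int n + 1) + chebz y (int n - 1) = 2 * y * chebz y (int n)" for n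
  proof (cases n)
    case (Suc l)
    then have "nat \<bar>int n + 1\<bar> = Suc (Suc l)" "nat \<bar>int n - 1\<bar> = l" "nat \<bar>int n\<bar> = Suc l" by auto
    then show ?thesis unfolding chebz_def by (simp only: cheb.simps)
  qed (simp add: chebz_def)
  show ?thesis
  proof (cases "0 \<le> k")
    case True
    then show ?thesis using pos[of "nat k"] by simp
  next
    case False
    then have "chebz y (k + 1) = chebz y (int (nat (- k)) - 1)" "chebz y (k - 1) = chebz y (int (nat (- k)) + 1)"
      "chebz y k = chebz y (int (nat (- k)))"
      by (auto simp: chebz_def abs_if intro!: arg_cong[of _ _ "cheb y"])
    then show ?thesis using pos[of "nat (- k)"] by (simp add: add.commute)
  qed
qed

section \<open>Walks on the integers and the Chebyshev expansion\<close>

definition fin_supp_int :: "(int \<Rightarrow> real) \<Rightarrow> bool" where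
  "fin_supp_int h \<longleftrightarrow> finite {k. h k \<noteq> 0}"

text \<open>Convolution with a symmetric nearest-neighbour measure. Both beta_s and delta_0 - beta_s
  have this form, so the convolution powers become iterates of such operators.\<close>

definition nn_step :: "real \<Rightarrow> real \<Rightarrow> (int \<Rightarrow> real) \<Rightarrow> int \<Rightarrow> real" where
  "nn_step p q h k = p * h k + q * h (k + 1) + q * h (k - 1)"

lemma fin_supp_int_summable: "fin_supp_int h \<Longrightarrow> (\<lambda>k. h k * g k) summable_on UNIV"
  unfolding fin_supp_int_def
  by (rule finite_nonzero_values_imp_summable_on) (auto elim: finite_subset[rotated])

lemma fin_supp_int_shift: "fin_supp_int h \<Longrightarrow> fin_supp_int (\<lambda>k. h (k + t))"
proof -
  assume "fin_supp_int h"
  then have "finite ((\<lambda>k. k - t) ` {k. h k \<noteq> 0})" by (simp add: fin_supp_int_def)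
  moreover have "{k. h (k + t) \<noteq> 0} \<subseteq> (\<lambda>k. k - t) ` {k. h k \<noteq> 0}"
  proof
    fix k assume "k \<in> {k. h (k + t) \<noteq> 0}"
    then show "k \<in> (\<lambda>k. k - t) ` {k. h k \<noteq> 0}" by (intro image_eqI[of _ _ "k + t"]) auto
  qed
  ultimately show ?thesis unfolding fin_supp_int_def by (rule finite_subset[rotated])
qed

lemma fin_supp_int_abs: "fin_supp_int h \<Longrightarrow> fin_supp_int (\<lambda>k. \<bar>h k\<bar>)"
  by (simp add: fin_supp_int_def)

lemma fin_supp_int_nn_step:
  assumes "fin_supp_int h"
  shows "fin_supp_int (nn_step p q h)"
proof -
  have "{k. nn_step p q h k \<noteq> 0} \<subseteq> {k. h k \<noteq> 0} \<union> {k. h (k + 1) \<noteq> 0} \<union> {k. h (k + (-1)) \<noteq> 0}"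
    by (auto simp: nn_step_def)
  moreover have "finite ({k. h k \<noteq> 0} \<union> {k. h (k + 1) \<noteq> 0} \<union> {k. h (k + (-1)) \<noteq> 0})"
    using assms fin_supp_int_shift[OF assms, of 1] fin_supp_int_shift[OF assms, of "-1"]
    unfolding fin_supp_int_def by blast
  ultimately show ?thesis unfolding fin_supp_int_def by (rule finite_subset)
qed

lemma infsum_shift: "(\<Sum>\<^sub>\<infinity>k. f (k + t)) = (\<Sum>\<^sub>\<infinity>k. f k)" for f :: "int \<Rightarrow> real"
  by (rule infsum_reindex_bij_betw) (rule bij_betw_byWitness[where f' = "\<lambda>k. k - t"]; simp)

lemma infsum_nn_step:
  assumes h: "fin_supp_int h"
  shows "(\<Sum>\<^sub>\<infinity>k. nn_step p q h k * g k) = (\<Sum>\<^sub>\<infinity>k. h k * (p * g k + q * g (k - 1) + q * g (k + 1)))"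
proof -
  have sm: "(\<lambda>k. h (k + t) * g' k) summable_on UNIV" for t g'
    by (intro fin_supp_int_summable fin_supp_int_shift h)
  have "(\<Sum>\<^sub>\<infinity>k. nn_step p q h k * g k) =
      (\<Sum>\<^sub>\<infinity>k. h (k + 0) * (p * g k) + (h (k + 1) * (q * g k) + h (k + (-1)) * (q * g k)))"
    by (intro infsum_cong) (simp add: nn_step_def algebra_simps)
  also have "\<dots> = (\<Sum>\<^sub>\<infinity>k. h (k + 0) * (p * g k)) +
      ((\<Sum>\<^sub>\<infinity>k. h (k + 1) * (q * g k)) + (\<Sum>\<^sub>\<infinity>k. h (k + (-1)) * (q * g k)))"
    by (simp only: infsum_add sm summable_on_add)
  also have "(\<Sum>\<^sub>\<infinity>k. h (k + 1) * (q * g k)) = (\<Sum>\<^sub>\<infinity>k. h k * (q * g (k - 1)))"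
    using infsum_shift[of "\<lambda>k. h k * (q * g (k - 1))" 1] by simp
  also have "(\<Sum>\<^sub>\<infinity>k. h (k + (-1)) * (q * g k)) = (\<Sum>\<^sub>\<infinity>k. h k * (q * g (k + 1)))"
    using infsum_shift[of "\<lambda>k. h k * (q * g (k + 1))" "-1"] by simp
  also have "(\<Sum>\<^sub>\<infinity>k. h (k + 0) * (p * g k)) + ((\<Sum>\<^sub>\<infinity>k. h k * (q * g (k - 1))) + (\<Sum>\<^sub>\<infinity>k. h k * (q * g (k + 1))))
      = (\<Sum>\<^sub>\<infinity>k. h (k + 0) * (p * g k) + (h (k + 0) * (q * g (k - 1)) + h (k + 0) * (q * g (k + 1))))"
    by (simp only: infsum_add sm summable_on_add) simp
  also have "\<dots> = (\<Sum>\<^sub>\<infinity>k. h k * (p * g k + q * g (k - 1) + q * g (k + 1)))"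
    by (intro infsum_cong) (simp add: algebra_simps)
  finally show ?thesis .
qed

lemma l1_nn_step:
  assumes h: "fin_supp_int h"
  shows "(\<Sum>\<^sub>\<infinity>k. \<bar>nn_step p q h k\<bar>) \<le> (\<bar>p\<bar> + 2 * \<bar>q\<bar>) * (\<Sum>\<^sub>\<infinity>k. \<bar>h k\<bar>)"
proof -
  note h' = fin_supp_int_abs[OF h]
  have "(\<Sum>\<^sub>\<infinity>k. \<bar>nn_step p q h k\<bar>) \<le> (\<Sum>\<^sub>\<infinity>k. nn_step \<bar>p\<bar> \<bar>q\<bar> (\<lambda>k. \<bar>h k\<bar>) k)"
  proof (rule infsum_mono)
    show "(\<lambda>k. \<bar>nn_step p q h k\<bar>) summable_on UNIV" "nn_step \<bar>p\<bar> \<bar>q\<bar> (\<lambda>k. \<bar>h k\<bar>) summable_on UNIV"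
      using fin_supp_int_summable[OF fin_supp_int_abs[OF fin_supp_int_nn_step[OF h]], where g = "\<lambda>_. 1"]
        fin_supp_int_summable[OF fin_supp_int_nn_step[OF h'], where g = "\<lambda>_. 1"] by simp_all
    show "\<bar>nn_step p q h k\<bar> \<le> nn_step \<bar>p\<bar> \<bar>q\<bar> (\<lambda>k. \<bar>h k\<bar>) k" for k
      unfolding nn_step_def abs_mult[symmetric] by linarith
  qed
  also have "\<dots> = (\<Sum>\<^sub>\<infinity>k. \<bar>h k\<bar> * (\<bar>p\<bar> * 1 + \<bar>q\<bar> * 1 + \<bar>q\<bar> * 1))"
    using infsum_nn_step[OF h', of "\<bar>p\<bar>" "\<bar>q\<bar>" "\<lambda>_. 1"] by simp
  also have "\<dots> = (\<bar>p\<bar> + 2 * \<bar>q\<bar>) * (\<Sum>\<^sub>\<infinity>k. \<bar>h k\<bar>)"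
    by (subst infsum_cmult_left') (simp add: mult.commute)
  finally show ?thesis .
qed

lemma conv_nn:
  assumes "\<And>k. a k = p * delta0 k + q * delta0 (k + 1) + q * delta0 (k - 1)"
  shows "conv a h = nn_step p q h"
proof
  fix k
  have "conv a h k = (\<Sum>\<^sub>\<infinity>i\<in>{-1, 0, 1}. a i * h (k - i))"
    unfolding conv_def by (rule infsum_cong_neutral) (auto simp: assms delta0_def)
  then show "conv a h k = nn_step p q h k"
    by (simp add: nn_step_def assms delta0_def)
qed

lemma conv_delta0: "conv delta0 h = h"
  using conv_nn[of delta0 1 0 h] by (simp add: nn_step_def fun_eq_iff)

lemma conv_assoc_nn:
  assumes c: "fin_supp_int c"
  shows "conv (nn_step p q c) h = nn_step p q (conv c h)"
proof
  fix k
  have "conv (nn_step p q c) h k = (\<Sum>\<^sub>\<infinity>i. c i * (p * h (k - i) + q * h (k - (i - 1)) + q * h (k - (i + 1))))"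
    unfolding conv_def using infsum_nn_step[OF c, of p q "\<lambda>i. h (k - i)"] .
  also have "\<dots> = (\<Sum>\<^sub>\<infinity>i. c i * h (k - i) * p + (c i * h (k + 1 - i) * q + c i * h (k - 1 - i) * q))"
    by (intro infsum_cong) (simp add: algebra_simps)
  also have "\<dots> = (\<Sum>\<^sub>\<infinity>i. c i * h (k - i) * p) + ((\<Sum>\<^sub>\<infinity>i. c i * h (k + 1 - i) * q) + (\<Sum>\<^sub>\<infinity>i. c i * h (k - 1 - i) * q))"
    by (simp only: mult.assoc infsum_add fin_supp_int_summable[OF c] summable_on_add)
  finally show "conv (nn_step p q c) h k = nn_step p q (conv c h) k"
    by (simp only: infsum_cmult_left' nn_step_def conv_def mult.commute[of p] mult.commute[of q] add.assoc)
qed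

lemma fin_supp_int_delta0: "fin_supp_int delta0"
  unfolding fin_supp_int_def by (rule finite_subset[of _ "{0}"]) (auto simp: delta0_def)

lemma conv_pow_nn:
  assumes a: "\<And>k. a k = p * delta0 k + q * delta0 (k + 1) + q * delta0 (k - 1)"
  shows "conv_pow a n = (nn_step p q ^^ n) delta0" "fin_supp_int (conv_pow a n)"
proof -
  show "conv_pow a n = (nn_step p q ^^ n) delta0"
    by (induction n) (simp_all add: conv_nn[of a, OF a])
  show "fin_supp_int (conv_pow a n)"
    by (induction n) (simp_all add: fin_supp_int_delta0 conv_nn[of a, OF a] fin_supp_int_nn_step)
qed

lemma conv_pow_conv:
  assumes a: "\<And>k. a k = p * delta0 k + q * delta0 (k + 1) + q * delta0 (k - 1)"
  shows "conv (conv_pow a n) h = (nn_step p q ^^ n) h"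
proof (induction n)
  case (Suc n)
  have "conv_pow a (Suc n) = nn_step p q (conv_pow a n)"
    using conv_nn[of a, OF a] by simp
  then show ?case using Suc conv_assoc_nn[OF conv_pow_nn(2)[OF a]] by simp
qed (simp add: conv_delta0)

definition walk_coeff :: "real \<Rightarrow> nat \<Rightarrow> nat \<Rightarrow> int \<Rightarrow> real" where
  "walk_coeff s j n = (nn_step s (- s / 2) ^^ j) ((nn_step (1 - s) (s / 2) ^^ n) delta0)"

lemma walk_coeff_eq:
  "conv (conv_pow (\<lambda>i. delta0 i - lazy_step s i) j) (conv_pow (lazy_step s) n) = walk_coeff s j n"
proof -
  have step: "step k = 1 / 2 * delta0 (k + 1) + 1 / 2 * delta0 (k - 1)" for k
    by (auto simp: step_def delta0_def)
  have 1: "lazy_step s k = (1 - s) * delta0 k + s / 2 * delta0 (k + 1) + s / 2 * delta0 (k - 1)" for k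
    by (simp add: lazy_step_def step algebra_simps)
  have 2: "delta0 k - lazy_step s k = s * delta0 k + (- s / 2) * delta0 (k + 1) + (- s / 2) * delta0 (k - 1)" for k
    by (simp add: 1 algebra_simps)
  show ?thesis
    unfolding conv_pow_conv[of "\<lambda>i. delta0 i - lazy_step s i", OF 2]
      conv_pow_nn(1)[of "lazy_step s", OF 1] walk_coeff_def ..
qed

lemma fin_supp_int_funpow: "fin_supp_int h \<Longrightarrow> fin_supp_int ((nn_step p q ^^ n) h)"
  by (induction n) (auto simp: fin_supp_int_nn_step)

lemma l1_nn_step_funpow:
  "fin_supp_int h \<Longrightarrow> (\<Sum>\<^sub>\<infinity>k. \<bar>(nn_step p q ^^ n) h k\<bar>) \<le> (\<bar>p\<bar> + 2 * \<bar>q\<bar>) ^ n * (\<Sum>\<^sub>\<infinity>k. \<bar>h k\<bar>)"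
proof (induction n)
  case (Suc n)
  have "(\<Sum>\<^sub>\<infinity>k. \<bar>(nn_step p q ^^ Suc n) h k\<bar>) \<le> (\<bar>p\<bar> + 2 * \<bar>q\<bar>) * (\<Sum>\<^sub>\<infinity>k. \<bar>(nn_step p q ^^ n) h k\<bar>)"
    using l1_nn_step[OF fin_supp_int_funpow[OF Suc.prems]] by simp
  also have "\<dots> \<le> (\<bar>p\<bar> + 2 * \<bar>q\<bar>) * ((\<bar>p\<bar> + 2 * \<bar>q\<bar>) ^ n * (\<Sum>\<^sub>\<infinity>k. \<bar>h k\<bar>))"
    using Suc by (intro mult_left_mono) auto
  finally show ?case by (simp add: mult_ac)
qed simp

lemma infsum_delta0: "(\<Sum>\<^sub>\<infinity>k. delta0 k * g k) = g 0"
proof -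
  have "(\<Sum>\<^sub>\<infinity>k. delta0 k * g k) = (\<Sum>\<^sub>\<infinity>k\<in>{0}. delta0 k * g k)"
    by (rule infsum_cong_neutral) (auto simp: delta0_def)
  then show ?thesis by (simp add: delta0_def)
qed

text \<open>Uniformity in \<open>n\<close> holds because beta_s is a probability measure for 0 < s
  <= 1; each factor delta_0 - beta_s has total variation 2s.\<close>

lemma walk_coeff_props:
  assumes s: "0 < s" "s \<le> 1"
  shows "fin_supp_int (walk_coeff s j n)" "(\<Sum>\<^sub>\<infinity>k. \<bar>walk_coeff s j n k\<bar>) \<le> 2 ^ j"
proof -
  show "fin_supp_int (walk_coeff s j n)"
    unfolding walk_coeff_def by (intro fin_supp_int_funpow fin_supp_int_delta0)
  have d1: "(\<Sum>\<^sub>\<infinity>k. \<bar>delta0 k\<bar>) = 1"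
  proof -
    have "\<bar>delta0 k\<bar> = delta0 k * 1" for k by (simp add: delta0_def)
    then show ?thesis using infsum_delta0[of "\<lambda>_. 1"] by (simp only:)
  qed
  have "(\<Sum>\<^sub>\<infinity>k. \<bar>walk_coeff s j n k\<bar>) \<le> (\<bar>s\<bar> + 2 * \<bar>- s / 2\<bar>) ^ j * (\<Sum>\<^sub>\<infinity>k. \<bar>(nn_step (1 - s) (s / 2) ^^ n) delta0 k\<bar>)"
    unfolding walk_coeff_def by (intro l1_nn_step_funpow fin_supp_int_funpow fin_supp_int_delta0)
  also have "\<dots> \<le> (\<bar>s\<bar> + 2 * \<bar>- s / 2\<bar>) ^ j * ((\<bar>1 - s\<bar> + 2 * \<bar>s / 2\<bar>) ^ n * (\<Sum>\<^sub>\<infinity>k. \<bar>delta0 k\<bar>))"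
    by (intro mult_left_mono l1_nn_step_funpow fin_supp_int_delta0) auto
  also have "\<dots> = (2 * s) ^ j" using s by (simp add: d1)
  also have "\<dots> \<le> 2 ^ j" using s by (intro power_mono) auto
  finally show "(\<Sum>\<^sub>\<infinity>k. \<bar>walk_coeff s j n k\<bar>) \<le> 2 ^ j" .
qed

text \<open>The walk with step distribution \<open>\<beta>\<^sub>s\<close> appears because multiplication by \<open>y\<close> maps \<open>T\<^sub>k\<close> to the mean of
  \<open>T\<^sub>k\<^sub>+\<^sub>1\<close> and \<open>T\<^sub>k\<^sub>-\<^sub>1\<close>.\<close>

lemma chebyshev_expansion:
  fixes L :: "real poly \<Rightarrow> real"
  assumes add: "\<And>p q. L (p + q) = L p + L q" and smult: "\<And>c p. L (smult c p) = c * L p"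
    and xy: "x = smult (1 - s) 1 + smult s y"
  shows "(\<Sum>\<^sub>\<infinity>k. walk_coeff s j n k * L (R * chebz y k)) = L ((1 - x) ^ j * x ^ n * R)"
proof -
  have step: "(\<Sum>\<^sub>\<infinity>k. nn_step p q h k * L (R * chebz y k)) = (\<Sum>\<^sub>\<infinity>k. h k * L ((smult p 1 + smult (2 * q) y) * R * chebz y k))"
    if "fin_supp_int h" for p q h R
  proof -
    have "p * L (R * chebz y k) + q * L (R * chebz y (k - 1)) + q * L (R * chebz y (k + 1)) =
        L ((smult p 1 + smult (2 * q) y) * R * chebz y k)" for k
    proof -
      have "smult q (R * chebz y (k - 1)) + smult q (R * chebz y (k + 1)) =
          smult q (R * (chebz y (k + 1) + chebz y (k - 1)))"
        by (simp only: distrib_left smult_add_right add.commute)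
      also have "\<dots> = smult q (R * (2 * (y * chebz y k)))"
        by (simp only: chebz_step mult.assoc)
      also have "\<dots> = smult (2 * q) (R * (y * chebz y k))"
        by (simp add: numeral_poly mult.commute[of q])
      finally have "smult p (R * chebz y k) + (smult q (R * chebz y (k - 1)) + smult q (R * chebz y (k + 1))) =
          (smult p 1 + smult (2 * q) y) * R * chebz y k"
        by (simp only: distrib_right mult_smult_left mult_1 mult.assoc mult.left_commute[of y])
      then have "L ((smult p 1 + smult (2 * q) y) * R * chebz y k) =
          p * L (R * chebz y k) + (q * L (R * chebz y (k - 1)) + q * L (R * chebz y (k + 1)))"
        by (metis add smult)
      then show ?thesis by simp
    qed
    then show ?thesis unfolding infsum_nn_step[OF that] by simp
  qed
  have funpow: "(\<Sum>\<^sub>\<infinity>k. (nn_step p q ^^ j) h k * L (R * chebz y k)) =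
      (\<Sum>\<^sub>\<infinity>k. h k * L ((smult p 1 + smult (2 * q) y) ^ j * R * chebz y k))"
    if "fin_supp_int h" for p q h j R
  proof (induction j arbitrary: R)
    case (Suc j)
    let ?S = "smult p 1 + smult (2 * q) y"
    have "(\<Sum>\<^sub>\<infinity>k. (nn_step p q ^^ Suc j) h k * L (R * chebz y k)) =
        (\<Sum>\<^sub>\<infinity>k. (nn_step p q ^^ j) h k * L (?S * R * chebz y k))"
      using step[OF fin_supp_int_funpow[OF that]] by (simp only: funpow.simps o_apply)
    also have "\<dots> = (\<Sum>\<^sub>\<infinity>k. h k * L (?S ^ j * (?S * R) * chebz y k))"
      by (rule Suc)
    also have "?S ^ j * (?S * R) = ?S ^ Suc j * R"
      by (simp only: power_Suc mult_ac)
    finally show ?case .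
  qed simp
  have x: "smult (1 - s) 1 + smult (2 * (s / 2)) y = x" using xy by simp
  have x1: "smult s 1 + smult (2 * (- s / 2)) y = 1 - x"
    unfolding xy by (simp add: one_pCons)
  have "(\<Sum>\<^sub>\<infinity>k. walk_coeff s j n k * L (R * chebz y k)) =
      (\<Sum>\<^sub>\<infinity>k. delta0 k * L (x ^ n * ((1 - x) ^ j * R) * chebz y k))"
    unfolding walk_coeff_def funpow[OF fin_supp_int_funpow[OF fin_supp_int_delta0]] funpow[OF fin_supp_int_delta0] x x1 by simp
  then show ?thesis by (simp add: infsum_delta0 chebz_def mult_ac)
qed

no_notation Infinite_Set_Sum.abs_summable_on (infix \<open>abs'_summable'_on\<close> 50)

lemma suminf_eq_infsum:
  fixes f :: "nat \<Rightarrow> real"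
  assumes "f abs_summable_on UNIV"
  shows "suminf f = (\<Sum>\<^sub>\<infinity>n. f n)"
  using has_sum_imp_sums[OF has_sum_infsum[OF Infinite_Sum.abs_summable_summable[OF assms]]] by (rule sums_unique[symmetric])

text \<open>Fubini: the double series converges absolutely because \<open>a\<close> is absolutely
  summable, the \<open>c n\<close> are uniformly bounded in l^1, and \<open>g\<close> is bounded.
  Summing over n first yields the sum of f(k) g(k), where only |k| >= q survives.\<close>

lemma weighted_series_bound:
  fixes a :: "nat \<Rightarrow> real" and c :: "nat \<Rightarrow> int \<Rightarrow> real" and g :: "int \<Rightarrow> real"
  assumes a: "summable (\<lambda>n. \<bar>a n\<bar>)"
    and c: "\<And>n. fin_supp_int (c n)" "\<And>n. (\<Sum>\<^sub>\<infinity>k. \<bar>c n k\<bar>) \<le> B"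
    and g: "\<And>k. \<bar>g k\<bar> \<le> G" "\<And>k. \<bar>k\<bar> < int q \<Longrightarrow> g k = 0"
    and f: "\<And>k. f k = (\<Sum>n. a n * c n k)"
    and X: "(\<Sum>\<^sub>\<infinity>k\<in>{k. int q \<le> \<bar>k\<bar>}. ennreal \<bar>f k\<bar>) \<le> ennreal X" "0 \<le> X"
  shows "summable (\<lambda>n. a n * (\<Sum>\<^sub>\<infinity>k. c n k * g k))"
    and "\<bar>(\<Sum>n. a n * (\<Sum>\<^sub>\<infinity>k. c n k * g k))\<bar> \<le> X * G"
proof -
  have G: "0 \<le> G" using g(1)[of 0] by linarith
  have a_abs: "(\<lambda>n. \<bar>a n\<bar>) summable_on UNIV"
    using norm_summable_imp_summable_on[of "\<lambda>n. \<bar>a n\<bar>"] a by simp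
  have c_abs: "(\<lambda>k. \<bar>c n k\<bar> * t k) summable_on UNIV" for n t
    by (intro fin_supp_int_summable fin_supp_int_abs c)
  have c_abs1: "(\<lambda>k. \<bar>c n k\<bar>) summable_on UNIV" for n
    using c_abs[of n "\<lambda>_. 1"] by simp
  have pair: "(\<lambda>(n, k). a n * c n k * t k) abs_summable_on UNIV \<times> UNIV" if t: "\<And>k. \<bar>t k\<bar> \<le> T" for t T
    unfolding Infinite_Sum.abs_summable_on_Sigma_iff
  proof (intro conjI ballI)
    have T: "0 \<le> T" using t[of 0] by linarith
    fix n
    show "(\<lambda>k. case (n, k) of (n, k) \<Rightarrow> a n * c n k * t k) abs_summable_on UNIV"
      using summable_on_cmult_right[OF c_abs[of n "\<lambda>k. \<bar>t k\<bar>"], of "\<bar>a n\<bar>"] by (simp add: abs_mult mult_ac)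
  next
    have T: "0 \<le> T" using t[of 0] by linarith
    have bound: "(\<Sum>\<^sub>\<infinity>k. \<bar>a n * c n k * t k\<bar>) \<le> \<bar>a n\<bar> * (B * T)" for n
    proof -
      have "(\<Sum>\<^sub>\<infinity>k. \<bar>a n * c n k * t k\<bar>) \<le> (\<Sum>\<^sub>\<infinity>k. \<bar>a n\<bar> * T * \<bar>c n k\<bar>)"
      proof (rule infsum_mono)
        show "(\<lambda>k. \<bar>a n * c n k * t k\<bar>) summable_on UNIV"
          using summable_on_cmult_right[OF c_abs[of n "\<lambda>k. \<bar>t k\<bar>"], of "\<bar>a n\<bar>"] by (simp add: abs_mult mult_ac)
        show "(\<lambda>k. \<bar>a n\<bar> * T * \<bar>c n k\<bar>) summable_on UNIV"
          by (intro summable_on_cmult_right c_abs1)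
        show "\<bar>a n * c n k * t k\<bar> \<le> \<bar>a n\<bar> * T * \<bar>c n k\<bar>" for k
          using mult_left_mono[OF t[of k], of "\<bar>a n\<bar> * \<bar>c n k\<bar>"] by (simp add: abs_mult mult_ac)
      qed
      also have "\<dots> = \<bar>a n\<bar> * T * (\<Sum>\<^sub>\<infinity>k. \<bar>c n k\<bar>)" by (rule infsum_cmult_right')
      also have "\<dots> \<le> \<bar>a n\<bar> * T * B" using T c(2) by (intro mult_left_mono) auto
      finally show ?thesis by (simp add: mult_ac)
    qed
    show "(\<lambda>n. \<Sum>\<^sub>\<infinity>k. norm (case (n, k) of (n, k) \<Rightarrow> a n * c n k * t k)) abs_summable_on UNIV"
    proof (rule Infinite_Sum.abs_summable_on_comparison_test)
      show "(\<lambda>n. \<bar>a n\<bar> * (B * T)) abs_summable_on UNIV"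
        using summable_on_cmult_left[OF a_abs, of "\<bar>B * T\<bar>"] by (simp add: abs_mult)
      show "norm (\<Sum>\<^sub>\<infinity>k. norm (case (n, k) of (n, k) \<Rightarrow> a n * c n k * t k)) \<le> norm (\<bar>a n\<bar> * (B * T))" for n
        using bound[of n] infsum_nonneg[of UNIV "\<lambda>k. \<bar>a n * c n k * t k\<bar>"] by simp
    qed
  qed
  have rows: "(\<lambda>n. \<Sum>\<^sub>\<infinity>k. norm (a n * c n k * t k)) summable_on UNIV" if t: "\<And>k. \<bar>t k\<bar> \<le> T" for t T
    using pair[where t = t and T = T, OF t] unfolding Infinite_Sum.abs_summable_on_Sigma_iff by (simp add: infsum_nonneg)
  have row: "(\<Sum>\<^sub>\<infinity>k. a n * c n k * t k) = a n * (\<Sum>\<^sub>\<infinity>k. c n k * t k)" for n t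
    unfolding mult.assoc by (rule infsum_cmult_right')
  have row_abs: "(\<lambda>n. a n * (\<Sum>\<^sub>\<infinity>k. c n k * g k)) abs_summable_on UNIV"
  proof (rule Infinite_Sum.abs_summable_on_comparison_test)
    show "(\<lambda>n. \<Sum>\<^sub>\<infinity>k. norm (a n * c n k * g k)) abs_summable_on UNIV"
      using rows[where t = g and T = G, OF g(1)] by (simp add: infsum_nonneg)
    fix n
    have "(\<lambda>k. a n * c n k * g k) abs_summable_on UNIV"
      using pair[where t = g and T = G, OF g(1)] unfolding Infinite_Sum.abs_summable_on_Sigma_iff by simp
    from norm_infsum_bound[OF this]
    show "norm (a n * (\<Sum>\<^sub>\<infinity>k. c n k * g k)) \<le> norm (\<Sum>\<^sub>\<infinity>k. norm (a n * c n k * g k))"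
      unfolding row by (simp add: infsum_nonneg)
  qed
  show "summable (\<lambda>n. a n * (\<Sum>\<^sub>\<infinity>k. c n k * g k))"
    using has_sum_imp_sums[OF has_sum_infsum[OF Infinite_Sum.abs_summable_summable[OF row_abs]]] by (rule sums_summable)
  have swap_pair: "(\<lambda>(k, n). a n * c n k * t k) abs_summable_on UNIV \<times> UNIV" if t: "\<And>k. \<bar>t k\<bar> \<le> T" for t T
    using iffD1[OF summable_on_swap pair[where t = t and T = T, OF t]] by (simp add: case_prod_unfold)
  have col: "(\<Sum>\<^sub>\<infinity>n. a n * c n k * t k) = f k * t k" for k t
  proof -
    have "(\<lambda>n. a n * c n k * 1) abs_summable_on UNIV"
      using swap_pair[of "\<lambda>_. 1" 1] unfolding Infinite_Sum.abs_summable_on_Sigma_iff by simp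
    then have "f k = (\<Sum>\<^sub>\<infinity>n. a n * c n k)" unfolding f by (intro suminf_eq_infsum) simp
    then show ?thesis by (simp add: infsum_cmult_left')
  qed
  have fg_abs: "(\<lambda>k. f k * t k) abs_summable_on UNIV" if t: "\<And>k. \<bar>t k\<bar> \<le> T" for t T
  proof (rule Infinite_Sum.abs_summable_on_comparison_test)
    show "(\<lambda>k. \<Sum>\<^sub>\<infinity>n. norm (a n * c n k * t k)) abs_summable_on UNIV"
      using swap_pair[where t = t and T = T, OF t] unfolding Infinite_Sum.abs_summable_on_Sigma_iff by simp
    fix k
    have "(\<lambda>n. a n * c n k * t k) abs_summable_on UNIV"
      using swap_pair[where t = t and T = T, OF t] unfolding Infinite_Sum.abs_summable_on_Sigma_iff by simp
    from norm_infsum_bound[OF this]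
    show "norm (f k * t k) \<le> norm (\<Sum>\<^sub>\<infinity>n. norm (a n * c n k * t k))"
      unfolding col by (simp add: infsum_nonneg)
  qed
  have "(\<Sum>n. a n * (\<Sum>\<^sub>\<infinity>k. c n k * g k)) = (\<Sum>\<^sub>\<infinity>n. \<Sum>\<^sub>\<infinity>k. a n * c n k * g k)"
    unfolding row by (rule suminf_eq_infsum[OF row_abs])
  also have "\<dots> = (\<Sum>\<^sub>\<infinity>k. \<Sum>\<^sub>\<infinity>n. a n * c n k * g k)"
    by (rule infsum_swap_banach[OF Infinite_Sum.abs_summable_summable[OF pair[where t = g and T = G, OF g(1)]]])
  also have "\<dots> = (\<Sum>\<^sub>\<infinity>k. f k * g k)" by (simp only: col)
  also have "\<dots> = (\<Sum>\<^sub>\<infinity>k\<in>{k. int q \<le> \<bar>k\<bar>}. f k * g k)"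
    by (rule infsum_cong_neutral) (auto simp: g(2))
  finally have eq: "(\<Sum>n. a n * (\<Sum>\<^sub>\<infinity>k. c n k * g k)) = (\<Sum>\<^sub>\<infinity>k\<in>{k. int q \<le> \<bar>k\<bar>}. f k * g k)" .
  have f_abs: "(\<lambda>k. \<bar>f k\<bar>) summable_on {k. int q \<le> \<bar>k\<bar>}"
    using fg_abs[of "\<lambda>_. 1" 1] by (auto intro: summable_on_subset_banach)
  have fX: "(\<Sum>\<^sub>\<infinity>k\<in>{k. int q \<le> \<bar>k\<bar>}. \<bar>f k\<bar>) \<le> X"
  proof (rule infsum_le_finite_sums[OF f_abs])
    fix F assume F: "finite F" "F \<subseteq> {k. int q \<le> \<bar>k\<bar>}"
    have "ennreal (\<Sum>k\<in>F. \<bar>f k\<bar>) = (\<Sum>k\<in>F. ennreal \<bar>f k\<bar>)" by (simp add: sum_ennreal)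
    also have "\<dots> \<le> (\<Sum>\<^sub>\<infinity>k\<in>{k. int q \<le> \<bar>k\<bar>}. ennreal \<bar>f k\<bar>)"
      unfolding infsum_finite[OF F(1), symmetric]
      by (rule infsum_mono_neutral) (use F in \<open>auto intro: nonneg_summable_on_complete\<close>)
    also note X(1)
    finally show "(\<Sum>k\<in>F. \<bar>f k\<bar>) \<le> X" using X(2) by (simp add: ennreal_le_iff)
  qed
  have "\<bar>(\<Sum>\<^sub>\<infinity>k\<in>{k. int q \<le> \<bar>k\<bar>}. f k * g k)\<bar> \<le> (\<Sum>\<^sub>\<infinity>k\<in>{k. int q \<le> \<bar>k\<bar>}. norm (f k * g k))"
    using fg_abs[where t = g and T = G, OF g(1)] unfolding real_norm_def[symmetric]
    by (intro norm_infsum_bound) (auto intro: summable_on_subset_banach)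
  also have "\<dots> \<le> (\<Sum>\<^sub>\<infinity>k\<in>{k. int q \<le> \<bar>k\<bar>}. \<bar>f k\<bar> * G)"
  proof (rule infsum_mono)
    show "(\<lambda>k. norm (f k * g k)) summable_on {k. int q \<le> \<bar>k\<bar>}"
      using fg_abs[where t = g and T = G, OF g(1)] by (auto intro: summable_on_subset_banach)
    show "(\<lambda>k. \<bar>f k\<bar> * G) summable_on {k. int q \<le> \<bar>k\<bar>}"
      by (intro summable_on_cmult_left f_abs)
  qed (use g(1) in \<open>auto simp: abs_mult intro: mult_left_mono\<close>)
  also have "\<dots> = (\<Sum>\<^sub>\<infinity>k\<in>{k. int q \<le> \<bar>k\<bar>}. \<bar>f k\<bar>) * G" by (rule infsum_cmult_left')
  also have "\<dots> \<le> X * G" using fX G by (intro mult_right_mono)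
  finally show "\<bar>(\<Sum>n. a n * (\<Sum>\<^sub>\<infinity>k. c n k * g k))\<bar> \<le> X * G" unfolding eq .
qed

section \<open>The kernel bound\<close>

lemma sum_le_vol:
  assumes "finite S" "S \<subseteq> B"
  shows "(\<Sum>v\<in>S. ennreal (vm mu v)) \<le> vol mu B"
  unfolding vol_def infsum_finite[OF assms(1), symmetric]
  by (rule infsum_mono_neutral) (use assms(2) in \<open>auto intro: nonneg_summable_on_complete\<close>)

context wgraph
begin

text \<open>Doubling at a radius just above \<open>1/2\<close> compares \<open>m(u)\<close> with the volume of its neighbourhood.\<close>

lemma finite_neighbours:
  assumes dbl: "vol_doubling mu D r0" and r0: "ereal (1 / 2) < r0"
  shows "finite {v. mu u v \<noteq> 0}"
proof (rule ccontr)
  assume inf: "infinite {v. mu u v \<noteq> 0}"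
  \<comment> \<open>For 1/2 < r < 1 the ball of radius r is a single vertex, while that of radius 2r
    contains all neighbours.\<close>
  have "ereal (1 / 2) < min r0 (ereal 1)" using r0 by simp
  then obtain r where r: "ereal (1 / 2) < ereal r" "ereal r < min r0 (ereal 1)"
    using ereal_dense2 by blast
  have r': "1 / 2 < r" "r < 1" "ereal r < r0" using r by auto
  define E where "E = max 1 D"
  have small: "vol mu (gball mu r w) = ennreal (vm mu w)" for w
  proof -
    have "gball mu r w = {w}"
    proof
      show "gball mu r w \<subseteq> {w}"
      proof
        fix x assume "x \<in> gball mu r w"
        then have "gdist mu w x = 0" using r' by (simp add: in_gball)
        then show "x \<in> {w}" by (simp add: gdist_eq_0)
      qed
    qed (use r' in \<open>simp add: in_gball\<close>)
    then show ?thesis by (simp add: vol_def)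
  qed
  have bound: "(\<Sum>v\<in>S. vm mu v) \<le> E * vm mu w" if S: "finite S" "S \<subseteq> {v. mu w v \<noteq> 0}" for S w
  proof -
    have "S \<subseteq> gball mu (2 * r) w"
    proof
      fix v assume "v \<in> S"
      then have "gdist mu w v \<le> 1" using S gdist_nbr by auto
      then show "v \<in> gball mu (2 * r) w" using r' by (simp add: in_gball)
    qed
    then have "(\<Sum>v\<in>S. ennreal (vm mu v)) \<le> vol mu (gball mu (2 * r) w)"
      using S by (intro sum_le_vol)
    also have "\<dots> \<le> ennreal D * vol mu (gball mu r w)"
      using dbl r' unfolding vol_doubling_def by auto
    also have "\<dots> \<le> ennreal E * ennreal (vm mu w)"
      unfolding small by (intro mult_right_mono) (auto simp: E_def intro: ennreal_leI)
    also have "\<dots> = ennreal (E * vm mu w)"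
      using vm_pos[of w] by (intro ennreal_mult[symmetric]) (auto simp: E_def)
    finally show ?thesis
      using vm_pos[of w] less_imp_le[OF vm_pos] by (simp add: sum_ennreal ennreal_le_iff E_def)
  qed
  \<comment> \<open>Each neighbour of \<open>u\<close> has mass at least m(u) / E, and finitely many
    of them have total mass at most E m(u). More than E^2 neighbours are therefore
    impossible.\<close>
  obtain n where n: "E * E < real n" using reals_Archimedean2 by blast
  obtain S where S: "S \<subseteq> {v. mu u v \<noteq> 0}" "finite S" "card S = n"
    using infinite_arbitrarily_large[OF inf] by blast
  have E: "1 \<le> E" by (simp add: E_def)
  have "real n * vm mu u = (\<Sum>v\<in>S. vm mu u)" using S by simp
  also have "\<dots> \<le> (\<Sum>v\<in>S. E * vm mu v)"
  proof (rule sum_mono)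
    fix v assume "v \<in> S"
    then have "mu v u \<noteq> 0" using S(1) mu_sym[of u v] by auto
    then show "vm mu u \<le> E * vm mu v" using bound[of "{u}" v] by simp
  qed
  also have "\<dots> = E * (\<Sum>v\<in>S. vm mu v)" by (simp add: sum_distrib_left)
  also have "\<dots> \<le> E * (E * vm mu u)" using E bound[OF S(2,1)] by (intro mult_left_mono) auto
  finally have "real n * vm mu u \<le> (E * E) * vm mu u" by simp
  then show False using n vm_pos[of u] by simp
qed

end

context loc_fin_graph
begin

lemma doubling_graphI:
  assumes dbl: "vol_doubling mu DX r0" and poi: "Defs.poincare mu PX r0" and D: "1 \<le> D" "DX \<le> D"
  shows "doubling_graph mu r0 D (max 0 PX)"
proof unfold_locales
  show "1 \<le> D" by fact
  show "0 \<le> max 0 PX" by simp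
next
  fix r :: real and u assume r: "0 < r" "ereal r < r0"
  have "ennreal (bv u (2 * r)) \<le> ennreal DX * ennreal (bv u r)"
    using dbl r unfolding vol_doubling_def vol_gball by blast
  also have "\<dots> \<le> ennreal D * ennreal (bv u r)"
    using D by (intro mult_right_mono ennreal_leI) auto
  also have "\<dots> = ennreal (D * bv u r)"
    using D bv_nonneg by (intro ennreal_mult[symmetric]) auto
  finally show "bv u (2 * r) \<le> D * bv u r"
    using D bv_nonneg[of u r] by (simp add: ennreal_le_iff)
next
  fix r :: real and u f assume r: "0 < r" "ereal r < r0"
  have avg: "ball_avg mu f u r = (\<Sum>v\<in>gball mu r u. f v * vm mu v) / bv u r"
    using bv_nonneg by (simp add: ball_avg_def finite_gball vol_gball)
  let ?S = "\<Sum>v\<in>gball mu r u. (f v - (\<Sum>v\<in>gball mu r u. f v * vm mu v) / bv u r)\<^sup>2 * vm mu v"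
  let ?E = "\<Sum>v\<in>gball mu (2 * r) u. energy_at f v"
  have E: "0 \<le> ?E" using energy_at_nonneg by (intro sum_nonneg)
  have "ennreal ?S = (\<Sum>\<^sub>\<infinity>v\<in>gball mu r u. ennreal (\<bar>f v - ball_avg mu f u r\<bar>\<^sup>2 * vm mu v))"
    using less_imp_le[OF vm_pos] by (simp add: avg finite_gball sum_ennreal)
  also have "\<dots> \<le> ennreal (PX * r\<^sup>2) * (\<Sum>\<^sub>\<infinity>v\<in>gball mu (2 * r) u. grad_sq mu f v * ennreal (vm mu v))"
    using poi r unfolding Defs.poincare_def by blast
  also have "(\<Sum>\<^sub>\<infinity>v\<in>gball mu (2 * r) u. grad_sq mu f v * ennreal (vm mu v)) = ennreal ?E"
    using energy_at_nonneg by (simp add: grad_sq_eq finite_gball sum_ennreal)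
  also have "ennreal (PX * r\<^sup>2) * ennreal ?E \<le> ennreal (max 0 PX * r\<^sup>2) * ennreal ?E"
    by (intro mult_right_mono ennreal_leI) auto
  also have "\<dots> = ennreal (max 0 PX * r\<^sup>2 * ?E)"
    using E by (intro ennreal_mult[symmetric]) auto
  finally show "?S \<le> max 0 PX * r\<^sup>2 * ?E"
    using E by (simp add: ennreal_le_iff)
qed

lemma markov_density_eq: "markov_density mu n u v = G.pact ([:0, 1:] ^ n) (G.point v) u"
proof -
  have "markov_pow mu n u v = vm mu v * G.pact ([:0, 1:] ^ n) (G.point v) u"
  proof (induction n arbitrary: u)
    case 0
    then show ?case using vm_pos[of v] by (simp add: G.point_def)
  next
    case (Suc n)
    have "markov_pow mu (Suc n) u v = (\<Sum>\<^sub>\<infinity>w\<in>{w. mu u w \<noteq> 0}. mu u w / vm mu u * (vm mu v * G.pact ([:0, 1:] ^ n) (G.point v) w))"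
      unfolding markov_pow.simps markov_def Suc by (rule infsum_cong_neutral) auto
    also have "\<dots> = (\<Sum>w | mu u w \<noteq> 0. mu u w / vm mu u * (vm mu v * G.pact ([:0, 1:] ^ n) (G.point v) w))"
      by (rule infsum_finite[OF fin_nb])
    also have "\<dots> = vm mu v * G.A (G.pact ([:0, 1:] ^ n) (G.point v)) u"
      unfolding G.A_def sum_divide_distrib sum_distrib_left by (intro sum.cong) auto
    finally show ?case by (simp only: power_Suc G.pact_mult G.pact_X)
  qed
  then show ?thesis using vm_pos[of v] by (simp add: markov_density_def)
qed

text \<open>By symmetry G1 moves to the point mass at \<open>u\<close>; what remains is
  Cauchy-Schwarz and the contraction T_k(Y).\<close>

lemma pact_cheb_bound:
  assumes spec: "l2_spectrum mu (markov_op mu) \<subseteq> complex_of_real ` {a<..1}"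
    and s: "0 < s" "1 - a \<le> 2 * s"
  shows "\<bar>G.pact (G1 * G2 * chebz (shifted_X s) k) (G.point v) u\<bar> \<le>
    sqrt (G.ip (G.pact G1 (G.point u)) (G.pact G1 (G.point u))) * sqrt (G.ip (G.pact G2 (G.point v)) (G.pact G2 (G.point v)))"
proof -
  let ?T = "chebz (shifted_X s) k"
  interpret L: pos_functional "\<lambda>p. G.ip (G.pact p (G.point v)) (G.point v)" "shifted_X s"
    by (rule pos_functional_shifted[OF spec s G.fin_supp_point])
  have sq: "G.ip (G.pact (p * p) (G.point v)) (G.point v) = G.ip (G.pact p (G.point v)) (G.pact p (G.point v))" for p
    by (rule G.pact_square[OF G.fin_supp_point G.fin_supp_point])
  have fs: "fin_supp (G.pact p (G.point x))" for p x
    by (intro G.fin_supp_pact G.fin_supp_point)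
  have "G.pact (G1 * G2 * ?T) (G.point v) u = G.ip (G.pact (G1 * (?T * G2)) (G.point v)) (G.point u)"
    using G.ip_point[OF fs] by (simp only: mult_ac)
  also have "\<dots> = G.ip (G.pact (?T * G2) (G.point v)) (G.pact G1 (G.point u))"
    by (rule G.pact_square[OF G.fin_supp_point G.fin_supp_point])
  finally have "\<bar>G.pact (G1 * G2 * ?T) (G.point v) u\<bar> \<le>
      sqrt (G.ip (G.pact (?T * G2) (G.point v)) (G.pact (?T * G2) (G.point v))) * sqrt (G.ip (G.pact G1 (G.point u)) (G.pact G1 (G.point u)))"
    using G.ip_cauchy_schwarz[OF fs fs] by simp
  also have "\<dots> \<le> sqrt (G.ip (G.pact G2 (G.point v)) (G.pact G2 (G.point v))) * sqrt (G.ip (G.pact G1 (G.point u)) (G.pact G1 (G.point u)))"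
    using L.bdd_sqrt[OF L.bdd_cheb, of "nat \<bar>k\<bar>" G2] G.ip_nonneg
    unfolding sq chebz_def by (intro mult_right_mono) auto
  finally show ?thesis by (simp only: mult.commute)
qed

lemma pact_cheb_zero:
  assumes "nat \<bar>k\<bar> + degree G1 + degree G2 < gdist mu u v"
  shows "G.pact (G1 * G2 * chebz (shifted_X s) k) (G.point v) u = 0"
proof (rule ccontr)
  assume "G.pact (G1 * G2 * chebz (shifted_X s) k) (G.point v) u \<noteq> 0"
  then have "gdist mu v u \<le> degree (G1 * G2 * chebz (shifted_X s) k)" by (rule pact_support)
  also have "\<dots> \<le> degree G1 + degree G2 + degree (chebz (shifted_X s) k)"
    by (meson add_le_mono1 degree_mult_le order.trans)
  also have "degree (chebz (shifted_X s) k) \<le> nat \<bar>k\<bar>"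
    unfolding chebz_def by (rule degree_cheb) (simp add: shifted_X_def)
  finally show False using assms gdist_sym[of u v] by simp
qed

text \<open>(1 - X)^j X^n is expanded in the T_k(Y) with coefficients
  \<open>walk_coeff s j n\<close>. The matrix coefficients of T_k(Y) G1 G2 are at most
  \<open>B\<close> and vanish for |k| < q by finite range, so the sum over n involves only the tail
  of \<open>f_sj F s j\<close> that \<open>class_F\<close> controls.\<close>

lemma matrix_coefficient_bound:
  assumes spec: "l2_spectrum mu (markov_op mu) \<subseteq> complex_of_real ` {a<..1}"
    and s: "0 < s" "s \<le> 1" "1 - a \<le> 2 * s"
    and F: "F \<in> class_F s r \<psi>" and \<psi>: "0 \<le> \<psi> q" and r: "0 < r"
    and far: "q + degree G1 + degree G2 \<le> gdist mu u v"
    and B: "sqrt (G.ip (G.pact G1 (G.point u)) (G.pact G1 (G.point u))) * sqrt (G.ip (G.pact G2 (G.point v)) (G.pact G2 (G.point v))) \<le> B"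
  shows "summable (\<lambda>n. coeff_at_1 F n * G.pact ((1 - [:0, 1:]) ^ j * [:0, 1:] ^ n * (G1 * G2)) (G.point v) u)"
    and "\<bar>(\<Sum>n. coeff_at_1 F n * G.pact ((1 - [:0, 1:]) ^ j * [:0, 1:] ^ n * (G1 * G2)) (G.point v) u)\<bar>
      \<le> (2 * real j / r) ^ (2 * j) * \<psi> q * B"
proof -
  define g where "g k = G.pact (G1 * G2 * chebz (shifted_X s) k) (G.point v) u" for k
  have X: "[:0, 1:] = smult (1 - s) 1 + smult s (shifted_X s)"
    using s by (simp add: shifted_X_def one_pCons)
  have expand: "(\<Sum>\<^sub>\<infinity>k. walk_coeff s j n k * g k) = G.pact ((1 - [:0, 1:]) ^ j * [:0, 1:] ^ n * (G1 * G2)) (G.point v) u" for n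
    unfolding g_def
    by (rule chebyshev_expansion[where L = "\<lambda>p. G.pact p (G.point v) u", OF _ _ X])
      (simp_all add: G.pact_add G.pact_smult)
  have F': "abs_analytic_at_1 F" and Fq: "(\<Sum>\<^sub>\<infinity>k\<in>{k. int q \<le> \<bar>k\<bar>}. ennreal \<bar>f_sj F s j k\<bar>)
      \<le> ennreal ((2 * real j / r) ^ (2 * j) * \<psi> q)"
    using F unfolding class_F_def by auto
  have a: "summable (\<lambda>n. \<bar>coeff_at_1 F n\<bar>)" using F' by (simp add: abs_analytic_at_1_def)
  have f: "f_sj F s j k = (\<Sum>n. coeff_at_1 F n * walk_coeff s j n k)" for k
    unfolding f_sj_def walk_coeff_eq ..
  have g_le: "\<bar>g k\<bar> \<le> B" for k
    unfolding g_def by (rule order.trans[OF pact_cheb_bound[OF spec s(1,3)] B])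
  have g_0: "g k = 0" if "\<bar>k\<bar> < int q" for k
    unfolding g_def by (rule pact_cheb_zero) (use that far in linarith)
  have nonneg: "0 \<le> (2 * real j / r) ^ (2 * j) * \<psi> q" using r \<psi> by simp
  show "summable (\<lambda>n. coeff_at_1 F n * G.pact ((1 - [:0, 1:]) ^ j * [:0, 1:] ^ n * (G1 * G2)) (G.point v) u)"
    unfolding expand[symmetric]
    by (rule weighted_series_bound(1)[OF a walk_coeff_props[OF s(1,2)] g_le _ f Fq nonneg]) (rule g_0)
  show "\<bar>(\<Sum>n. coeff_at_1 F n * G.pact ((1 - [:0, 1:]) ^ j * [:0, 1:] ^ n * (G1 * G2)) (G.point v) u)\<bar>
      \<le> (2 * real j / r) ^ (2 * j) * \<psi> q * B"
    unfolding expand[symmetric]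
    by (rule weighted_series_bound(2)[OF a walk_coeff_props[OF s(1,2)] g_le _ f Fq nonneg]) (rule g_0)
qed

end

lemma partition_of_one:
  assumes "1 \<le> n"
  shows "(\<Sum>i\<le>M. smult (real (M choose i) * (real n)\<^sup>2 ^ (M - i))
    ((1 - [:0, 1:]) ^ (M - i) * (fejer_factor n ^ i * rest_factor n ^ (M - i)))) = 1"
proof -
  have "1 = (fejer_factor n + smult ((real n)\<^sup>2) ((1 - [:0, 1:]) * rest_factor n)) ^ M"
    using fejer_partition[OF assms] by simp
  also have "\<dots> = (\<Sum>i\<le>M. of_nat (M choose i) * fejer_factor n ^ i * smult ((real n)\<^sup>2) ((1 - [:0, 1:]) * rest_factor n) ^ (M - i))"
    by (rule binomial_ring)
  also have "\<dots> = (\<Sum>i\<le>M. smult (real (M choose i) * (real n)\<^sup>2 ^ (M - i))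
      ((1 - [:0, 1:]) ^ (M - i) * (fejer_factor n ^ i * rest_factor n ^ (M - i))))"
  proof (rule sum.cong[OF refl])
    fix i
    have "of_nat c * p * smult t (x * h) ^ l = smult (real c * t ^ l) (x ^ l * (p * h ^ l))" for c l t and p x h :: "real poly"
      by (simp add: smult_power power_mult_distrib of_nat_poly mult_ac)
    then show "of_nat (M choose i) * fejer_factor n ^ i * smult ((real n)\<^sup>2) ((1 - [:0, 1:]) * rest_factor n) ^ (M - i) =
        smult (real (M choose i) * (real n)\<^sup>2 ^ (M - i)) ((1 - [:0, 1:]) ^ (M - i) * (fejer_factor n ^ i * rest_factor n ^ (M - i)))" .
  qed
  finally show ?thesis by simp
qed

lemma factor_prod:
  assumes "i \<le> M"
  shows "p ^ i * h ^ (M - i) = (\<Prod>j<M. if j < i then p else (h :: 'b :: comm_monoid_mult))"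
proof -
  have "(\<Prod>j<M. if j < i then p else h) = (\<Prod>j\<in>{..<M} \<inter> {j. j < i}. p) * (\<Prod>j\<in>{..<M} \<inter> - {j. j < i}. h)"
    by (rule prod.If_cases) simp
  moreover have "{..<M} \<inter> {j. j < i} = {..<i}" "{..<M} \<inter> - {j. j < i} = {i..<M}"
    using assms by auto
  ultimately show ?thesis by simp
qed

context doubling_graph
begin

lemma bv_half_ball:
  assumes "0 < r" "ereal r < r0" "u \<in> gball mu (r / 2) w"
  shows "bv w r \<le> D * bv u r"
proof -
  have "bv w r \<le> bv u (2 * r)"
    using assms by (intro bv_mono gball_subset) (simp add: in_gball)
  also have "\<dots> \<le> D * bv u r" by (intro doubling assms)
  finally show ?thesis .
qed

lemma kernel_bound:
  assumes M: "1 \<le> M" and D: "D = 2 * 4 ^ (M - 1)"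
    and spec: "l2_spectrum mu (markov_op mu) \<subseteq> complex_of_real ` {a<..1}"
    and s: "0 < s" "s \<le> 1" "1 - a \<le> 2 * s"
  shows "\<exists>C>0. \<forall>r \<psi> F w1 w2 q u v. 0 < r \<longrightarrow> ereal r < r0 \<longrightarrow> 0 \<le> \<psi> q \<longrightarrow> F \<in> class_F s r \<psi> \<longrightarrow>
    real (gdist mu w1 w2) = 2 * r + real q \<longrightarrow> u \<in> gball mu (r / 2) w1 \<longrightarrow> v \<in> gball mu (r / 2) w2 \<longrightarrow>
    \<bar>kernel_of mu F u v\<bar> \<le> C / sqrt (bv w1 r * bv w2 r) * \<psi> q"
proof -
  obtain C0 where C0: "0 \<le> C0" and smooth: "\<And>u r n E. 1 / 2 \<le> r \<Longrightarrow> ereal r < r0 \<Longrightarrow> 1 \<le> n \<Longrightarrow>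
      r / (4 * real M) \<le> real n \<Longrightarrow> real (M * (n - 1)) \<le> r / 4 \<Longrightarrow> (\<forall>j<M. E j \<in> {fejer_factor n, rest_factor n}) \<Longrightarrow>
      G.ip (G.pact (\<Prod>j<M. E j) (G.point u)) (G.pact (\<Prod>j<M. E j) (G.point u)) \<le> C0 / bv u r"
    using smoothing[OF M D] by blast
  define c where "c i n = real (M choose i) * (real n)\<^sup>2 ^ (M - i)" for i n
  \<comment> \<open>From n <= 3r and an exponent l <= 2M: n * 2l / r <= 6l <= 12M, raised to the
    power 2l <= 4M.\<close>
  define C1 where "C1 = (\<Sum>i\<le>M. \<Sum>i'\<le>M. real (M choose i) * real (M choose i') * (12 * real M) ^ (4 * M))"
  have C1: "0 \<le> C1" unfolding C1_def by (intro sum_nonneg) auto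
  show ?thesis
  proof (intro exI[of _ "C1 * C0 * D + 1"] conjI allI impI)
    show "0 < C1 * C0 * D + 1" using C0 C1 D_ge by (simp add: add_nonneg_pos)
    fix r \<psi> F w1 w2 and q :: nat and u v
    assume r: "0 < r" "ereal r < r0" and \<psi>: "0 \<le> \<psi> q" and F: "F \<in> class_F s r \<psi>"
      and d: "real (gdist mu w1 w2) = 2 * r + real q"
      and u: "u \<in> gball mu (r / 2) w1" and v: "v \<in> gball mu (r / 2) w2"
    \<comment> \<open>2r is a positive difference of two integers.\<close>
    have r_half: "1 / 2 \<le> r"
    proof -
      have "real q < real (gdist mu w1 w2)" using d r by simp
      then have "real (Suc q) \<le> real (gdist mu w1 w2)"
        by (simp only: of_nat_le_iff Suc_le_eq of_nat_less_iff)
      then show ?thesis using d by simp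
    qed
    \<comment> \<open>Rounding keeps n - 1 <= r / (4M), so that M factors have range at most r/4,
      and n >= r / (4M). The additional 1 is at most 2r, whence n <= 3r.\<close>
    define n where "n = nat \<lfloor>r / (4 * real M)\<rfloor> + 1"
    have n1: "1 \<le> n" by (simp add: n_def)
    have pos: "0 \<le> r / (4 * real M)" using r by simp
    have n_lower: "r / (4 * real M) \<le> real n" unfolding n_def by linarith
    have n_pred: "real (n - 1) \<le> r / (4 * real M)" unfolding n_def using pos by simp
    have n_upper: "real n \<le> 3 * r"
    proof -
      have "r / (4 * real M) \<le> r" using r M by (simp add: divide_le_eq mult_le_cancel_left1)
      then show ?thesis using n_pred n1 r_half by simp
    qed
    have n_deg: "real (M * (n - 1)) \<le> r / 4"
      using mult_left_mono[OF n_pred, of "real M"] M by simp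
    define W where "W i = fejer_factor n ^ i * rest_factor n ^ (M - i)" for i
    have W_prod: "W i = (\<Prod>j<M. if j < i then fejer_factor n else rest_factor n)" if "i \<le> M" for i
      unfolding W_def by (rule factor_prod[OF that])
    have W_deg: "real (degree (W i)) \<le> r / 4" if "i \<le> M" for i
    proof -
      have "degree (W i) \<le> (\<Sum>j<M. degree (if j < i then fejer_factor n else rest_factor n))"
        unfolding W_prod[OF that] by (rule order.trans[OF degree_prod_sum_le]) auto
      also have "\<dots> \<le> (\<Sum>j<M. n - 1)"
        using degree_factors[of n] by (intro sum_mono) auto
      finally have "degree (W i) \<le> M * (n - 1)" by simp
      then have "real (degree (W i)) \<le> real (M * (n - 1))" by (simp only: of_nat_le_iff)
      then show ?thesis using n_deg by linarith
    qed
    have W_norm: "sqrt (G.ip (G.pact (W i) (G.point x)) (G.pact (W i) (G.point x))) \<le> sqrt (C0 / bv x r)" if "i \<le> M" for i x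
      unfolding W_prod[OF that] by (intro real_sqrt_le_mono smooth[OF r_half r(2) n1 n_lower n_deg]) auto
    define B where "B = sqrt (C0 / bv u r) * sqrt (C0 / bv v r)"
    have B0: "0 \<le> B" unfolding B_def using C0 bv_nonneg by simp
    \<comment> \<open>From 2r + q, at most r/2 is lost at each of \<open>u\<close>, \<open>v\<close>
      and r/4 to each of the two products.\<close>
    have far: "q + degree (W i) + degree (W i') \<le> gdist mu u v" if "i \<le> M" "i' \<le> M" for i i'
    proof -
      have "gdist mu w1 w2 \<le> gdist mu w1 u + (gdist mu u v + gdist mu v w2)"
        using gdist_triangle[of w1 w2 u] gdist_triangle[of u w2 v] by linarith
      then have "2 * r + real q \<le> real (gdist mu w1 u) + (real (gdist mu u v) + real (gdist mu v w2))"
        using d by linarith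
      moreover have "real (gdist mu w1 u) < r / 2" "real (gdist mu v w2) < r / 2"
        using u v gdist_sym[of v w2] by (auto simp: in_gball)
      ultimately have "real (q + degree (W i) + degree (W i')) \<le> real (gdist mu u v)"
        using W_deg[OF that(1)] W_deg[OF that(2)] r by simp
      then show ?thesis by (simp only: of_nat_le_iff)
    qed
    define l where "l i i' = (M - i) + (M - i')" for i i'
    define T where "T i i' m = coeff_at_1 F m * G.pact ((1 - [:0, 1:]) ^ l i i' * [:0, 1:] ^ m * (W i * W i')) (G.point v) u" for i i' m
    have bnd: "summable (T i i')" "\<bar>(\<Sum>m. T i i' m)\<bar> \<le> (2 * real (l i i') / r) ^ (2 * l i i') * \<psi> q * B"
      if "i \<le> M" "i' \<le> M" for i i'
    proof -
      have "sqrt (G.ip (G.pact (W i) (G.point u)) (G.pact (W i) (G.point u))) * sqrt (G.ip (G.pact (W i') (G.point v)) (G.pact (W i') (G.point v))) \<le> B"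
        unfolding B_def using W_norm that C0 bv_nonneg G.ip_nonneg by (intro mult_mono) auto
      then show "summable (T i i')" "\<bar>(\<Sum>m. T i i' m)\<bar> \<le> (2 * real (l i i') / r) ^ (2 * l i i') * \<psi> q * B"
        unfolding T_def using matrix_coefficient_bound[OF spec s F \<psi> r(1) far[OF that]] by blast+
    qed
    \<comment> \<open>The partition is inserted twice, once for each end of the kernel. The powers
      of 1 - P are collected with P^m, which leaves \<open>W i\<close> and \<open>W i'\<close> free
      to act on the two point masses.\<close>
    have density: "coeff_at_1 F m * markov_density mu m u v = (\<Sum>i\<le>M. \<Sum>i'\<le>M. c i n * c i' n * T i i' m)" for m
    proof -
      have "[:0, 1:] ^ m = [:0, 1:] ^ m * ((\<Sum>i\<le>M. smult (c i n) ((1 - [:0, 1:]) ^ (M - i) * W i)) *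
          (\<Sum>i'\<le>M. smult (c i' n) ((1 - [:0, 1:]) ^ (M - i') * W i')))"
        using partition_of_one[OF n1, of M] unfolding c_def W_def by simp
      also have "\<dots> = (\<Sum>i\<le>M. \<Sum>i'\<le>M. [:0, 1:] ^ m * (smult (c i n) ((1 - [:0, 1:]) ^ (M - i) * W i) *
          smult (c i' n) ((1 - [:0, 1:]) ^ (M - i') * W i')))"
        unfolding sum_product by (simp only: sum_distrib_left)
      also have "\<dots> = (\<Sum>i\<le>M. \<Sum>i'\<le>M. smult (c i n * c i' n) ((1 - [:0, 1:]) ^ l i i' * [:0, 1:] ^ m * (W i * W i')))"
      proof (intro sum.cong refl)
        fix i i'
        have "x ^ m * (smult t (z ^ e * g) * smult t' (z ^ e' * g')) = smult (t * t') (z ^ (e + e') * x ^ m * (g * g'))"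
          for x z g g' :: "real poly" and t t' e e'
          by (simp add: power_add mult_ac)
        then show "[:0, 1:] ^ m * (smult (c i n) ((1 - [:0, 1:]) ^ (M - i) * W i) * smult (c i' n) ((1 - [:0, 1:]) ^ (M - i') * W i'))
            = smult (c i n * c i' n) ((1 - [:0, 1:]) ^ l i i' * [:0, 1:] ^ m * (W i * W i'))"
          unfolding l_def .
      qed
      finally have "G.pact ([:0, 1:] ^ m) (G.point v) u =
          G.pact (\<Sum>i\<le>M. \<Sum>i'\<le>M. smult (c i n * c i' n) ((1 - [:0, 1:]) ^ l i i' * [:0, 1:] ^ m * (W i * W i'))) (G.point v) u"
        by (rule arg_cong)
      also have "\<dots> = (\<Sum>i\<le>M. \<Sum>i'\<le>M. c i n * c i' n * G.pact ((1 - [:0, 1:]) ^ l i i' * [:0, 1:] ^ m * (W i * W i')) (G.point v) u)"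
      proof -
        have "G.pact (\<Sum>i\<in>I. f i) g x = (\<Sum>i\<in>I. G.pact (f i) g x)" for I :: "nat set" and f g x
          by (induction I rule: infinite_finite_induct) (auto simp: G.pact_add)
        then show ?thesis by (simp only: G.pact_smult)
      qed
      finally show ?thesis
        unfolding markov_density_eq T_def by (simp only: sum_distrib_left mult.left_commute)
    qed
    have "kernel_of mu F u v = (\<Sum>m. \<Sum>i\<le>M. \<Sum>i'\<le>M. c i n * c i' n * T i i' m)"
      unfolding kernel_of_def density ..
    also have "\<dots> = (\<Sum>i\<le>M. \<Sum>m. \<Sum>i'\<le>M. c i n * c i' n * T i i' m)"
      using bnd(1) by (intro suminf_sum summable_sum summable_mult) auto
    also have "\<dots> = (\<Sum>i\<le>M. \<Sum>i'\<le>M. \<Sum>m. c i n * c i' n * T i i' m)"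
      using bnd(1) by (intro sum.cong refl suminf_sum summable_mult) auto
    also have "\<dots> = (\<Sum>i\<le>M. \<Sum>i'\<le>M. c i n * c i' n * (\<Sum>m. T i i' m))"
      using bnd(1) by (intro sum.cong refl suminf_mult) auto
    finally have "\<bar>kernel_of mu F u v\<bar> \<le> (\<Sum>i\<le>M. \<Sum>i'\<le>M. \<bar>c i n * c i' n * (\<Sum>m. T i i' m)\<bar>)"
      by (simp only:) (intro order.trans[OF sum_abs] sum_mono sum_abs)
    also have "\<dots> \<le> (\<Sum>i\<le>M. \<Sum>i'\<le>M. real (M choose i) * real (M choose i') * (12 * real M) ^ (4 * M) * (\<psi> q * B))"
    proof (intro sum_mono)
      fix i i' assume i: "i \<in> {..M}" "i' \<in> {..M}"
      have c0: "0 \<le> c i n * c i' n" by (simp add: c_def)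
      have "\<bar>c i n * c i' n * (\<Sum>m. T i i' m)\<bar> = c i n * c i' n * \<bar>\<Sum>m. T i i' m\<bar>"
        using c0 by (simp only: abs_mult[of "c i n * c i' n"] abs_of_nonneg)
      also have "\<dots> \<le> c i n * c i' n * ((2 * real (l i i') / r) ^ (2 * l i i') * \<psi> q * B)"
        using bnd(2) i c0 by (intro mult_left_mono) auto
      also have "\<dots> = real (M choose i) * real (M choose i') * ((real n) ^ (2 * l i i') * (2 * real (l i i') / r) ^ (2 * l i i')) * (\<psi> q * B)"
        by (simp add: c_def l_def power_mult[symmetric] power_add distrib_left)
      also have "(real n) ^ (2 * l i i') * (2 * real (l i i') / r) ^ (2 * l i i') = (real n * (2 * real (l i i') / r)) ^ (2 * l i i')"
        by (simp only: power_mult_distrib)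
      also have "\<dots> \<le> (12 * real M) ^ (2 * l i i')"
      proof (rule power_mono)
        have "real n * (2 * real (l i i') / r) \<le> 3 * r * (2 * real (l i i') / r)"
          using n_upper r by (intro mult_right_mono) auto
        also have "\<dots> = 6 * real (l i i')" using r by simp
        also have "\<dots> \<le> 6 * real (2 * M)" unfolding l_def by simp
        finally show "real n * (2 * real (l i i') / r) \<le> 12 * real M" by simp
      qed (use r in simp)
      also have "\<dots> \<le> (12 * real M) ^ (4 * M)"
        using M by (intro power_increasing) (auto simp: l_def)
      finally show "\<bar>c i n * c i' n * (\<Sum>m. T i i' m)\<bar> \<le>
          real (M choose i) * real (M choose i') * (12 * real M) ^ (4 * M) * (\<psi> q * B)"
        using \<psi> B0 by (simp add: mult_left_mono mult_right_mono)
    qed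
    also have "\<dots> = C1 * (\<psi> q * B)"
      unfolding C1_def by (simp only: sum_distrib_right)
    also have "\<dots> \<le> C1 * (\<psi> q * (C0 * D / sqrt (bv w1 r * bv w2 r)))"
    proof (intro mult_left_mono C1 \<psi>)
      have p: "0 < bv u r" "0 < bv v r" "0 < bv w1 r" "0 < bv w2 r" using r bv_pos by auto
      have "bv w1 r * bv w2 r \<le> (D * bv u r) * (D * bv v r)"
        using bv_half_ball[OF r u] bv_half_ball[OF r v] p D_ge by (intro mult_mono) auto
      also have "\<dots> = D\<^sup>2 * (bv u r * bv v r)" by (simp add: power2_eq_square)
      finally have "sqrt (bv w1 r * bv w2 r) \<le> D * sqrt (bv u r * bv v r)"
        using D_ge real_sqrt_le_mono by (fastforce simp: real_sqrt_mult)
      moreover have "0 < sqrt (bv w1 r * bv w2 r)" "0 < sqrt (bv u r * bv v r)" using p by auto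
      ultimately have "1 / sqrt (bv u r * bv v r) \<le> D / sqrt (bv w1 r * bv w2 r)" by (simp add: field_simps)
      then have "C0 * (1 / sqrt (bv u r * bv v r)) \<le> C0 * (D / sqrt (bv w1 r * bv w2 r))"
        using C0 by (rule mult_left_mono)
      moreover have "B = C0 * (1 / sqrt (bv u r * bv v r))"
        using C0 p by (simp add: B_def real_sqrt_divide real_sqrt_mult)
      ultimately show "B \<le> C0 * D / sqrt (bv w1 r * bv w2 r)" by simp
    qed
    also have "\<dots> = C1 * C0 * D / sqrt (bv w1 r * bv w2 r) * \<psi> q" by simp
    also have "\<dots> \<le> (C1 * C0 * D + 1) / sqrt (bv w1 r * bv w2 r) * \<psi> q"
      using bv_nonneg by (intro mult_right_mono[OF _ \<psi>] divide_right_mono) auto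
    finally show "\<bar>kernel_of mu F u v\<bar> \<le> (C1 * C0 * D + 1) / sqrt (bv w1 r * bv w2 r) * \<psi> q" .
  qed
qed

end

theorem theorem4p3:
  fixes \<mu> :: "'a \<Rightarrow> 'a \<Rightarrow> real"
    and D_X P_X a s :: real
    and r0 :: ereal
  assumes "weighted_graph \<mu>"
    and "0 < r0"
    and "vol_doubling \<mu> D_X r0"
    and "poincare \<mu> P_X r0"
    and "-1 < a" and "a < 1"
    and "l2_spectrum \<mu> (markov_op \<mu>) \<subseteq> complex_of_real ` {a<..1}"
    and "0 < s" and "s \<le> 1" and "1 - a \<le> 2 * s"
  shows "\<exists>C4>0. \<forall>(r::real) (\<psi> :: nat \<Rightarrow> real) F w1 w2 (q::nat).
           0 < r \<and> ereal r < r0 \<and> (\<forall>n. 0 \<le> \<psi> n) \<and> F \<in> class_F s r \<psi> \<and>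
           real (gdist \<mu> w1 w2) = 2 * r + real q \<longrightarrow>
           (SUP (u, v) \<in> gball \<mu> (r / 2) w1 \<times> gball \<mu> (r / 2) w2. ereal \<bar>kernel_of \<mu> F u v\<bar>)
           \<le> ereal (C4 / sqrt (enn2real (vol \<mu> (gball \<mu> r w1)) * enn2real (vol \<mu> (gball \<mu> r w2)))
                     * \<psi> q)"
proof (cases "ereal (1 / 2) < r0")
  case False
  \<comment> \<open>For r0 <= 1/2 the claim is vacuous, since an integer distance 2r + q with r > 0
    forces r >= 1/2.\<close>
  have "\<not> (0 < r \<and> ereal r < r0 \<and> real (gdist \<mu> w1 w2) = 2 * r + real q)" for r w1 w2 and q :: nat
  proof
    assume r: "0 < r \<and> ereal r < r0 \<and> real (gdist \<mu> w1 w2) = 2 * r + real q"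
    then have "ereal r < ereal (1 / 2)" using False by (meson leI order.strict_trans2)
    moreover have "real q < real (gdist \<mu> w1 w2)" using r by linarith
    then have "real (Suc q) \<le> real (gdist \<mu> w1 w2)"
      by (simp only: of_nat_le_iff Suc_le_eq of_nat_less_iff)
    ultimately show False using r by simp
  qed
  then show ?thesis by (intro exI[of _ 1] conjI allI impI zero_less_one) blast
next
  case True
  interpret wgraph \<mu> by unfold_locales (rule assms(1))
  interpret loc_fin_graph \<mu>
    by unfold_locales (rule finite_neighbours[OF assms(3) True])
  \<comment> \<open>M - 1 = \<open>M0\<close> exceeds log_4 of the given doubling constant, which
    may then be enlarged to the form 2 * 4^(M - 1) required for smoothing.\<close>
  obtain M0 where M0: "D_X < 4 ^ M0" using real_arch_pow[of 4 D_X] by auto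
  define M where "M = Suc M0"
  define D :: real where "D = 2 * 4 ^ (M - 1)"
  have "(1::real) \<le> 4 ^ M0" by (rule one_le_power) simp
  then have D: "1 \<le> D" "D_X \<le> D" using M0 unfolding D_def M_def diff_Suc_1 by linarith+
  interpret doubling_graph \<mu> r0 D "max 0 P_X"
    by (rule doubling_graphI[OF assms(3,4) D])
  have "1 \<le> M" by (simp add: M_def)
  from kernel_bound[OF this D_def assms(7,8,9,10)] obtain C where C: "0 < C"
    "\<And>r \<psi> F w1 w2 q u v. 0 < r \<Longrightarrow> ereal r < r0 \<Longrightarrow> 0 \<le> \<psi> q \<Longrightarrow> F \<in> class_F s r \<psi> \<Longrightarrow>
    real (gdist \<mu> w1 w2) = 2 * r + real q \<Longrightarrow> u \<in> gball \<mu> (r / 2) w1 \<Longrightarrow> v \<in> gball \<mu> (r / 2) w2 \<Longrightarrow>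
    \<bar>kernel_of \<mu> F u v\<bar> \<le> C / sqrt (bv w1 r * bv w2 r) * \<psi> q"
    by blast
  show ?thesis
  proof (intro exI[of _ C] conjI allI impI C(1))
    fix r \<psi> F w1 w2 and q :: nat
    assume H: "0 < r \<and> ereal r < r0 \<and> (\<forall>n. 0 \<le> \<psi> n) \<and> F \<in> class_F s r \<psi> \<and>
      real (gdist \<mu> w1 w2) = 2 * r + real q"
    have "ereal \<bar>kernel_of \<mu> F u v\<bar> \<le> ereal (C / sqrt (bv w1 r * bv w2 r) * \<psi> q)"
      if "u \<in> gball \<mu> (r / 2) w1" "v \<in> gball \<mu> (r / 2) w2" for u v
      using C(2)[of r \<psi> q F w1 w2 u v] H that by simp
    then show "(SUP (u, v) \<in> gball \<mu> (r / 2) w1 \<times> gball \<mu> (r / 2) w2. ereal \<bar>kernel_of \<mu> F u v\<bar>)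
           \<le> ereal (C / sqrt (enn2real (vol \<mu> (gball \<mu> r w1)) * enn2real (vol \<mu> (gball \<mu> r w2))) * \<psi> q)"
      unfolding vol_gball enn2real_ennreal[OF bv_nonneg] by (intro SUP_least) auto
  qed
qed

end
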